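(* Let $M(\varphi,\xi,\eta,g)$ be an almost coKähler manifold. Then the Reeb vector field $\xi$ is a mixed Killing vector field if and only if $h=0$. Moreover, in this case, $M$ is locally a Riemannian product of the real line and an almost Kähler manifold.
   Context: A vector field $V$ on a (semi-)Riemannian manifold $(M,g)$ is a mixed Killing vector field if there exists a non-zero smooth function $f$ on $M$ (the mixed Killing factor) such that $L_VL_Vg=fL_Vg$, where $L_V$ is the Lie derivative along $V$. An almost contact metric manifold $M^{2n+1}(\varphi,\xi,\eta,g)$ ($n\ge 1$) is a Riemannian manifold $(M,g)$ of dimension $2n+1$ with a vector field $\xi$ (the Reeb vector field), a global 1-form $\eta$ and a $(1,1)$ tensor field $\varphi$ such that for all vector fields $X,Y$: $\varphi^2Y=-Y+\eta(Y)\xi$, $\eta(\xi)=1$, $g(\varphi X,\varphi Y)=g(X,Y)-\eta(X)\eta(Y)$. Its fundamental 2-form is $\Phi(X,Y)=g(X,\varphi Y)$. It is almost coKähler if $d\eta=0$ and $d\Phi=0$. On it one defines $h=\frac12L_\xi\varphi$. *)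

theory Defs
  imports "HOL-Analysis.Analysis"
begin

subsection \<open>Smooth maps between Euclidean spaces\<close>

text \<open>Meant for open \<open>S\<close> only: the derivatives are taken at \<open>x\<close>, not within \<open>S\<close>.\<close>

primrec Ck_on :: "nat \<Rightarrow> 'e::euclidean_space set \<Rightarrow> ('e \<Rightarrow> 'f::euclidean_space) \<Rightarrow> bool" where
  "Ck_on 0 S f \<longleftrightarrow> continuous_on S f"
| "Ck_on (Suc k) S f \<longleftrightarrow>
     (\<forall>x\<in>S. f differentiable (at x)) \<and>
     (\<forall>v. Ck_on k S (\<lambda>x. frechet_derivative f (at x) v))"

definition smooth_on :: "'e::euclidean_space set \<Rightarrow> ('e \<Rightarrow> 'f::euclidean_space) \<Rightarrow> bool" where
  "smooth_on S f \<longleftrightarrow> (\<forall>k. Ck_on k S f)"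


subsection \<open>Smooth manifolds\<close>

text \<open>A manifold is given by a (not necessarily maximal) smooth atlas. Its underlying set is the
  union of the chart domains, an open subset of the ambient type, whose class provides the
  Hausdorff property and second countability.\<close>

type_synonym ('a, 'e) chart = "'a set \<times> ('a \<Rightarrow> 'e)"

definition chart_inv :: "('a, 'e) chart \<Rightarrow> 'e \<Rightarrow> 'a" where
  "chart_inv c = inv_into (fst c) (snd c)"

definition is_chart :: "('a::topological_space, 'e::euclidean_space) chart \<Rightarrow> bool" where
  "is_chart c \<longleftrightarrow> open (fst c) \<and> open (snd c ` fst c) \<and>
     homeomorphism (fst c) (snd c ` fst c) (snd c) (chart_inv c)"

definition points :: "('a, 'e) chart set \<Rightarrow> 'a set" where
  "points A = (\<Union>c\<in>A. fst c)"

definition smooth_manifold ::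
  "('a::{t2_space, second_countable_topology}, 'e::euclidean_space) chart set \<Rightarrow> bool" where
  "smooth_manifold A \<longleftrightarrow> points A \<noteq> {} \<and> (\<forall>c\<in>A. is_chart c) \<and>
     (\<forall>c\<in>A. \<forall>d\<in>A. smooth_on (snd c ` (fst c \<inter> fst d)) (snd d \<circ> chart_inv c))"

definition smooth_fun_on ::
  "('a::topological_space, 'e::euclidean_space) chart set \<Rightarrow> 'a set \<Rightarrow> ('a \<Rightarrow> real) \<Rightarrow> bool" where
  "smooth_fun_on A U f \<longleftrightarrow> open U \<and> U \<subseteq> points A \<and>
     (\<forall>c\<in>A. smooth_on (snd c ` (fst c \<inter> U)) (f \<circ> chart_inv c))"

definition smooth_near ::
  "('a::topological_space, 'e::euclidean_space) chart set \<Rightarrow> 'a \<Rightarrow> ('a \<Rightarrow> real) \<Rightarrow> bool" where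
  "smooth_near A p f \<longleftrightarrow> (\<exists>U. p \<in> U \<and> smooth_fun_on A U f)"

definition smooth_map_on ::
  "('a::topological_space, 'e::euclidean_space) chart set \<Rightarrow>
   ('b::topological_space, 'f::euclidean_space) chart set \<Rightarrow> 'a set \<Rightarrow> ('a \<Rightarrow> 'b) \<Rightarrow> bool" where
  "smooth_map_on A B U F \<longleftrightarrow> open U \<and> U \<subseteq> points A \<and> F ` U \<subseteq> points B \<and> continuous_on U F \<and>
     (\<forall>c\<in>A. \<forall>d\<in>B. smooth_on (snd c ` (fst c \<inter> U \<inter> F -` fst d)) (snd d \<circ> F \<circ> chart_inv c))"

definition diffeomorphism_on ::
  "('a::topological_space, 'e::euclidean_space) chart set \<Rightarrow>
   ('b::topological_space, 'f::euclidean_space) chart set \<Rightarrow> 'a set \<Rightarrow> 'b set \<Rightarrow> ('a \<Rightarrow> 'b) \<Rightarrow> bool"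
  where
  "diffeomorphism_on A B U W F \<longleftrightarrow>
     (\<exists>F'. homeomorphism U W F F' \<and> smooth_map_on A B U F \<and> smooth_map_on B A W F')"


subsection \<open>Tangent vectors and vector fields\<close>

text \<open>Tangent vectors at \<open>p\<close> are the derivations at \<open>p\<close> of the algebra of real functions that are
  smooth near \<open>p\<close>. Locality needs no separate axiom: for an open \<open>W\<close> containing \<open>p\<close> the indicator
  of \<open>W\<close> is smooth near \<open>p\<close> and idempotent, so every derivation kills it. The value 0 on all other
  functions makes equality of tangent vectors equality in HOL.\<close>

type_synonym 'a tvec = "('a \<Rightarrow> real) \<Rightarrow> real"
type_synonym 'a vfield = "'a \<Rightarrow> 'a tvec"

definition tangent_space ::
  "('a::topological_space, 'e::euclidean_space) chart set \<Rightarrow> 'a \<Rightarrow> 'a tvec set" where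
  "tangent_space A p = {v.
     (\<forall>f g. smooth_near A p f \<longrightarrow> smooth_near A p g \<longrightarrow>
        v (\<lambda>q. f q + g q) = v f + v g \<and>
        v (\<lambda>q. f q * g q) = f p * v g + g p * v f) \<and>
     (\<forall>a f. smooth_near A p f \<longrightarrow> v (\<lambda>q. a * f q) = a * v f) \<and>
     (\<forall>f. \<not> smooth_near A p f \<longrightarrow> v f = 0)}"

definition tcomb :: "real \<Rightarrow> 'a tvec \<Rightarrow> real \<Rightarrow> 'a tvec \<Rightarrow> 'a tvec" where
  "tcomb a u b v = (\<lambda>f. a * u f + b * v f)"

definition tzero :: "'a tvec" where
  "tzero = (\<lambda>f. 0)"

definition vector_field_on ::
  "('a::topological_space, 'e::euclidean_space) chart set \<Rightarrow> 'a set \<Rightarrow> 'a vfield \<Rightarrow> bool" where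
  "vector_field_on A U X \<longleftrightarrow> open U \<and> U \<subseteq> points A \<and> (\<forall>p\<in>U. X p \<in> tangent_space A p) \<and>
     (\<forall>W f. W \<subseteq> U \<longrightarrow> smooth_fun_on A W f \<longrightarrow> smooth_fun_on A W (\<lambda>p. X p f))"

definition lie_bracket ::
  "('a::topological_space, 'e::euclidean_space) chart set \<Rightarrow> 'a vfield \<Rightarrow> 'a vfield \<Rightarrow> 'a vfield"
  where
  "lie_bracket A X Y = (\<lambda>p f. if smooth_near A p f
     then X p (\<lambda>q. Y q f) - Y p (\<lambda>q. X q f) else 0)"

definition pushforward ::
  "('b::topological_space, 'f::euclidean_space) chart set \<Rightarrow> ('a \<Rightarrow> 'b) \<Rightarrow> 'a \<Rightarrow> 'a tvec \<Rightarrow> 'b tvec"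
  where
  "pushforward B F p v = (\<lambda>f. if smooth_near B (F p) f then v (f \<circ> F) else 0)"


subsection \<open>Tensor fields\<close>

text \<open>Tensor fields are pointwise multilinear; they are smooth if they turn smooth vector fields,
  on arbitrary open subsets, into smooth functions or vector fields.\<close>

definition one_form ::
  "('a::topological_space, 'e::euclidean_space) chart set \<Rightarrow> ('a \<Rightarrow> 'a tvec \<Rightarrow> real) \<Rightarrow> bool" where
  "one_form A \<eta> \<longleftrightarrow>
     (\<forall>p\<in>points A. \<forall>u\<in>tangent_space A p. \<forall>v\<in>tangent_space A p. \<forall>a b.
        \<eta> p (tcomb a u b v) = a * \<eta> p u + b * \<eta> p v) \<and>
     (\<forall>U X. vector_field_on A U X \<longrightarrow> smooth_fun_on A U (\<lambda>p. \<eta> p (X p)))"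

definition endomorphism_field ::
  "('a::topological_space, 'e::euclidean_space) chart set \<Rightarrow> ('a \<Rightarrow> 'a tvec \<Rightarrow> 'a tvec) \<Rightarrow> bool" where
  "endomorphism_field A \<phi> \<longleftrightarrow>
     (\<forall>p\<in>points A. \<forall>u\<in>tangent_space A p. \<phi> p u \<in> tangent_space A p) \<and>
     (\<forall>p\<in>points A. \<forall>u\<in>tangent_space A p. \<forall>v\<in>tangent_space A p. \<forall>a b.
        \<phi> p (tcomb a u b v) = tcomb a (\<phi> p u) b (\<phi> p v)) \<and>
     (\<forall>U X. vector_field_on A U X \<longrightarrow> vector_field_on A U (\<lambda>p. \<phi> p (X p)))"

definition riemannian_metric ::
  "('a::topological_space, 'e::euclidean_space) chart set \<Rightarrow>
   ('a \<Rightarrow> 'a tvec \<Rightarrow> 'a tvec \<Rightarrow> real) \<Rightarrow> bool" where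
  "riemannian_metric A g \<longleftrightarrow>
     (\<forall>p\<in>points A. \<forall>u\<in>tangent_space A p. \<forall>v\<in>tangent_space A p. \<forall>w\<in>tangent_space A p. \<forall>a b.
        g p (tcomb a u b v) w = a * g p u w + b * g p v w) \<and>
     (\<forall>p\<in>points A. \<forall>u\<in>tangent_space A p. \<forall>v\<in>tangent_space A p. g p u v = g p v u) \<and>
     (\<forall>p\<in>points A. \<forall>u\<in>tangent_space A p. u \<noteq> tzero \<longrightarrow> g p u u > 0) \<and>
     (\<forall>U X Y. vector_field_on A U X \<longrightarrow> vector_field_on A U Y \<longrightarrow>
        smooth_fun_on A U (\<lambda>p. g p (X p) (Y p)))"

text \<open>A covariant 2-tensor field seen as an operator on (local) vector fields.\<close>

definition on_fields ::
  "('a \<Rightarrow> 'a tvec \<Rightarrow> 'a tvec \<Rightarrow> real) \<Rightarrow> 'a vfield \<Rightarrow> 'a vfield \<Rightarrow> 'a \<Rightarrow> real" where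
  "on_fields T X Y = (\<lambda>p. T p (X p) (Y p))"

definition lie_deriv_2 ::
  "('a::topological_space, 'e::euclidean_space) chart set \<Rightarrow> 'a vfield \<Rightarrow>
   ('a vfield \<Rightarrow> 'a vfield \<Rightarrow> 'a \<Rightarrow> real) \<Rightarrow> 'a vfield \<Rightarrow> 'a vfield \<Rightarrow> 'a \<Rightarrow> real" where
  "lie_deriv_2 A V T X Y =
     (\<lambda>p. V p (T X Y) - T (lie_bracket A V X) Y p - T X (lie_bracket A V Y) p)"

definition lie_deriv_endo ::
  "('a::topological_space, 'e::euclidean_space) chart set \<Rightarrow> 'a vfield \<Rightarrow>
   ('a \<Rightarrow> 'a tvec \<Rightarrow> 'a tvec) \<Rightarrow> 'a vfield \<Rightarrow> 'a vfield" where
  "lie_deriv_endo A V \<phi> X =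
     (\<lambda>p. tcomb 1 (lie_bracket A V (\<lambda>q. \<phi> q (X q)) p) (- 1) (\<phi> p (lie_bracket A V X p)))"

text \<open>Exterior derivatives without the factors 1/2 and 1/3 that some authors use; only
  closedness matters below.\<close>

definition ext_deriv_1 ::
  "('a::topological_space, 'e::euclidean_space) chart set \<Rightarrow> ('a \<Rightarrow> 'a tvec \<Rightarrow> real) \<Rightarrow>
   'a vfield \<Rightarrow> 'a vfield \<Rightarrow> 'a \<Rightarrow> real" where
  "ext_deriv_1 A \<eta> X Y =
     (\<lambda>p. X p (\<lambda>q. \<eta> q (Y q)) - Y p (\<lambda>q. \<eta> q (X q)) - \<eta> p (lie_bracket A X Y p))"

definition ext_deriv_2 ::
  "('a::topological_space, 'e::euclidean_space) chart set \<Rightarrow> ('a \<Rightarrow> 'a tvec \<Rightarrow> 'a tvec \<Rightarrow> real) \<Rightarrow>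
   'a vfield \<Rightarrow> 'a vfield \<Rightarrow> 'a vfield \<Rightarrow> 'a \<Rightarrow> real" where
  "ext_deriv_2 A \<omega> X Y Z = (\<lambda>p.
     X p (on_fields \<omega> Y Z) + Y p (on_fields \<omega> Z X) + Z p (on_fields \<omega> X Y)
     - on_fields \<omega> (lie_bracket A X Y) Z p - on_fields \<omega> (lie_bracket A Y Z) X p
     - on_fields \<omega> (lie_bracket A Z X) Y p)"

definition closed_1 ::
  "('a::topological_space, 'e::euclidean_space) chart set \<Rightarrow> ('a \<Rightarrow> 'a tvec \<Rightarrow> real) \<Rightarrow> bool" where
  "closed_1 A \<eta> \<longleftrightarrow> (\<forall>U X Y. vector_field_on A U X \<longrightarrow> vector_field_on A U Y \<longrightarrow>
     (\<forall>p\<in>U. ext_deriv_1 A \<eta> X Y p = 0))"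

definition closed_2 ::
  "('a::topological_space, 'e::euclidean_space) chart set \<Rightarrow>
   ('a \<Rightarrow> 'a tvec \<Rightarrow> 'a tvec \<Rightarrow> real) \<Rightarrow> bool" where
  "closed_2 A \<omega> \<longleftrightarrow> (\<forall>U X Y Z. vector_field_on A U X \<longrightarrow> vector_field_on A U Y \<longrightarrow>
     vector_field_on A U Z \<longrightarrow> (\<forall>p\<in>U. ext_deriv_2 A \<omega> X Y Z p = 0))"


subsection \<open>Mixed Killing vector fields\<close>

text \<open>A mixed Killing factor may have zeros; it is only required not to vanish identically.\<close>

definition mixed_killing ::
  "('a::topological_space, 'e::euclidean_space) chart set \<Rightarrow>
   ('a \<Rightarrow> 'a tvec \<Rightarrow> 'a tvec \<Rightarrow> real) \<Rightarrow> 'a vfield \<Rightarrow> bool" where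
  "mixed_killing A g V \<longleftrightarrow> vector_field_on A (points A) V \<and>
     (\<exists>f. smooth_fun_on A (points A) f \<and> (\<exists>p\<in>points A. f p \<noteq> 0) \<and>
        (\<forall>U X Y. vector_field_on A U X \<longrightarrow> vector_field_on A U Y \<longrightarrow>
          (\<forall>p\<in>U. lie_deriv_2 A V (lie_deriv_2 A V (on_fields g)) X Y p
                 = f p * lie_deriv_2 A V (on_fields g) X Y p)))"


subsection \<open>Almost coKaehler and almost Kaehler manifolds\<close>

definition almost_contact_metric ::
  "nat \<Rightarrow> ('a::{t2_space, second_countable_topology}, 'e::euclidean_space) chart set \<Rightarrow>
   ('a \<Rightarrow> 'a tvec \<Rightarrow> 'a tvec) \<Rightarrow> 'a vfield \<Rightarrow> ('a \<Rightarrow> 'a tvec \<Rightarrow> real) \<Rightarrow>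
   ('a \<Rightarrow> 'a tvec \<Rightarrow> 'a tvec \<Rightarrow> real) \<Rightarrow> bool" where
  "almost_contact_metric n A \<phi> \<xi> \<eta> g \<longleftrightarrow>
     n \<ge> 1 \<and> DIM('e) = 2 * n + 1 \<and> smooth_manifold A \<and> riemannian_metric A g \<and>
     vector_field_on A (points A) \<xi> \<and> one_form A \<eta> \<and> endomorphism_field A \<phi> \<and>
     (\<forall>p\<in>points A. \<eta> p (\<xi> p) = 1) \<and>
     (\<forall>p\<in>points A. \<forall>v\<in>tangent_space A p. \<phi> p (\<phi> p v) = tcomb (- 1) v (\<eta> p v) (\<xi> p)) \<and>
     (\<forall>p\<in>points A. \<forall>u\<in>tangent_space A p. \<forall>v\<in>tangent_space A p.
        g p (\<phi> p u) (\<phi> p v) = g p u v - \<eta> p u * \<eta> p v)"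

definition fundamental_form ::
  "('a \<Rightarrow> 'a tvec \<Rightarrow> 'a tvec) \<Rightarrow> ('a \<Rightarrow> 'a tvec \<Rightarrow> 'a tvec \<Rightarrow> real) \<Rightarrow>
   'a \<Rightarrow> 'a tvec \<Rightarrow> 'a tvec \<Rightarrow> real" where
  "fundamental_form \<phi> g = (\<lambda>p u v. g p u (\<phi> p v))"

definition almost_coKaehler ::
  "nat \<Rightarrow> ('a::{t2_space, second_countable_topology}, 'e::euclidean_space) chart set \<Rightarrow>
   ('a \<Rightarrow> 'a tvec \<Rightarrow> 'a tvec) \<Rightarrow> 'a vfield \<Rightarrow> ('a \<Rightarrow> 'a tvec \<Rightarrow> real) \<Rightarrow>
   ('a \<Rightarrow> 'a tvec \<Rightarrow> 'a tvec \<Rightarrow> real) \<Rightarrow> bool" where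
  "almost_coKaehler n A \<phi> \<xi> \<eta> g \<longleftrightarrow> almost_contact_metric n A \<phi> \<xi> \<eta> g \<and>
     closed_1 A \<eta> \<and> closed_2 A (fundamental_form \<phi> g)"

definition h_tensor ::
  "('a::topological_space, 'e::euclidean_space) chart set \<Rightarrow>
   ('a \<Rightarrow> 'a tvec \<Rightarrow> 'a tvec) \<Rightarrow> 'a vfield \<Rightarrow> 'a vfield \<Rightarrow> 'a vfield" where
  "h_tensor A \<phi> \<xi> X = (\<lambda>p f. lie_deriv_endo A \<xi> \<phi> X p f / 2)"

definition h_vanishes ::
  "('a::topological_space, 'e::euclidean_space) chart set \<Rightarrow>
   ('a \<Rightarrow> 'a tvec \<Rightarrow> 'a tvec) \<Rightarrow> 'a vfield \<Rightarrow> bool" where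
  "h_vanishes A \<phi> \<xi> \<longleftrightarrow>
     (\<forall>U X. vector_field_on A U X \<longrightarrow> (\<forall>p\<in>U. h_tensor A \<phi> \<xi> X p = tzero))"

definition almost_Kaehler ::
  "('a::{t2_space, second_countable_topology}, 'e::euclidean_space) chart set \<Rightarrow>
   ('a \<Rightarrow> 'a tvec \<Rightarrow> 'a tvec) \<Rightarrow> ('a \<Rightarrow> 'a tvec \<Rightarrow> 'a tvec \<Rightarrow> real) \<Rightarrow> bool" where
  "almost_Kaehler B J k \<longleftrightarrow>
     smooth_manifold B \<and> riemannian_metric B k \<and> endomorphism_field B J \<and>
     (\<forall>p\<in>points B. \<forall>v\<in>tangent_space B p. J p (J p v) = tcomb (- 1) v 0 v) \<and>
     (\<forall>p\<in>points B. \<forall>u\<in>tangent_space B p. \<forall>v\<in>tangent_space B p. k p (J p u) (J p v) = k p u v) \<and>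
     closed_2 B (fundamental_form J k)"


subsection \<open>Riemannian products and local isometries\<close>

definition product_atlas :: "('a, 'e) chart set \<Rightarrow> ('b, 'f) chart set \<Rightarrow> ('a \<times> 'b, 'e \<times> 'f) chart set"
  where
  "product_atlas A B = {(fst c \<times> fst d, map_prod (snd c) (snd d)) |c d. c \<in> A \<and> d \<in> B}"

definition product_metric ::
  "('a::topological_space, 'e::euclidean_space) chart set \<Rightarrow>
   ('b::topological_space, 'f::euclidean_space) chart set \<Rightarrow>
   ('a \<Rightarrow> 'a tvec \<Rightarrow> 'a tvec \<Rightarrow> real) \<Rightarrow> ('b \<Rightarrow> 'b tvec \<Rightarrow> 'b tvec \<Rightarrow> real) \<Rightarrow>
   ('a \<times> 'b) \<Rightarrow> ('a \<times> 'b) tvec \<Rightarrow> ('a \<times> 'b) tvec \<Rightarrow> real" where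
  "product_metric A B g k = (\<lambda>p u v.
     g (fst p) (pushforward A fst p u) (pushforward A fst p v) +
     k (snd p) (pushforward B snd p u) (pushforward B snd p v))"

definition real_line :: "(real, real) chart set" where
  "real_line = {(UNIV, id)}"

text \<open>The standard metric of the real line: the component of a tangent vector with respect to
  \<open>d/dt\<close> is its value on the identity.\<close>

definition real_line_metric :: "real \<Rightarrow> real tvec \<Rightarrow> real tvec \<Rightarrow> real" where
  "real_line_metric = (\<lambda>t u v. u id * v id)"

definition locally_isometric_at ::
  "('a::topological_space, 'e::euclidean_space) chart set \<Rightarrow>
   ('a \<Rightarrow> 'a tvec \<Rightarrow> 'a tvec \<Rightarrow> real) \<Rightarrow>
   ('b::topological_space, 'f::euclidean_space) chart set \<Rightarrow>
   ('b \<Rightarrow> 'b tvec \<Rightarrow> 'b tvec \<Rightarrow> real) \<Rightarrow> 'a \<Rightarrow> bool" where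
  "locally_isometric_at A g B k p \<longleftrightarrow>
     (\<exists>U W F. p \<in> U \<and> diffeomorphism_on A B U W F \<and>
        (\<forall>q\<in>U. \<forall>u\<in>tangent_space A q. \<forall>v\<in>tangent_space A q.
           g q u v = k (F q) (pushforward B F q u) (pushforward B F q v)))"

text \<open>HOL cannot quantify existentially over the type carrying the second factor. As the condition
  is local, it loses nothing to look for that factor among the manifolds whose points lie in its
  own model space \<open>'f\<close>: any \<open>'f\<close>-dimensional manifold may be replaced by the image of a chart.\<close>

definition locally_real_line_times_almost_Kaehler ::
  "'f::euclidean_space itself \<Rightarrow>
   ('a::topological_space, 'e::euclidean_space) chart set \<Rightarrow>
   ('a \<Rightarrow> 'a tvec \<Rightarrow> 'a tvec \<Rightarrow> real) \<Rightarrow> bool" where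
  "locally_real_line_times_almost_Kaehler (_ :: 'f itself) A g \<longleftrightarrow>
     (\<forall>p\<in>points A. \<exists>(B :: ('f, 'f) chart set) J k. almost_Kaehler B J k \<and>
        locally_isometric_at A g (product_atlas real_line B)
          (product_metric real_line B real_line_metric k) p)"

end

theory Submission
  imports Defs
begin

text \<open>
  Put \<open>P = L\<^sub>\<xi> \<phi> = 2h\<close>, \<open>T = L\<^sub>\<xi> g\<close> and \<open>Q = L\<^sub>\<xi> P\<close>. As \<open>\<xi>\<close> is in the kernel of \<open>\<Phi>\<close> and \<open>\<eta>\<close>, \<open>\<Phi>\<close> are
  closed, \<open>L\<^sub>\<xi> \<eta> = 0\<close> and \<open>L\<^sub>\<xi> \<Phi> = 0\<close>, that is, \<open>T(X, \<phi>Y) = - g(X, PY)\<close> and \<open>T(X, Y) = g(\<phi>X, PY)\<close>.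
  Differentiating both, \<open>(L\<^sub>\<xi> T)(X, \<phi>Y) = - 2 T(X, PY) - g(X, QY)\<close> and
  \<open>(L\<^sub>\<xi> T)(X, Y) = g(\<phi>X, QY)\<close>. If \<open>L\<^sub>\<xi> T = f T\<close>, comparing the two formulas yields
  \<open>0 = T(\<phi>X, PX) = - g(PX, PX)\<close>, so \<open>P = 0\<close>.

  Conversely \<open>h = 0\<close> gives \<open>T = 0\<close>. Around any point there are coordinates \<open>(t, y)\<close> in which \<open>\<xi>\<close> is the
  derivative in \<open>t\<close> and \<open>\<eta> = dt\<close>. As the flow of \<open>\<xi>\<close> preserves \<open>g\<close> and \<open>\<Phi>\<close>, the metric is
  \<open>dt\<^sup>2 + k\<close> with \<open>k\<close> independent of \<open>t\<close>, and \<open>\<Phi>\<close> is the pullback of a closed form in \<open>y\<close>; so \<open>k\<close>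
  and the restriction of \<open>\<phi>\<close> make the slice \<open>t = 0\<close> almost Kaehler. The coordinates rest on
  the smoothness of flows, obtained by induction on the order of differentiability: the derivative of
  a solution in a parameter solves a linear equation of the same kind.
\<close>

subsection \<open>Calculus of \<open>C\<^sup>k\<close> maps\<close>

text \<open>\<Phi> is invariant along \<xi> on every almost coKaehler manifold; h = 0 adds the
  invariance of g. The flow itself lives in a single chart and only builds the coordinates.

  The encoding shapes the rest. Tangent vectors are abstract derivations, so Hadamard's lemma is
  needed before they have components at all. Tensors are controlled through smooth fields on open
  sets, so the identities are proved for local fields, and T has to be rewritten pointwise before
  its additivity can be used. The flow time becomes a function of the point through a local
  potential of \<eta>, hence Poincare's lemma. Finally the flow yields a parametrisation, which a
  smooth inverse function theorem must turn into a chart.\<close>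

lemma Ck_on_subset: "Ck_on k S f \<Longrightarrow> T \<subseteq> S \<Longrightarrow> Ck_on k T f"
  by (induction k arbitrary: f) (auto intro: continuous_on_subset)

lemma frechet_derivative_cong_open:
  assumes "open S" "x \<in> S" "\<And>y. y \<in> S \<Longrightarrow> f y = g y"
  shows "frechet_derivative f (at x) = frechet_derivative g (at x)"
proof -
  have "(f has_derivative D) (at x) \<longleftrightarrow> (g has_derivative D) (at x)" for D
    using has_derivative_transform_within_open[OF _ assms(1,2)] assms(3) by metis
  then show ?thesis unfolding frechet_derivative_def by simp
qed

lemma differentiable_cong_open:
  assumes "open S" "x \<in> S" "\<And>y. y \<in> S \<Longrightarrow> f y = g y"
  shows "f differentiable (at x) \<longleftrightarrow> g differentiable (at x)"
  unfolding differentiable_def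
  using has_derivative_transform_within_open[OF _ assms(1,2)] assms(3) by metis

lemma Ck_on_cong:
  assumes "open S" "\<And>x. x \<in> S \<Longrightarrow> f x = g x"
  shows "Ck_on k S f \<longleftrightarrow> Ck_on k S g"
  using assms(2)
proof (induction k arbitrary: f g)
  case 0
  then show ?case by (auto intro: continuous_on_cong)
next
  case (Suc k)
  have "frechet_derivative f (at x) = frechet_derivative g (at x)" if "x \<in> S" for x
    using frechet_derivative_cong_open[OF assms(1) that] Suc.prems by blast
  then have "Ck_on k S (\<lambda>x. frechet_derivative f (at x) v) \<longleftrightarrow>
      Ck_on k S (\<lambda>x. frechet_derivative g (at x) v)" for v
    by (intro Suc.IH) auto
  moreover have "f differentiable (at x) \<longleftrightarrow> g differentiable (at x)" if "x \<in> S" for x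
    using differentiable_cong_open[OF assms(1) that] Suc.prems by blast
  ultimately show ?case by auto
qed

lemma Ck_on_transform:
  "open S \<Longrightarrow> Ck_on k S f \<Longrightarrow> (\<And>x. x \<in> S \<Longrightarrow> f x = g x) \<Longrightarrow> Ck_on k S g"
  using Ck_on_cong by blast

text \<open>\<open>frechet_derivative\<close> is a choice term; by uniqueness of derivatives any
  explicit formula \<open>f'\<close> may replace it, and only its values in fixed directions have to
  be of class C^k.\<close>

lemma Ck_on_Suc_I:
  assumes "open S" "\<And>x. x \<in> S \<Longrightarrow> (f has_derivative f' x) (at x)" "\<And>v. Ck_on k S (\<lambda>x. f' x v)"
  shows "Ck_on (Suc k) S f"
proof -
  have "frechet_derivative f (at x) = f' x" if "x \<in> S" for x
    using frechet_derivative_at[OF assms(2)[OF that]] by simp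
  then have "Ck_on k S (\<lambda>x. frechet_derivative f (at x) v)" for v
    using Ck_on_cong[OF assms(1), of "\<lambda>x. frechet_derivative f (at x) v" "\<lambda>x. f' x v"] assms(3) by simp
  then show ?thesis using assms(2) by (auto simp: differentiable_def)
qed

lemma Ck_on_Suc_has_derivative:
  "Ck_on (Suc k) S f \<Longrightarrow> x \<in> S \<Longrightarrow> (f has_derivative frechet_derivative f (at x)) (at x)"
  using frechet_derivative_works by auto

lemma Ck_on_Suc_D: "Ck_on (Suc k) S f \<Longrightarrow> Ck_on k S f"
proof (induction k arbitrary: f)
  case 0
  then show ?case
    by (auto intro!: continuous_at_imp_continuous_on differentiable_imp_continuous_within)
next
  case (Suc k)
  then show ?case by (metis Ck_on.simps(2))
qed

lemma Ck_on_le: "Ck_on m S f \<Longrightarrow> k \<le> m \<Longrightarrow> Ck_on k S f"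
  by (induction m) (auto simp: le_Suc_eq simp del: Ck_on.simps dest: Ck_on_Suc_D)

lemma Ck_on_continuous: "Ck_on k S f \<Longrightarrow> continuous_on S f"
  using Ck_on_le[of k S f 0] by simp

text \<open>Derivatives are taken at a point and not within a set, so the order of differentiability
  can be tested near each point separately. Solutions of differential equations use this, since
  their parameter derivatives are constructed only on smaller time intervals.\<close>

lemma Ck_on_local:
  assumes "\<And>x. x \<in> S \<Longrightarrow> \<exists>T. open T \<and> x \<in> T \<and> Ck_on k T f"
  shows "Ck_on k S f"
  using assms
proof (induction k arbitrary: f)
  case 0
  have "continuous (at x) f" if "x \<in> S" for x
  proof -
    obtain T where "open T" "x \<in> T" "continuous_on T f" using 0[OF \<open>x \<in> S\<close>] by auto
    then show ?thesis by (simp add: continuous_on_eq_continuous_at)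
  qed
  then show ?case by (simp add: continuous_at_imp_continuous_on)
next
  case (Suc k)
  have "Ck_on k S (\<lambda>x. frechet_derivative f (at x) v)" for v
    by (rule Suc.IH) (metis Ck_on.simps(2) Suc.prems)
  then show ?case using Suc.prems by (metis Ck_on.simps(2))
qed

lemma Ck_on_const: "Ck_on k S (\<lambda>x. c)"
  by (induction k arbitrary: c) auto

lemma Ck_on_linear:
  fixes f :: "'e::euclidean_space \<Rightarrow> 'f::euclidean_space"
  assumes "linear f" shows "Ck_on k S f"
proof -
  have "(f has_derivative f) (at x)" for x
    using assms by (simp add: bounded_linear_imp_has_derivative linear_conv_bounded_linear)
  then have *: "frechet_derivative f (at x) = f" "f differentiable (at x)" for x
    using frechet_derivative_at by (metis, auto simp: differentiable_def)
  show ?thesis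
    by (cases k) (auto simp: * Ck_on_const linear_continuous_on assms linear_linear)
qed

lemma Ck_on_compose_linear:
  fixes L :: "'f::euclidean_space \<Rightarrow> 'g::euclidean_space"
  assumes "linear L" "open S" "Ck_on k S f"
  shows "Ck_on k S (\<lambda>x. L (f x))"
  using assms(3)
proof (induction k arbitrary: f)
  case 0
  then show ?case
    using assms(1) linear_continuous_on_compose linear_linear by (simp, blast)
next
  case (Suc k)
  have "bounded_linear L" using assms(1) by (simp add: linear_linear)
  then have "((\<lambda>x. L (f x)) has_derivative (\<lambda>v. L (frechet_derivative f (at x) v))) (at x)"
    if "x \<in> S" for x
    using Ck_on_Suc_has_derivative[OF Suc.prems that] bounded_linear.has_derivative by blast
  then show ?case
    using Suc by (intro Ck_on_Suc_I[OF assms(2)]) auto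
qed

lemma Ck_on_add:
  assumes "open S" "Ck_on k S f" "Ck_on k S g"
  shows "Ck_on k S (\<lambda>x. f x + g x)"
  using assms(2,3)
proof (induction k arbitrary: f g)
  case 0 then show ?case by (simp add: continuous_on_add)
next
  case (Suc k)
  have "((\<lambda>x. f x + g x) has_derivative
      (\<lambda>v. frechet_derivative f (at x) v + frechet_derivative g (at x) v)) (at x)" if "x \<in> S" for x
    using Suc.prems that by (intro has_derivative_add Ck_on_Suc_has_derivative)
  then show ?case using Suc by (intro Ck_on_Suc_I[OF assms(1)]) auto
qed

lemma Ck_on_sum:
  assumes "open S" "\<And>i. i \<in> I \<Longrightarrow> Ck_on k S (f i)"
  shows "Ck_on k S (\<lambda>x. \<Sum>i\<in>I. f i x)"
proof (cases "finite I")
  case True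
  then show ?thesis using assms(2)
    by (induction I) (auto simp: Ck_on_const intro!: Ck_on_add assms(1))
qed (simp add: Ck_on_const)

lemma Ck_on_bilinear:
  fixes B :: "'f::euclidean_space \<Rightarrow> 'g::euclidean_space \<Rightarrow> 'h::euclidean_space"
  assumes "bounded_bilinear B" "open S" "Ck_on k S f" "Ck_on k S g"
  shows "Ck_on k S (\<lambda>x. B (f x) (g x))"
  using assms(3,4)
proof (induction k arbitrary: f g)
  case 0 then show ?case using bounded_bilinear.continuous_on[OF assms(1)] by simp
next
  case (Suc k)
  have "((\<lambda>x. B (f x) (g x)) has_derivative
      (\<lambda>v. B (f x) (frechet_derivative g (at x) v) + B (frechet_derivative f (at x) v) (g x))) (at x)"
    if "x \<in> S" for x
    using bounded_bilinear.FDERIV[OF assms(1) Ck_on_Suc_has_derivative[OF Suc.prems(1) that]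
        Ck_on_Suc_has_derivative[OF Suc.prems(2) that]] .
  moreover have "Ck_on k S (\<lambda>x. B (f x) (frechet_derivative g (at x) v) +
      B (frechet_derivative f (at x) v) (g x))" for v
    using Suc.prems Ck_on_Suc_D[OF Suc.prems(1)] Ck_on_Suc_D[OF Suc.prems(2)]
    by (intro Ck_on_add[OF assms(2)] Suc.IH) simp_all
  ultimately show ?case by (intro Ck_on_Suc_I[OF assms(2)])
qed

lemma Ck_on_componentwise:
  fixes f :: "'e::euclidean_space \<Rightarrow> 'f::euclidean_space"
  assumes "open S"
  shows "Ck_on k S f \<longleftrightarrow> (\<forall>b\<in>Basis. Ck_on k S (\<lambda>x. f x \<bullet> b))"
proof
  assume "Ck_on k S f"
  then show "\<forall>b\<in>Basis. Ck_on k S (\<lambda>x. f x \<bullet> b)"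
    by (auto intro!: Ck_on_compose_linear[where L = "\<lambda>y. y \<bullet> _"] assms
        simp: bounded_linear.linear bounded_linear_inner_left)
next
  assume *: "\<forall>b\<in>Basis. Ck_on k S (\<lambda>x. f x \<bullet> b)"
  have "Ck_on k S (\<lambda>x. \<Sum>b\<in>Basis. (f x \<bullet> b) *\<^sub>R b)"
    by (intro Ck_on_sum assms Ck_on_compose_linear[where L = "\<lambda>r. r *\<^sub>R _"])
      (use * in \<open>auto simp: bounded_linear.linear bounded_linear_scaleR_left\<close>)
  then show "Ck_on k S f" by (simp add: euclidean_representation)
qed

lemma frechet_derivative_linear:
  assumes "(f has_derivative D) (at x)"
  shows "linear (frechet_derivative f (at x))"
  using assms by (simp add: linear_frechet_derivative differentiableI)

lemma linear_basis_expansion: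
  fixes L :: "'e::euclidean_space \<Rightarrow> 'f::real_vector"
  assumes "linear L" shows "L v = (\<Sum>b\<in>Basis. (v \<bullet> b) *\<^sub>R L b)"
proof -
  have "L v = L (\<Sum>b\<in>Basis. (v \<bullet> b) *\<^sub>R b)" by (simp add: euclidean_representation)
  then show ?thesis by (simp add: linear_sum[OF assms] linear_scale[OF assms])
qed

text \<open>Induction on k for all f at once. Expanding the inner derivative in the basis turns the
  chain rule into a sum of products: a component of the derivative of g times the derivative of f in
  a fixed direction, composed with g. The induction hypothesis covers the second factor.\<close>

lemma Ck_on_compose:
  fixes f :: "'f::euclidean_space \<Rightarrow> 'g::euclidean_space" and g :: "'e::euclidean_space \<Rightarrow> 'f"
  assumes "open S" "open T" "Ck_on k T f" "Ck_on k S g" "g ` S \<subseteq> T"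
  shows "Ck_on k S (\<lambda>x. f (g x))"
  using assms(3,4)
proof (induction k arbitrary: f)
  case 0
  then show ?case using assms(5) by (auto intro: continuous_on_compose2)
next
  case (Suc k)
  let ?f = "\<lambda>x. frechet_derivative f (at x)" and ?g = "\<lambda>x. frechet_derivative g (at x)"
  have D: "((\<lambda>x. f (g x)) has_derivative (\<lambda>v. ?f (g x) (?g x v))) (at x)" if "x \<in> S" for x
    using has_derivative_compose[OF Ck_on_Suc_has_derivative[OF Suc.prems(2) that]]
      Ck_on_Suc_has_derivative[OF Suc.prems(1)] assms(5) that by blast
  have "Ck_on k S (\<lambda>x. \<Sum>b\<in>Basis. (?g x v \<bullet> b) *\<^sub>R ?f (g x) b)" for v
  proof (intro Ck_on_sum assms Ck_on_bilinear[where B = scaleR, OF bounded_bilinear_scaleR])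
    fix b :: 'f assume b: "b \<in> Basis"
    show "Ck_on k S (\<lambda>x. ?g x v \<bullet> b)"
      using Suc.prems(2) Ck_on_componentwise[OF assms(1), THEN iffD1, rule_format, OF _ b] by auto
    show "Ck_on k S (\<lambda>x. ?f (g x) b)"
      using Suc.prems Ck_on_Suc_D by (intro Suc.IH) auto
  qed
  moreover have "(\<Sum>b\<in>Basis. (?g x v \<bullet> b) *\<^sub>R ?f (g x) b) = ?f (g x) (?g x v)" if "x \<in> S" for x v
  proof -
    have "linear (?f (g x))"
      by (rule frechet_derivative_linear[OF Ck_on_Suc_has_derivative[OF Suc.prems(1)]])
        (use assms(5) that in auto)
    then show ?thesis by (simp add: linear_basis_expansion[symmetric])
  qed
  ultimately have "Ck_on k S (\<lambda>x. ?f (g x) (?g x v))" for v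
    by (rule Ck_on_transform[OF assms(1)])
  then show ?case using D by (intro Ck_on_Suc_I[OF assms(1)])
qed

text \<open>The direction may vary with the point, as it does when a vector field acts on a function
  and in the variational equation of a differential equation. Basis expansion reduces this to
  derivatives in fixed directions.\<close>

lemma Ck_on_frechet_apply:
  fixes f :: "'f::euclidean_space \<Rightarrow> 'g::euclidean_space" and g :: "'e::euclidean_space \<Rightarrow> 'f"
  assumes "open S" "open T" "Ck_on (Suc k) T f" "Ck_on k S g" "g ` S \<subseteq> T" "Ck_on k S w"
  shows "Ck_on k S (\<lambda>x. frechet_derivative f (at (g x)) (w x))"
proof -
  let ?f = "\<lambda>x. frechet_derivative f (at x)"
  have "Ck_on k S (\<lambda>x. \<Sum>b\<in>Basis. (w x \<bullet> b) *\<^sub>R ?f (g x) b)"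
  proof (intro Ck_on_sum assms Ck_on_bilinear[where B = scaleR, OF bounded_bilinear_scaleR])
    fix b :: 'f assume b: "b \<in> Basis"
    show "Ck_on k S (\<lambda>x. w x \<bullet> b)"
      using assms(6) Ck_on_componentwise[OF assms(1)] b by auto
    show "Ck_on k S (\<lambda>x. ?f (g x) b)"
      using assms(3) by (intro Ck_on_compose[OF assms(1,2) _ assms(4,5)]) auto
  qed
  moreover have "(\<Sum>b\<in>Basis. (w x \<bullet> b) *\<^sub>R ?f (g x) b) = ?f (g x) (w x)" if "x \<in> S" for x
  proof -
    have "linear (?f (g x))"
      by (rule frechet_derivative_linear[OF Ck_on_Suc_has_derivative[OF assms(3)]])
        (use assms(5) that in auto)
    then show ?thesis by (simp add: linear_basis_expansion[symmetric])
  qed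
  ultimately show ?thesis by (rule Ck_on_transform[OF assms(1)])
qed

lemma Ck_on_Pair:
  fixes f :: "'e::euclidean_space \<Rightarrow> 'f::euclidean_space" and g :: "'e \<Rightarrow> 'g::euclidean_space"
  assumes "open S" "Ck_on k S f" "Ck_on k S g"
  shows "Ck_on k S (\<lambda>x. (f x, g x))"
proof -
  have "Ck_on k S (\<lambda>x. (f x, 0) + (0, g x))"
    by (intro Ck_on_add assms Ck_on_compose_linear[where L = "\<lambda>y. (y, 0)"]
        Ck_on_compose_linear[where L = "\<lambda>y. (0, y)"] linearI) auto
  then show ?thesis by simp
qed

lemma linear_fst_snd: "linear fst" "linear snd"
  by (simp_all add: linear_iff)

lemma Ck_on_fst: "Ck_on k S fst" and Ck_on_snd: "Ck_on k S snd"
  by (auto intro: Ck_on_linear linear_fst_snd)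

lemma Ck_on_id: "Ck_on k S (\<lambda>x. x)"
  by (intro Ck_on_linear linear_ident)

section \<open>Closure properties of smooth maps\<close>

lemma smooth_on_subset: "smooth_on S f \<Longrightarrow> T \<subseteq> S \<Longrightarrow> smooth_on T f"
  unfolding smooth_on_def using Ck_on_subset by blast

lemma smooth_on_transform:
  "open S \<Longrightarrow> smooth_on S f \<Longrightarrow> (\<And>x. x \<in> S \<Longrightarrow> f x = g x) \<Longrightarrow> smooth_on S g"
  unfolding smooth_on_def using Ck_on_cong by blast

lemma smooth_on_local:
  assumes "\<And>x. x \<in> S \<Longrightarrow> \<exists>T. open T \<and> x \<in> T \<and> smooth_on T f"
  shows "smooth_on S f"
  unfolding smooth_on_def
proof
  fix k show "Ck_on k S f"
    by (rule Ck_on_local) (use assms in \<open>auto simp: smooth_on_def\<close>)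
qed

lemma smooth_on_continuous: "smooth_on S f \<Longrightarrow> continuous_on S f"
  unfolding smooth_on_def using Ck_on_continuous by blast

lemma smooth_on_has_derivative:
  "smooth_on S f \<Longrightarrow> x \<in> S \<Longrightarrow> (f has_derivative frechet_derivative f (at x)) (at x)"
  unfolding smooth_on_def by (rule Ck_on_Suc_has_derivative) auto

lemma smooth_on_frechet_linear: "smooth_on S f \<Longrightarrow> x \<in> S \<Longrightarrow> linear (frechet_derivative f (at x))"
  using smooth_on_has_derivative frechet_derivative_linear by blast

lemma smooth_onI:
  assumes "open S" "\<And>x. x \<in> S \<Longrightarrow> (f has_derivative f' x) (at x)" "\<And>v. smooth_on S (\<lambda>x. f' x v)"
  shows "smooth_on S f"
  unfolding smooth_on_def
proof
  fix k show "Ck_on k S f"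
    using Ck_on_Suc_I[OF assms(1,2), of k] assms(3) Ck_on_Suc_D unfolding smooth_on_def by blast
qed

lemma smooth_on_const: "smooth_on S (\<lambda>x. c)"
  unfolding smooth_on_def using Ck_on_const by blast

lemma smooth_on_linear: "linear f \<Longrightarrow> smooth_on S f"
  unfolding smooth_on_def using Ck_on_linear by blast

lemma smooth_on_id: "smooth_on S (\<lambda>x. x)"
  unfolding smooth_on_def using Ck_on_id by blast

lemma smooth_on_compose_linear:
  "linear L \<Longrightarrow> open S \<Longrightarrow> smooth_on S f \<Longrightarrow> smooth_on S (\<lambda>x. L (f x))"
  unfolding smooth_on_def using Ck_on_compose_linear by blast

lemma smooth_on_snd: "open S \<Longrightarrow> smooth_on S f \<Longrightarrow> smooth_on S (\<lambda>x. snd (f x))"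
  by (rule smooth_on_compose_linear[OF linear_fst_snd(2)])

lemma smooth_on_inner_left: "open S \<Longrightarrow> smooth_on S g \<Longrightarrow> smooth_on S (\<lambda>x. g x \<bullet> b)"
  by (rule smooth_on_compose_linear[where L = "\<lambda>y. y \<bullet> b"])
    (simp add: bounded_linear.linear bounded_linear_inner_left)

lemma smooth_on_add:
  "open S \<Longrightarrow> smooth_on S f \<Longrightarrow> smooth_on S g \<Longrightarrow> smooth_on S (\<lambda>x. f x + g x)"
  unfolding smooth_on_def using Ck_on_add by blast

lemma smooth_on_bilinear:
  "bounded_bilinear B \<Longrightarrow> open S \<Longrightarrow> smooth_on S f \<Longrightarrow> smooth_on S g \<Longrightarrow> smooth_on S (\<lambda>x. B (f x) (g x))"
  unfolding smooth_on_def using Ck_on_bilinear by blast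

lemma smooth_on_scaleR:
  "open S \<Longrightarrow> smooth_on S f \<Longrightarrow> smooth_on S g \<Longrightarrow> smooth_on S (\<lambda>x. f x *\<^sub>R g x)"
  by (rule smooth_on_bilinear[OF bounded_bilinear_scaleR])

lemma smooth_on_mult:
  fixes f :: "'e::euclidean_space \<Rightarrow> real"
  shows "open S \<Longrightarrow> smooth_on S f \<Longrightarrow> smooth_on S g \<Longrightarrow> smooth_on S (\<lambda>x. f x * g x)"
  by (rule smooth_on_bilinear[OF bounded_bilinear_mult])

lemma smooth_on_diff:
  fixes f :: "'e::euclidean_space \<Rightarrow> 'f::euclidean_space"
  assumes "open S" "smooth_on S f" "smooth_on S g"
  shows "smooth_on S (\<lambda>x. f x - g x)"
proof -
  have "smooth_on S (\<lambda>x. f x + (- 1) *\<^sub>R g x)"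
    using assms by (intro smooth_on_add smooth_on_scaleR smooth_on_const)
  then show ?thesis by simp
qed

lemma smooth_on_componentwise:
  fixes f :: "'e::euclidean_space \<Rightarrow> 'f::euclidean_space"
  shows "open S \<Longrightarrow> smooth_on S f \<longleftrightarrow> (\<forall>b\<in>Basis. smooth_on S (\<lambda>x. f x \<bullet> b))"
  unfolding smooth_on_def using Ck_on_componentwise by blast

lemma smooth_on_Pair:
  "open S \<Longrightarrow> smooth_on S f \<Longrightarrow> smooth_on S g \<Longrightarrow> smooth_on S (\<lambda>x. (f x, g x))"
  unfolding smooth_on_def using Ck_on_Pair by blast

lemma smooth_on_compose:
  "open S \<Longrightarrow> open T \<Longrightarrow> smooth_on T f \<Longrightarrow> smooth_on S g \<Longrightarrow> g ` S \<subseteq> T \<Longrightarrow> smooth_on S (\<lambda>x. f (g x))"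
  unfolding smooth_on_def using Ck_on_compose by blast

lemma smooth_on_frechet_apply:
  "open S \<Longrightarrow> open T \<Longrightarrow> smooth_on T f \<Longrightarrow> smooth_on S g \<Longrightarrow> g ` S \<subseteq> T \<Longrightarrow> smooth_on S w
    \<Longrightarrow> smooth_on S (\<lambda>x. frechet_derivative f (at (g x)) (w x))"
  unfolding smooth_on_def using Ck_on_frechet_apply by blast

lemma smooth_on_frechet:
  "smooth_on S f \<Longrightarrow> smooth_on S (\<lambda>x. frechet_derivative f (at x) v)"
  unfolding smooth_on_def by (metis Ck_on.simps(2))

subsection \<open>Ordinary differential equations with parameters\<close>

text \<open>At a time s where |w| is maximal the mean value inequality gives |w s - w 0| \<le> a (L
  |w s| + e); since L a \<le> 1/2, half of |w s| is absorbed on the left. This serves in place of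
  Gronwall's inequality.\<close>

lemma ode_estimate:
  fixes w w' :: "real \<Rightarrow> 'u::euclidean_space"
  assumes "a > 0" "L \<ge> 0" "L * a \<le> 1/2"
    and der: "\<And>t. t \<in> {-a..a} \<Longrightarrow> (w has_vector_derivative w' t) (at t within {-a..a})"
    and bd: "\<And>t. t \<in> {-a..a} \<Longrightarrow> norm (w' t) \<le> L * norm (w t) + e"
    and t: "t \<in> {-a..a}"
  shows "norm (w t) \<le> 2 * (norm (w 0) + a * e)"
proof -
  have "continuous_on {-a..a} w"
    unfolding continuous_on_eq_continuous_within by (blast intro: der has_vector_derivative_continuous)
  then have "continuous_on {-a..a} (\<lambda>t. norm (w t))" by (intro continuous_intros)
  then obtain s where s: "s \<in> {-a..a}" "\<And>t. t \<in> {-a..a} \<Longrightarrow> norm (w t) \<le> norm (w s)"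
    using continuous_attains_sup[of "{-a..a}" "\<lambda>t. norm (w t)"] assms(1) by auto
  define B where "B = L * norm (w s) + e"
  have B: "norm (w' t) \<le> B" if "t \<in> {-a..a}" for t
    using bd[OF that] s(2)[OF that] assms(2) unfolding B_def
    by (meson add_right_mono mult_left_mono order_trans)
  have "0 \<le> B" using B[OF t] norm_ge_zero order_trans by blast
  have "norm (w s - w 0) \<le> B * norm (s - 0)"
  proof (rule differentiable_bound[of "{-a..a}" w "\<lambda>t h. h *\<^sub>R w' t"])
    show "(w has_derivative (\<lambda>h. h *\<^sub>R w' x)) (at x within {-a..a})" if "x \<in> {-a..a}" for x
      using der[OF that] by (simp add: has_vector_derivative_def)
    show "onorm (\<lambda>h. h *\<^sub>R w' x) \<le> B" if "x \<in> {-a..a}" for x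
      using B[OF that] by (intro onorm_le) (simp add: mult.commute[of B] mult_left_mono)
  qed (use s assms(1) in auto)
  also have "\<dots> \<le> B * a"
    using s(1) \<open>0 \<le> B\<close> by (intro mult_left_mono) auto
  also have "\<dots> = L * a * norm (w s) + a * e" by (simp add: B_def algebra_simps)
  also have "\<dots> \<le> norm (w s) / 2 + a * e"
    using mult_right_mono[OF assms(3), of "norm (w s)"] by simp
  finally have "norm (w s - w 0) \<le> norm (w s) / 2 + a * e" .
  then have "norm (w s) \<le> 2 * (norm (w 0) + a * e)"
    using norm_triangle_sub[of "w s" "w 0"] by (simp add: algebra_simps)
  then show ?thesis using s(2)[OF t] by linarith
qed

text \<open>Picard iteration: the integral operator contracts the supremum distance by the factor L
  a \<le> 1/2.\<close>

lemma ode_exists: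
  fixes F :: "real \<Rightarrow> 'u::euclidean_space \<Rightarrow> 'u"
  assumes "a > 0" "L \<ge> 0" "L * a \<le> 1/2"
    and cont: "continuous_on ({-a..a} \<times> UNIV) (\<lambda>(t, y). F t y)"
    and lip: "\<And>t y z. t \<in> {-a..a} \<Longrightarrow> norm (F t y - F t z) \<le> L * norm (y - z)"
  shows "\<exists>u. u 0 = y0 \<and>
    (\<forall>t\<in>{-a..a}. (u has_vector_derivative F t (u t)) (at t within {-a..a}))"
proof -
  \<comment> \<open>The fixed point is sought in the complete type of bounded continuous functions
    on the whole line. Clamping the time to [-a, a] turns a curve on the interval into such a
    function.\<close>
  define c where "c = (\<lambda>t::real. max (- a) (min a t))"
  have c: "c t \<in> {-a..a}" for t using assms(1) by (auto simp: c_def)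
  have c_id: "c t = t" if "t \<in> {-a..a}" for t using that by (auto simp: c_def)
  have c_cont: "continuous_on UNIV c" unfolding c_def by (intro continuous_intros)
  \<comment> \<open>The primitive starts at the left endpoint -a; subtracting the second integral
    normalises its value at time 0 to \<open>y0\<close>.\<close>
  define J where "J = (\<lambda>\<gamma> :: real \<Rightarrow>\<^sub>C 'u. \<lambda>t. y0 + integral {-a..t} (\<lambda>s. F s (\<gamma> s))
      - integral {-a..0} (\<lambda>s. F s (\<gamma> s)))"
  have J_der: "(J \<gamma> has_vector_derivative F t (\<gamma> t)) (at t within {-a..a})"
    if "t \<in> {-a..a}" for \<gamma> t
  proof -
    have "continuous_on {-a..a} (\<lambda>s. (\<lambda>(t, y). F t y) (s, \<gamma> s))"
      by (rule continuous_on_compose2[OF cont]) (auto intro!: continuous_intros)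
    then have "continuous_on {-a..a} (\<lambda>s. F s (\<gamma> s))" by simp
    from integral_has_vector_derivative[OF this that] show ?thesis
      unfolding J_def by (auto intro!: derivative_eq_intros)
  qed
  have J_cont: "continuous_on {-a..a} (J \<gamma>)" for \<gamma>
    unfolding continuous_on_eq_continuous_within by (blast intro: J_der has_vector_derivative_continuous)
  define T where "T = (\<lambda>\<gamma>. Bcontfun (\<lambda>t. J \<gamma> (c t)))"
  have T: "apply_bcontfun (T \<gamma>) = (\<lambda>t. J \<gamma> (c t))" for \<gamma>
  proof -
    have "bounded (range (\<lambda>t. J \<gamma> (c t)))"
      by (rule bounded_subset[OF compact_imp_bounded[OF compact_continuous_image[OF J_cont]]])
        (use c in auto)
    moreover have "continuous_on UNIV (\<lambda>t. J \<gamma> (c t))"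
      by (rule continuous_on_compose2[OF J_cont c_cont]) (use c in auto)
    ultimately show ?thesis
      unfolding T_def by (intro Bcontfun_inverse) (simp add: bcontfun_def)
  qed
  have "dist (T \<gamma>) (T \<delta>) \<le> 1/2 * dist \<gamma> \<delta>" for \<gamma> \<delta>
  proof (rule dist_bound)
    fix t
    let ?D = "\<lambda>t. J \<gamma> t - J \<delta> t"
    have "norm (?D (c t) - ?D 0) \<le> (L * dist \<gamma> \<delta>) * norm (c t - 0)"
    proof (rule differentiable_bound[of "{-a..a}" ?D "\<lambda>t h. h *\<^sub>R (F t (\<gamma> t) - F t (\<delta> t))"])
      show "(?D has_derivative (\<lambda>h. h *\<^sub>R (F x (\<gamma> x) - F x (\<delta> x)))) (at x within {-a..a})"
        if "x \<in> {-a..a}" for x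
        using has_vector_derivative_diff[OF J_der[OF that] J_der[OF that]]
        by (simp add: has_vector_derivative_def)
      show "onorm (\<lambda>h. h *\<^sub>R (F x (\<gamma> x) - F x (\<delta> x))) \<le> L * dist \<gamma> \<delta>" if "x \<in> {-a..a}" for x
      proof (rule onorm_le)
        fix h :: real
        have "norm (F x (\<gamma> x) - F x (\<delta> x)) \<le> L * norm (\<gamma> x - \<delta> x)" by (rule lip[OF that])
        also have "\<dots> \<le> L * dist \<gamma> \<delta>"
          using dist_bounded[of \<gamma> x \<delta>] assms(2) by (intro mult_left_mono) (simp_all add: dist_norm)
        finally have "\<bar>h\<bar> * norm (F x (\<gamma> x) - F x (\<delta> x)) \<le> \<bar>h\<bar> * (L * dist \<gamma> \<delta>)"
          by (rule mult_left_mono) simp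
        then show "norm (h *\<^sub>R (F x (\<gamma> x) - F x (\<delta> x))) \<le> L * dist \<gamma> \<delta> * norm h"
          by (simp add: mult.commute)
      qed
    qed (use c assms(1) in auto)
    also have "\<dots> \<le> (L * dist \<gamma> \<delta>) * a"
      using c[of t] assms(2) by (intro mult_left_mono) auto
    also have "\<dots> \<le> 1/2 * dist \<gamma> \<delta>"
      using mult_right_mono[OF assms(3), of "dist \<gamma> \<delta>"] by (simp add: algebra_simps)
    finally show "dist (T \<gamma> t) (T \<delta> t) \<le> 1/2 * dist \<gamma> \<delta>"
      by (simp add: T dist_norm J_def)
  qed
  then obtain \<gamma> where \<gamma>: "T \<gamma> = \<gamma>"
    using banach_fix_type[of "1/2" T] by auto
  have eq: "J \<gamma> t = \<gamma> t" if "t \<in> {-a..a}" for t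
    using T[of \<gamma>] c_id[OF that] \<gamma> by metis
  have "(apply_bcontfun \<gamma> has_vector_derivative F t (\<gamma> t)) (at t within {-a..a})"
    if "t \<in> {-a..a}" for t
    using has_vector_derivative_transform[OF that _ J_der[OF that]] eq by metis
  moreover have "\<gamma> 0 = y0" using eq[of 0] assms(1) by (simp add: J_def)
  ultimately show ?thesis by blast
qed

section \<open>Uniform linearisation on compact sets\<close>

lemma Blinfun_frechet:
  assumes "Ck_on (Suc k) S F" "z \<in> S"
  shows "blinfun_apply (Blinfun (frechet_derivative F (at z))) = frechet_derivative F (at z)"
  using Ck_on_Suc_has_derivative[OF assms] has_derivative_bounded_linear
  by (intro bounded_linear_Blinfun_apply) blast

text \<open>In finite dimension, continuity in each direction is continuity in the operator norm.
  The compactness arguments and the inverse function theorem need the latter.\<close>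

lemma continuous_on_Blinfun_frechet:
  fixes F :: "'z::euclidean_space \<Rightarrow> 'u::euclidean_space"
  assumes "Ck_on (Suc 0) S F"
  shows "continuous_on S (\<lambda>z. Blinfun (frechet_derivative F (at z)))"
proof (rule continuous_on_blinfun_componentwise)
  fix i :: 'z
  have "continuous_on S (\<lambda>z. frechet_derivative F (at z) i)" using assms by simp
  then show "continuous_on S (\<lambda>z. blinfun_apply (Blinfun (frechet_derivative F (at z))) i)"
    using Blinfun_frechet[OF assms] by (simp cong: continuous_on_cong)
qed

text \<open>The derivative is uniformly continuous on a compact neighbourhood of K, and the mean
  value inequality on the ball of radius |k| turns this into a remainder estimate uniform in z. The
  uniformity is what allows linearising along a whole solution curve.\<close>

lemma uniformly_differentiable_on_compact:
  fixes F :: "'z::euclidean_space \<Rightarrow> 'u::euclidean_space"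
  assumes "Ck_on (Suc 0) S F" "open S" "compact K" "K \<subseteq> S" "e > 0"
  shows "\<exists>d>0. \<forall>z\<in>K. \<forall>k. norm k < d \<longrightarrow> z + k \<in> S \<and>
    norm (F (z + k) - F z - frechet_derivative F (at z) k) \<le> e * norm k"
proof (cases "K = {}")
  case True
  then show ?thesis by (auto intro: exI[of _ 1])
next
  case False
  let ?D = "\<lambda>z. Blinfun (frechet_derivative F (at z))"
  obtain r where r: "r > 0" "{x. infdist x K \<le> r} \<subseteq> S"
    using compact_in_open_separated[OF False assms(3,2,4)] by metis
  let ?K = "{x. infdist x K \<le> r}"
  have "uniformly_continuous_on ?K ?D"
    using continuous_on_subset[OF continuous_on_Blinfun_frechet[OF assms(1)] r(2)]
      compact_infdist_le[OF False assms(3) r(1)] by (intro compact_uniformly_continuous)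
  then obtain d where d: "d > 0" "\<And>x y. x \<in> ?K \<Longrightarrow> y \<in> ?K \<Longrightarrow> dist y x < d \<Longrightarrow> dist (?D y) (?D x) < e"
    using assms(5) unfolding uniformly_continuous_on_def by metis
  have "z + k \<in> S \<and> norm (F (z + k) - F z - frechet_derivative F (at z) k) \<le> e * norm k"
    if z: "z \<in> K" and k: "norm k < min d r" for z k
  proof -
    have near: "x \<in> ?K" if "x \<in> cball z (norm k)" for x
      using infdist_le[OF z, of x] that k by (simp add: dist_commute)
    have zk: "z \<in> cball z (norm k)" "z + k \<in> cball z (norm k)" by (auto simp: dist_norm)
    have "norm (F (z + k) - F z - frechet_derivative F (at z) (z + k - z)) \<le> norm (z + k - z) * e"
    proof (rule differentiable_bound_linearization[where S = "cball z (norm k)"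
          and f' = "\<lambda>x. frechet_derivative F (at x)"])
      fix x assume x: "x \<in> cball z (norm k)"
      then have "x \<in> S" "z \<in> S" using near r(2) z assms(4) by auto
      then show "(F has_derivative frechet_derivative F (at x)) (at x within cball z (norm k))"
        using Ck_on_Suc_has_derivative[OF assms(1)] has_derivative_at_withinI by blast
      have "dist (?D x) (?D z) < e"
        using d(2)[of z x] near[OF x] near[OF zk(1)] x k by (simp add: dist_commute)
      then show "onorm (frechet_derivative F (at x) - frechet_derivative F (at z)) \<le> e"
        using Blinfun_frechet[OF assms(1) \<open>x \<in> S\<close>] Blinfun_frechet[OF assms(1) \<open>z \<in> S\<close>]
        by (simp add: dist_norm norm_blinfun.rep_eq minus_blinfun.rep_eq fun_diff_def)
    next
      fix t :: real assume "t \<in> {0..1}"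
      then show "z + t *\<^sub>R (z + k - z) \<in> cball z (norm k)"
        by (simp add: dist_norm mult_left_le_one_le)
    qed (rule zk)
    then show ?thesis using near[OF zk(2)] r(2) by (auto simp: mult.commute)
  qed
  then show ?thesis using d(1) r(1) by (intro exI[of _ "min d r"]) auto
qed

lemma derivative_norm_le:
  fixes f :: "'z::real_normed_vector \<Rightarrow> 'u::real_normed_vector"
  assumes "(f has_derivative D) (at z)" "\<delta> > 0"
    and "\<And>s. 0 < s \<Longrightarrow> s < \<delta> \<Longrightarrow> norm (f (z + s *\<^sub>R v) - f z) \<le> M * s"
  shows "norm (D v) \<le> M"
proof (rule field_le_epsilon)
  fix e :: real assume "e > 0"
  define e' where "e' = e / (norm v + 1)"
  have e': "e' > 0" "e' * norm v \<le> e"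
    using \<open>e > 0\<close> by (auto simp: e'_def field_simps add_pos_nonneg)
  have bl: "bounded_linear D" using assms(1) has_derivative_bounded_linear by blast
  obtain d where d: "d > 0"
    "\<And>y. norm (y - z) < d \<Longrightarrow> norm (f y - f z - D (y - z)) \<le> e' * norm (y - z)"
    using assms(1) e'(1) unfolding has_derivative_at_alt by blast
  \<comment> \<open>Small enough for both the hypothesis on the ray and the differentiability
    estimate; the 1 added to |v| covers v = 0.\<close>
  define s where "s = min (\<delta> / 2) (d / (2 * (norm v + 1)))"
  have n: "norm v + 1 > 0" by (simp add: add_nonneg_pos)
  have s: "0 < s" "s < \<delta>" using assms(2) d(1) n by (auto simp: s_def)
  have "s * norm v \<le> s * (norm v + 1)" using s by (simp add: algebra_simps)
  also have "\<dots> \<le> d / (2 * (norm v + 1)) * (norm v + 1)"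
    using n by (intro mult_right_mono) (auto simp: s_def)
  also have "\<dots> = d / 2" using n by (simp add: field_simps)
  also have "\<dots> < d" using d(1) by simp
  finally have "norm (z + s *\<^sub>R v - z) < d" using s by simp
  from d(2)[OF this] have "norm (f (z + s *\<^sub>R v) - f z - s *\<^sub>R D v) \<le> e' * (s * norm v)"
    using s linear_scale[OF bounded_linear.linear[OF bl]] by simp
  moreover have "norm (f (z + s *\<^sub>R v) - f z) \<le> M * s" using assms(3) s by blast
  moreover have "norm (s *\<^sub>R D v) \<le> norm (f (z + s *\<^sub>R v) - f z) + norm (f (z + s *\<^sub>R v) - f z - s *\<^sub>R D v)"
    by (metis norm_minus_commute norm_triangle_sub)
  moreover have "norm (s *\<^sub>R D v) = s * norm (D v)" using s(1) by simp
  moreover have "e' * (s * norm v) \<le> e * s"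
    using mult_right_mono[OF e'(2), of s] s by (simp add: algebra_simps)
  ultimately have "s * norm (D v) \<le> M * s + e * s" by linarith
  then have "s * norm (D v) \<le> s * (M + e)" by (simp add: algebra_simps)
  then show "norm (D v) \<le> M + e" using s by simp
qed

text \<open>The bound \<open>L * a \<le> 1/2\<close> turns all estimates into contraction arguments, and linearising in
  the parameter preserves it: the derivative of a family in the parameter is again a family, with the
  same \<open>a\<close> and \<open>L\<close>.\<close>

definition ode_family :: "real \<Rightarrow> real \<Rightarrow> 'p::euclidean_space set \<Rightarrow> 'u::euclidean_space set \<Rightarrow>
    (real \<times> 'p \<times> 'u \<Rightarrow> 'u) \<Rightarrow> (real \<times> 'p \<Rightarrow> 'u) \<Rightarrow> bool" where
  "ode_family a L P Q F u \<longleftrightarrow> 0 < a \<and> 0 \<le> L \<and> L * a \<le> 1/2 \<and> open P \<and> open Q \<and>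
    (\<forall>t\<in>{-a<..<a}. \<forall>x\<in>P. u (t, x) \<in> Q \<and>
      ((\<lambda>s. u (s, x)) has_vector_derivative F (t, x, u (t, x))) (at t) \<and>
      (\<forall>y\<in>Q. \<forall>z\<in>Q. norm (F (t, x, y) - F (t, x, z)) \<le> L * norm (y - z)))"

section \<open>Dependence of solutions on parameters\<close>

lemma ode_family_continuous_time:
  assumes "ode_family a L P Q F u" "x \<in> P"
  shows "continuous_on {-a<..<a} (\<lambda>t. u (t, x))"
  using assms unfolding ode_family_def
  by (auto intro!: continuous_at_imp_continuous_on has_vector_derivative_continuous)

text \<open>The difference of the solutions for x and x0 satisfies the hypothesis of the estimate:
  changing the state costs the Lipschitz term, and changing the parameter along the fixed solution
  for x0 costs an error that is small by uniform continuity.\<close>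

lemma ode_family_continuous:
  fixes F :: "real \<times> 'p::euclidean_space \<times> 'u::euclidean_space \<Rightarrow> 'u"
  assumes fam: "ode_family a L P Q F u"
    and F: "continuous_on ({-a<..<a} \<times> P \<times> Q) F" and b: "continuous_on P (\<lambda>x. u (0, x))"
  shows "continuous_on ({-a<..<a} \<times> P) u"
proof -
  have pos: "0 < a" "0 \<le> L" "L * a \<le> 1/2" "open P" "open Q" using fam unfolding ode_family_def by auto
  have "continuous (at (t0, x0)) u" if t0: "t0 \<in> {-a<..<a}" and x0: "x0 \<in> P" for t0 x0
    unfolding continuous_at_eps_delta
  proof (intro allI impI)
    fix e :: real assume "e > 0"
    \<comment> \<open>A time strictly between |t0| and a gives a compact interval inside the open
      one on which the family is defined.\<close>
    define a' where "a' = (\<bar>t0\<bar> + a) / 2"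
    have a': "0 < a'" "a' < a" "\<bar>t0\<bar> < a'" using t0 pos(1) by (auto simp: a'_def)
    obtain r where r: "r > 0" "cball x0 r \<subseteq> P" using pos(4) x0 open_contains_cball by blast
    have cu: "continuous_on {-a<..<a} (\<lambda>t. u (t, x0))" by (rule ode_family_continuous_time[OF fam x0])
    let ?K = "{-a'..a'} \<times> cball x0 r"
    let ?G = "\<lambda>z. F (fst z, snd z, u (fst z, x0))"
    have "continuous_on ?K ?G"
    proof (rule continuous_on_compose2[OF F])
      show "continuous_on ?K (\<lambda>z. (fst z, snd z, u (fst z, x0)))"
        by (intro continuous_intros continuous_on_compose2[OF cu]) (use a' in auto)
      show "(\<lambda>z. (fst z, snd z, u (fst z, x0))) ` ?K \<subseteq> {-a<..<a} \<times> P \<times> Q"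
        using a' r fam x0 unfolding ode_family_def by auto
    qed
    then have uc: "uniformly_continuous_on ?K ?G"
      by (intro compact_uniformly_continuous compact_Times) auto
    \<comment> \<open>The estimate doubles the initial error e/8 plus a' times this bound, hence
      yields e/2. The other half pays for the continuity in time of the solution for
      \<open>x0\<close>.\<close>
    have "e / (8 * a') > 0" using \<open>e > 0\<close> a' by simp
    then obtain d1 where d1: "d1 > 0"
      "\<And>z z'. z \<in> ?K \<Longrightarrow> z' \<in> ?K \<Longrightarrow> dist z' z < d1 \<Longrightarrow> dist (?G z') (?G z) < e / (8 * a')"
      using uc unfolding uniformly_continuous_on_def by metis
    have "continuous (at x0) (\<lambda>x. u (0, x))" using b pos(4) x0 continuous_on_eq_continuous_at by blast
    then obtain d2 where d2: "d2 > 0" "\<And>x. dist x x0 < d2 \<Longrightarrow> dist (u (0, x)) (u (0, x0)) < e / 8"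
      unfolding continuous_at_eps_delta using \<open>e > 0\<close> by (metis zero_less_divide_iff zero_less_numeral)
    have "continuous (at t0) (\<lambda>t. u (t, x0))" using cu t0 continuous_on_eq_continuous_at open_greaterThanLessThan by blast
    then obtain d3 where d3: "d3 > 0" "\<And>t. dist t t0 < d3 \<Longrightarrow> dist (u (t, x0)) (u (t0, x0)) < e / 2"
      unfolding continuous_at_eps_delta using \<open>e > 0\<close> by (metis half_gt_zero)
    define d where "d = Min {d1, d2, d3, r, a' - \<bar>t0\<bar>}"
    have d: "d > 0" "d \<le> d1" "d \<le> d2" "d \<le> d3" "d \<le> r" "d \<le> a' - \<bar>t0\<bar>"
      using d1 d2 d3 r a' by (auto simp: d_def)
    have "dist (u (t, x)) (u (t0, x0)) < e" if "dist (t, x) (t0, x0) < d" for t x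
    proof -
      have tx: "dist t t0 < d" "dist x x0 < d"
        using that dist_fst_le[of "(t, x)" "(t0, x0)"] dist_snd_le[of "(t, x)" "(t0, x0)"] by auto
      have xP: "x \<in> cball x0 r" "x \<in> P" using tx d r by (auto simp: dist_commute)
      have tK: "t \<in> {-a'..a'}" using tx d by (auto simp: dist_real_def)
      have "norm (u (t, x) - u (t, x0)) \<le> 2 * (norm (u (0, x) - u (0, x0)) + a' * (e / (8 * a')))"
      proof (rule ode_estimate[where L = L and w' = "\<lambda>s. F (s, x, u (s, x)) - F (s, x0, u (s, x0))"])
        show "0 < a'" "0 \<le> L" using a' pos by auto
        show "L * a' \<le> 1/2" using pos a' mult_left_mono[of a' a L] by linarith
        show "t \<in> {-a'..a'}" by fact
        fix s assume s: "s \<in> {-a'..a'}"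
        then have sa: "s \<in> {-a<..<a}" using a' by auto
        show "((\<lambda>s. u (s, x) - u (s, x0)) has_vector_derivative F (s, x, u (s, x)) - F (s, x0, u (s, x0)))
            (at s within {-a'..a'})"
          using fam sa xP(2) x0 unfolding ode_family_def
          by (intro has_vector_derivative_diff) (auto intro: has_vector_derivative_at_within)
        have "norm (F (s, x, u (s, x)) - F (s, x, u (s, x0))) \<le> L * norm (u (s, x) - u (s, x0))"
          using fam sa xP(2) x0 unfolding ode_family_def by blast
        moreover have "dist (?G (s, x)) (?G (s, x0)) < e / (8 * a')"
          using d1(2)[of "(s, x0)" "(s, x)"] s xP r tx d by (auto simp: dist_Pair_Pair)
        ultimately show "norm (F (s, x, u (s, x)) - F (s, x0, u (s, x0)))
            \<le> L * norm (u (s, x) - u (s, x0)) + e / (8 * a')"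
          using norm_triangle_ineq[of "F (s, x, u (s, x)) - F (s, x, u (s, x0))"
              "F (s, x, u (s, x0)) - F (s, x0, u (s, x0))"]
          by (simp add: dist_norm)
      qed
      moreover have "dist (u (0, x)) (u (0, x0)) < e / 8" using d2(2) tx d by auto
      moreover have "dist (u (t, x0)) (u (t0, x0)) < e / 2" using d3(2) tx d by auto
      moreover have "a' * (e / (8 * a')) = e / 8" using a' by simp
      moreover have "dist (u (t, x)) (u (t0, x0)) \<le> dist (u (t, x)) (u (t, x0)) + dist (u (t, x0)) (u (t0, x0))"
        by (rule dist_triangle)
      ultimately show ?thesis by (simp add: dist_norm)
    qed
    then show "\<exists>d>0. \<forall>z. dist z (t0, x0) < d \<longrightarrow> dist (u z) (u (t0, x0)) < e"
      using d(1) by (intro exI[of _ d]) auto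
  qed
  then show ?thesis by (auto intro!: continuous_at_imp_continuous_on)
qed

text \<open>A Lipschitz constant in the state bounds the partial derivative in the state. This is
  why the linearised family keeps the constant L and the time a needs no shrinking with the order of
  differentiation.\<close>

lemma ode_family_partial_bound:
  assumes fam: "ode_family a L P Q F u" and t: "t \<in> {-a<..<a}" and x: "x \<in> P"
    and D: "(F has_derivative D) (at (t, x, u (t, x)))"
  shows "norm (D (0, 0, y)) \<le> L * norm y"
proof -
  have uQ: "u (t, x) \<in> Q" "open Q" using fam t x unfolding ode_family_def by auto
  then obtain r where r: "r > 0" "ball (u (t, x)) r \<subseteq> Q"
    using open_contains_ball by blast
  show ?thesis
  proof (rule derivative_norm_le[OF D])
    show "r / (norm y + 1) > 0" using r(1) by (simp add: add_nonneg_pos)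
    fix s :: real assume s: "0 < s" "s < r / (norm y + 1)"
    have "s * norm y \<le> s * (norm y + 1)" using s by (simp add: algebra_simps)
    also have "\<dots> < r" using s by (simp add: pos_less_divide_eq add_nonneg_pos)
    finally have "u (t, x) + s *\<^sub>R y \<in> Q" using r(2) s by (auto simp: dist_norm)
    then have "norm (F (t, x, u (t, x) + s *\<^sub>R y) - F (t, x, u (t, x)))
        \<le> L * norm (u (t, x) + s *\<^sub>R y - u (t, x))"
      using fam t x uQ unfolding ode_family_def by blast
    then show "norm (F ((t, x, u (t, x)) + s *\<^sub>R (0, 0, y)) - F (t, x, u (t, x))) \<le> L * norm y * s"
      using s by (simp add: algebra_simps)
  qed
qed

text \<open>The candidate \<open>v\<close> solves the variational equation. The estimate is applied
  twice: once to bound the increment \<open>u (t, x0 + h) - u (t, x0)\<close> by a multiple of |h|,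
  then to the increment minus \<open>v h t\<close>. In the second case the state derivative
  contributes L, and the remaining error is o(|h|) by uniform differentiability along the compact
  solution curve.\<close>

lemma ode_family_param_derivative:
  fixes F :: "real \<times> 'p::euclidean_space \<times> 'u::euclidean_space \<Rightarrow> 'u"
  assumes fam: "ode_family a L P Q F u"
    and F: "Ck_on (Suc 0) ({-a<..<a} \<times> P \<times> Q) F"
    and b: "((\<lambda>x. u (0, x)) has_derivative (\<lambda>h. v h 0)) (at x0)"
    and x0: "x0 \<in> P" and a': "0 < a'" "a' < a" and lin: "\<And>t. linear (\<lambda>h. v h t)"
    and v: "\<And>h t. t \<in> {-a'..a'} \<Longrightarrow> (v h has_vector_derivative
      frechet_derivative F (at (t, x0, u (t, x0))) (0, h, v h t)) (at t within {-a'..a'})"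
    and t: "t \<in> {-a'..a'}"
  shows "((\<lambda>x. u (t, x)) has_derivative (\<lambda>h. v h t)) (at x0)"
proof -
  have pos: "0 < a" "0 \<le> L" "L * a \<le> 1/2" "open P" "open Q" using fam unfolding ode_family_def by auto
  have La': "L * a' \<le> 1/2" using pos a' mult_left_mono[of a' a L] by linarith
  have ta: "t \<in> {-a<..<a}" if "t \<in> {-a'..a'}" for t using that a' by auto
  define S where "S = {-a<..<a} \<times> P \<times> Q"
  have "open S" using pos by (auto simp: S_def intro: open_Times)
  define z where "z = (\<lambda>t. (t, x0, u (t, x0)))"
  define D where "D = (\<lambda>t. frechet_derivative F (at (z t)))"
  have zS: "z t \<in> S" if "t \<in> {-a'..a'}" for t
    using ta[OF that] fam x0 unfolding ode_family_def S_def z_def by auto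
  have D: "(F has_derivative D t) (at (z t))" if "t \<in> {-a'..a'}" for t
    unfolding D_def using Ck_on_Suc_has_derivative[OF F] zS[OF that] by (simp add: S_def)
  have D_lin: "linear (D t)" if "t \<in> {-a'..a'}" for t
    using D[OF that] has_derivative_linear by blast
  have u_der: "((\<lambda>s. u (s, x)) has_vector_derivative F (t, x, u (t, x))) (at t within {-a'..a'})"
    if "t \<in> {-a'..a'}" "x \<in> P" for t x
    using fam ta[OF that(1)] that(2) unfolding ode_family_def by (auto intro: has_vector_derivative_at_within)
  have u_Q: "u (t, x) \<in> Q" if "t \<in> {-a'..a'}" "x \<in> P" for t x
    using fam ta[OF that(1)] that(2) unfolding ode_family_def by auto
  have lip: "norm (F (t, x, y) - F (t, x, y')) \<le> L * norm (y - y')"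
    if "t \<in> {-a'..a'}" "x \<in> P" "y \<in> Q" "y' \<in> Q" for t x y y'
    using fam ta[OF that(1)] that(2-) unfolding ode_family_def by auto
  have D_u: "norm (D t (0, 0, y)) \<le> L * norm y" if t: "t \<in> {-a'..a'}" for t y
    using ode_family_partial_bound[OF fam ta[OF t] x0] D[OF t] by (simp add: z_def)
  have cont_z: "continuous_on {-a'..a'} z"
    unfolding z_def
    by (intro continuous_intros continuous_on_subset[OF ode_family_continuous_time[OF fam x0]]) (use ta in auto)
  have K: "compact (z ` {-a'..a'})" "z ` {-a'..a'} \<subseteq> S"
    using zS by (auto intro!: compact_continuous_image cont_z)
  have F': "Ck_on (Suc 0) S F" using F by (simp add: S_def)
  note ud = uniformly_differentiable_on_compact[OF F' \<open>open S\<close> K]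
  obtain C where C: "C > 0" "\<And>t k. t \<in> {-a'..a'} \<Longrightarrow> norm (D t k) \<le> C * norm k"
  proof -
    have "compact ((\<lambda>z. Blinfun (frechet_derivative F (at z))) ` (z ` {-a'..a'}))"
      using continuous_on_subset[OF continuous_on_Blinfun_frechet[OF F'] K(2)] K(1)
      by (rule compact_continuous_image)
    then obtain C where C: "C > 0" "\<And>t. t \<in> {-a'..a'} \<Longrightarrow> norm (Blinfun (D t)) \<le> C"
      using compact_imp_bounded bounded_pos unfolding D_def by (metis (no_types, lifting) imageI)
    have "norm (D t k) \<le> C * norm k" if t: "t \<in> {-a'..a'}" for t k
    proof -
      have "norm (D t k) \<le> norm (Blinfun (D t)) * norm k"
        using norm_blinfun[of "Blinfun (D t)" k] Blinfun_frechet[OF F' zS[OF t]] by (simp add: D_def)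
      also have "\<dots> \<le> C * norm k" using C(2)[OF t] by (rule mult_right_mono) simp
      finally show ?thesis .
    qed
    then show ?thesis using C(1) that by blast
  qed
  obtain d1 where d1: "d1 > 0" "\<And>t k. t \<in> {-a'..a'} \<Longrightarrow> norm k < d1 \<Longrightarrow> z t + k \<in> S \<and>
      norm (F (z t + k) - F (z t) - D t k) \<le> norm k"
    using ud[of 1] unfolding D_def by auto
  have b_bl: "bounded_linear (\<lambda>h. v h 0)" using b has_derivative_bounded_linear by blast
  then obtain C0 where C0: "C0 > 0" "\<And>h. norm (v h 0) \<le> norm h * C0"
    using bounded_linear.pos_bounded by blast
  obtain d2 where d2: "d2 > 0" "\<And>h. norm h < d2 \<Longrightarrow> norm (u (0, x0 + h) - u (0, x0) - v h 0) \<le> norm h"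
  proof -
    obtain d where "d > 0" "\<And>y. norm (y - x0) < d \<Longrightarrow>
        norm (u (0, y) - u (0, x0) - v (y - x0) 0) \<le> 1 * norm (y - x0)"
      using b zero_less_one unfolding has_derivative_at_alt by blast
    then show ?thesis using that[of d] by (metis add_diff_cancel_left' mult_1)
  qed
  \<comment> \<open>The outcome of the estimate when the initial increment is at most (1 + C0) |h|
    and the error in the equation at most (1 + C) |h|.\<close>
  define C2 where "C2 = 2 * (1 + C0 + a' * (1 + C))"
  have C2: "C2 > 0" using C C0 a' by (auto simp: C2_def intro!: mult_pos_pos add_pos_pos)
  have Delta: "norm (u (t, x0 + h) - u (t, x0)) \<le> C2 * norm h"
    if t: "t \<in> {-a'..a'}" and h: "norm h < min d1 d2" for t h
  proof -
    have hP: "x0 + h \<in> P" using d1(2)[of 0 "(0, h, 0)"] h a' by (auto simp: z_def S_def norm_Pair)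
    have "norm (u (t, x0 + h) - u (t, x0)) \<le>
        2 * (norm (u (0, x0 + h) - u (0, x0)) + a' * ((1 + C) * norm h))"
    proof (rule ode_estimate[OF a'(1) pos(2) La' _ _ t])
      fix s assume s: "s \<in> {-a'..a'}"
      show "((\<lambda>s. u (s, x0 + h) - u (s, x0)) has_vector_derivative
          F (s, x0 + h, u (s, x0 + h)) - F (s, x0, u (s, x0))) (at s within {-a'..a'})"
        using u_der[OF s hP] u_der[OF s x0] by (rule has_vector_derivative_diff)
      have n: "norm (0::real, h, 0::'u) = norm h" by (simp add: norm_Pair)
      have "norm (F (z s + (0, h, 0)) - F (z s)) \<le>
          norm (F (z s + (0, h, 0)) - F (z s) - D s (0, h, 0)) + norm (D s (0, h, 0))"
        by (metis add.commute norm_triangle_sub)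
      also have "\<dots> \<le> norm h + C * norm h"
        using d1(2)[OF s, of "(0, h, 0)"] C(2)[OF s, of "(0, h, 0)"] h by (simp add: n)
      finally have 1: "norm (F (s, x0 + h, u (s, x0)) - F (s, x0, u (s, x0))) \<le> (1 + C) * norm h"
        by (simp add: z_def algebra_simps)
      have "norm (F (s, x0 + h, u (s, x0 + h)) - F (s, x0 + h, u (s, x0))) \<le> L * norm (u (s, x0 + h) - u (s, x0))"
        by (rule lip[OF s hP u_Q[OF s hP] u_Q[OF s x0]])
      then show "norm (F (s, x0 + h, u (s, x0 + h)) - F (s, x0, u (s, x0))) \<le>
          L * norm (u (s, x0 + h) - u (s, x0)) + (1 + C) * norm h"
        using 1 norm_triangle_ineq[of "F (s, x0 + h, u (s, x0 + h)) - F (s, x0 + h, u (s, x0))"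
            "F (s, x0 + h, u (s, x0)) - F (s, x0, u (s, x0))"] by simp
    qed
    moreover have "norm (u (0, x0 + h) - u (0, x0)) \<le> (1 + C0) * norm h"
      using d2(2)[of h] C0(2)[of h] h norm_triangle_sub[of "u (0, x0 + h) - u (0, x0)" "v h 0"]
      by (simp add: algebra_simps)
    ultimately show ?thesis by (simp add: C2_def algebra_simps)
  qed
  have main: "\<exists>d>0. \<forall>h. norm h < d \<longrightarrow> norm (u (t, x0 + h) - u (t, x0) - v h t) \<le> e * norm h"
    if "e > 0" for e
  proof -
    \<comment> \<open>Chosen so that the final bound 2 (e1 |h| + a' e1 (1 + C2) |h|) is exactly e
      |h|.\<close>
    define e1 where "e1 = e / (2 * (1 + a' * (1 + C2)))"
    have den: "2 * (1 + a' * (1 + C2)) > 0" using a' C2 by (intro mult_pos_pos add_pos_pos) auto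
    have e1: "e1 > 0" "e1 * (2 * (1 + a' * (1 + C2))) = e"
      using that den by (simp_all add: e1_def)
    obtain d3 where d3: "d3 > 0" "\<And>t k. t \<in> {-a'..a'} \<Longrightarrow> norm k < d3 \<Longrightarrow> z t + k \<in> S \<and>
        norm (F (z t + k) - F (z t) - D t k) \<le> e1 * norm k"
      using ud[OF e1(1)] unfolding D_def by auto
    obtain d4 where d4: "d4 > 0" "\<And>h. norm h < d4 \<Longrightarrow> norm (u (0, x0 + h) - u (0, x0) - v h 0) \<le> e1 * norm h"
    proof -
      obtain d where "d > 0" "\<And>y. norm (y - x0) < d \<Longrightarrow>
          norm (u (0, y) - u (0, x0) - v (y - x0) 0) \<le> e1 * norm (y - x0)"
        using b e1(1) unfolding has_derivative_at_alt by blast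
      then show ?thesis using that[of d] by (metis add_diff_cancel_left')
    qed
    \<comment> \<open>The increment of the full argument of F has norm at most (1 + C2) |h|, so
      dividing by 1 + C2 keeps it below \<open>d3\<close>.\<close>
    define d where "d = Min {d1, d2, d3 / (1 + C2), d4}"
    have d: "d > 0" "d \<le> d1" "d \<le> d2" "d \<le> d3 / (1 + C2)" "d \<le> d4"
      using d1 d2 d3 d4 C2 by (auto simp: d_def)
    have "norm (u (t, x0 + h) - u (t, x0) - v h t) \<le> e * norm h" if h: "norm h < d" for h
    proof -
      have hP: "x0 + h \<in> P" using d1(2)[of 0 "(0, h, 0)"] h d a' by (auto simp: z_def S_def norm_Pair)
      have "norm (u (t, x0 + h) - u (t, x0) - v h t) \<le>
          2 * (norm (u (0, x0 + h) - u (0, x0) - v h 0) + a' * (e1 * ((1 + C2) * norm h)))"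
      proof (rule ode_estimate[OF a'(1) pos(2) La' _ _ t])
        fix s assume s: "s \<in> {-a'..a'}"
        let ?w = "u (s, x0 + h) - u (s, x0) - v h s"
        let ?k = "(0::real, h, u (s, x0 + h) - u (s, x0))"
        show "((\<lambda>s. u (s, x0 + h) - u (s, x0) - v h s) has_vector_derivative
            F (s, x0 + h, u (s, x0 + h)) - F (s, x0, u (s, x0)) - D s (0, h, v h s)) (at s within {-a'..a'})"
          using u_der[OF s hP] u_der[OF s x0] v[OF s, of h] unfolding D_def z_def
          by (intro has_vector_derivative_diff)
        have "norm ?k \<le> norm h + norm (u (s, x0 + h) - u (s, x0))"
          using norm_Pair_le[of h "u (s, x0 + h) - u (s, x0)"] by (simp add: norm_Pair)
        also have "\<dots> \<le> (1 + C2) * norm h" using Delta[OF s, of h] h d by (simp add: algebra_simps)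
        finally have k: "norm ?k \<le> (1 + C2) * norm h" .
        also have "\<dots> < (1 + C2) * (d3 / (1 + C2))"
          using h d C2 by (intro mult_strict_left_mono) auto
        also have "\<dots> = d3" using C2 by simp
        finally have "norm (F (z s + ?k) - F (z s) - D s ?k) \<le> e1 * norm ?k" using d3(2)[OF s] by blast
        also have "\<dots> \<le> e1 * ((1 + C2) * norm h)" using k e1 by (intro mult_left_mono) auto
        finally have 1: "norm (F (s, x0 + h, u (s, x0 + h)) - F (s, x0, u (s, x0)) - D s ?k)
            \<le> e1 * ((1 + C2) * norm h)" by (simp add: z_def)
        have "D s ?k - D s (0, h, v h s) = D s (0, 0, ?w)"
          by (simp add: linear_diff[OF D_lin[OF s], symmetric])
        then have "norm (D s ?k - D s (0, h, v h s)) \<le> L * norm ?w" using D_u[OF s] by simp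
        then show "norm (F (s, x0 + h, u (s, x0 + h)) - F (s, x0, u (s, x0)) - D s (0, h, v h s))
            \<le> L * norm ?w + e1 * ((1 + C2) * norm h)"
          using 1 norm_triangle_ineq[of "F (s, x0 + h, u (s, x0 + h)) - F (s, x0, u (s, x0)) - D s ?k"
              "D s ?k - D s (0, h, v h s)"] by simp
      qed
      also have "\<dots> \<le> 2 * (e1 * norm h + a' * (e1 * ((1 + C2) * norm h)))"
        using d4(2)[of h] h d by simp
      also have "\<dots> = e1 * (2 * (1 + a' * (1 + C2))) * norm h" by (simp add: algebra_simps)
      finally show ?thesis using e1 by simp
    qed
    then show ?thesis using d(1) by blast
  qed
  show ?thesis
    unfolding has_derivative_at_alt
  proof (intro conjI allI impI)
    show "bounded_linear (\<lambda>h. v h t)" using lin linear_conv_bounded_linear by blast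
    fix e :: real assume "e > 0"
    then obtain d where d: "d > 0" "\<And>h. norm h < d \<Longrightarrow> norm (u (t, x0 + h) - u (t, x0) - v h t) \<le> e * norm h"
      using main by blast
    have "norm (u (t, y) - u (t, x0) - v (y - x0) t) \<le> e * norm (y - x0)" if "norm (y - x0) < d" for y
      using d(2)[OF that] by simp
    then show "\<exists>d>0. \<forall>y. norm (y - x0) < d \<longrightarrow> norm (u (t, y) - u (t, x0) - v (y - x0) t) \<le> e * norm (y - x0)"
      using d(1) by blast
  qed
qed

text \<open>Two uses of the induction hypothesis: first u itself is of class C^k, so the right-hand
  side of the variational equation, into which u is substituted, is also of class C^k; then the
  solutions of that equation are of class C^k. These are the parameter derivatives of u. The
  statement is general in a, Q, F and u because the second use has a smaller time, the whole space
  as state space and another equation.\<close>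

lemma ode_family_Ck:
  fixes F :: "real \<times> 'p::euclidean_space \<times> 'u::euclidean_space \<Rightarrow> 'u"
  assumes "ode_family a L P Q F u" "Ck_on k ({-a<..<a} \<times> P \<times> Q) F" "Ck_on k P (\<lambda>x. u (0, x))"
  shows "Ck_on k ({-a<..<a} \<times> P) u"
  using assms
proof (induction k arbitrary: a Q F u)
  case 0
  then show ?case using ode_family_continuous[OF 0(1)] by simp
next
  case (Suc k)
  note fam = Suc.prems(1)
  have pos: "0 < a" "0 \<le> L" "L * a \<le> 1/2" "open P" "open Q" using fam unfolding ode_family_def by auto
  have u_Q: "u (t, x) \<in> Q" if "t \<in> {-a<..<a}" "x \<in> P" for t x
    using fam that unfolding ode_family_def by auto
  let ?D = "\<lambda>z. frechet_derivative F (at z)"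
  have op: "open ({-a<..<a} \<times> P)" "open ({-a<..<a} \<times> P \<times> Q)" using pos by (auto intro: open_Times)
  have F1: "Ck_on (Suc 0) ({-a<..<a} \<times> P \<times> Q) F" by (rule Ck_on_le[OF Suc.prems(2)]) simp
  have uk: "Ck_on k ({-a<..<a} \<times> P) u"
    by (rule Suc.IH[OF fam Ck_on_Suc_D[OF Suc.prems(2)] Ck_on_Suc_D[OF Suc.prems(3)]])
  have Fu: "Ck_on k ({-a<..<a} \<times> P) (\<lambda>z. F (fst z, snd z, u z))"
    by (rule Ck_on_compose[OF op Ck_on_Suc_D[OF Suc.prems(2)]])
      (auto intro!: Ck_on_Pair op uk Ck_on_fst Ck_on_snd u_Q)
  have D_lin: "linear (?D (t, x, u (t, x)))" if "t \<in> {-a<..<a}" "x \<in> P" for t x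
    using Ck_on_Suc_has_derivative[OF F1, of "(t, x, u (t, x))"] that u_Q frechet_derivative_linear by blast
  have D_u: "norm (?D (t, x, u (t, x)) (0, 0, y)) \<le> L * norm y" if "t \<in> {-a<..<a}" "x \<in> P" for t x y
    by (rule ode_family_partial_bound[OF fam that Ck_on_Suc_has_derivative[OF F1]])
      (use that u_Q in auto)
  \<comment> \<open>The right-hand side of the variational equation for the derivative of u in the
    parameter direction e.\<close>
  define G where "G = (\<lambda>(e::'p) z. ?D (fst z, fst (snd z), u (fst z, fst (snd z))) (0, e, snd (snd z)))"
  have G: "Ck_on k ({-a<..<a} \<times> P \<times> UNIV) (G e)" for e
    unfolding G_def
  proof (rule Ck_on_frechet_apply[OF _ op(2) Suc.prems(2)])
    show o: "open ({-a<..<a} \<times> P \<times> (UNIV :: 'u set))" by (intro open_Times pos) simp_all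
    have 1: "Ck_on k ({-a<..<a} \<times> P \<times> (UNIV :: 'u set)) (\<lambda>z. fst (snd z))"
      "Ck_on k ({-a<..<a} \<times> P \<times> (UNIV :: 'u set)) (\<lambda>z. snd (snd z))"
      by (rule Ck_on_compose_linear[OF linear_fst_snd(1) o Ck_on_snd],
          rule Ck_on_compose_linear[OF linear_fst_snd(2) o Ck_on_snd])
    then have "Ck_on k ({-a<..<a} \<times> P \<times> (UNIV :: 'u set)) (\<lambda>z. u (fst z, fst (snd z)))"
      by (intro Ck_on_compose[OF o op(1) uk] Ck_on_Pair o Ck_on_fst) auto
    with 1 have "Ck_on k ({-a<..<a} \<times> P \<times> (UNIV :: 'u set)) (\<lambda>z. (fst z, fst (snd z), u (fst z, fst (snd z))))"
      "Ck_on k ({-a<..<a} \<times> P \<times> (UNIV :: 'u set)) (\<lambda>z. (0, e, snd (snd z)))"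
      by (auto intro!: Ck_on_Pair o Ck_on_fst Ck_on_const)
    then show "Ck_on k ({-a<..<a} \<times> P \<times> (UNIV :: 'u set)) (\<lambda>z. (fst z, fst (snd z), u (fst z, fst (snd z))))"
      "Ck_on k ({-a<..<a} \<times> P \<times> (UNIV :: 'u set)) (\<lambda>z. (0, e, snd (snd z)))" by auto
  qed (auto simp: u_Q)
  have G_lip: "norm (G e (t, x, y) - G e (t, x, z)) \<le> L * norm (y - z)"
    if "t \<in> {-a<..<a}" "x \<in> P" for e t x y z
  proof -
    have "G e (t, x, y) - G e (t, x, z) = ?D (t, x, u (t, x)) (0, 0, y - z)"
      by (simp add: G_def linear_diff[OF D_lin[OF that], symmetric])
    then show ?thesis using D_u[OF that] by simp
  qed
  show ?case
  proof (rule Ck_on_local)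
    fix z0 assume z0: "z0 \<in> {-a<..<a} \<times> P"
    define a' where "a' = (\<bar>fst z0\<bar> + a) / 2"
    have a': "0 < a'" "a' < a" "\<bar>fst z0\<bar> < a'" using z0 pos(1) by (auto simp: a'_def)
    have La': "L * a' \<le> 1/2" using pos a' mult_left_mono[of a' a L] by linarith
    let ?sol = "\<lambda>e x v. v 0 = frechet_derivative (\<lambda>x. u (0, x)) (at x) e \<and>
      (\<forall>t\<in>{-a'..a'}. (v has_vector_derivative G e (t, x, v t)) (at t within {-a'..a'}))"
    have ex: "\<exists>v. ?sol e x v" if x: "x \<in> P" for e x
    proof (rule ode_exists[OF a'(1) pos(2) La'])
      have "continuous_on ({-a'..a'} \<times> UNIV) (\<lambda>z. G e (fst z, x, snd z))"
        by (rule continuous_on_compose2[OF Ck_on_continuous[OF G]])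
          (use x a' in \<open>auto intro!: continuous_intros\<close>)
      then show "continuous_on ({-a'..a'} \<times> UNIV) (\<lambda>(t, y). G e (t, x, y))"
        by (simp add: case_prod_beta')
      show "norm (G e (t, x, y) - G e (t, x, z)) \<le> L * norm (y - z)" if "t \<in> {-a'..a'}" for t y z
        by (rule G_lip) (use that a' x in auto)
    qed
    \<comment> \<open>The derivative must be available as a solution before u is known to be
      differentiable. Existence is proved on compact time intervals, hence the passage to
      a'.\<close>
    define V where "V = (\<lambda>e x. SOME v. ?sol e x v)"
    have sol: "?sol e x (V e x)" if "x \<in> P" for e x
      unfolding V_def by (rule someI_ex[OF ex[OF that]])
    have V0: "V e x 0 = frechet_derivative (\<lambda>x. u (0, x)) (at x) e" if "x \<in> P" for e x
      using sol[OF that] by blast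
    have V: "(V e x has_vector_derivative G e (t, x, V e x t)) (at t within {-a'..a'})"
      if "x \<in> P" "t \<in> {-a'..a'}" for e x t
      using sol[OF that(1)] that(2) by blast
    have V_fam: "ode_family a' L P UNIV (G e) (\<lambda>(t, x). V e x t)" for e
      unfolding ode_family_def
    proof (intro conjI ballI)
      fix t x assume t: "t \<in> {-a'<..<a'}" and x: "x \<in> P"
      have "(V e x has_vector_derivative G e (t, x, V e x t)) (at t within {-a'..a'})"
        by (rule V[OF x]) (use t in auto)
      moreover have "at t within {-a'..a'} = at t" using t by (intro at_within_interior) auto
      ultimately show "((\<lambda>s. case (s, x) of (t, x) \<Rightarrow> V e x t) has_vector_derivative
          G e (t, x, case (t, x) of (t, x) \<Rightarrow> V e x t)) (at t)" by simp
      show "norm (G e (t, x, y) - G e (t, x, z)) \<le> L * norm (y - z)" for y z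
        by (rule G_lip) (use t x a' in auto)
    qed (use a' pos La' in auto)
    have V_Ck: "Ck_on k ({-a'<..<a'} \<times> P) (\<lambda>z. V e (snd z) (fst z))" for e
    proof -
      have 1: "Ck_on k ({-a'<..<a'} \<times> P \<times> UNIV) (G e)"
        by (rule Ck_on_subset[OF G]) (use a' in auto)
      have "Ck_on k P (\<lambda>x. frechet_derivative (\<lambda>x. u (0, x)) (at x) e)" using Suc.prems(3) by simp
      then have 2: "Ck_on k P (\<lambda>x. case (0, x) of (t, x) \<Rightarrow> V e x t)"
        by (rule Ck_on_transform[OF pos(4)]) (simp add: V0)
      show ?thesis using Suc.IH[OF V_fam 1 2] by (simp add: case_prod_beta')
    qed
    \<comment> \<open>The total derivative: parameter directions are expanded in the basis, and the
      time direction contributes the equation itself.\<close>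
    let ?f' = "\<lambda>z v. (\<Sum>e\<in>Basis. (snd v \<bullet> e) *\<^sub>R V e (snd z) (fst z)) + fst v *\<^sub>R F (fst z, snd z, u z)"
    have op': "open ({-a'<..<a'} \<times> P)" using pos by (auto intro: open_Times)
    have der: "(u has_derivative ?f' z) (at z)" if z: "z \<in> {-a'<..<a'} \<times> P" for z
    proof -
      obtain t x where tx: "z = (t, x)" "t \<in> {-a'<..<a'}" "x \<in> P" using z by auto
      define v where "v = (\<lambda>h s. \<Sum>e\<in>Basis. (h \<bullet> e) *\<^sub>R V e x s)"
      have v_lin: "linear (\<lambda>h. v h s)" for s
        unfolding v_def by (auto intro!: linearI simp: inner_add_left scaleR_left_distrib sum.distrib scaleR_sum_right)
      have v0: "v h 0 = frechet_derivative (\<lambda>x. u (0, x)) (at x) h" for h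
        unfolding v_def V0[OF tx(3)]
        using linear_basis_expansion[OF frechet_derivative_linear[OF Ck_on_Suc_has_derivative[OF Suc.prems(3) tx(3)]], of h]
        by simp
      have "((\<lambda>x. u (t, x)) has_derivative (\<lambda>h. v h t)) (at x)"
      proof (rule ode_family_param_derivative[OF fam F1 _ tx(3) a'(1,2) v_lin])
        show "((\<lambda>x. u (0, x)) has_derivative (\<lambda>h. v h 0)) (at x)"
          unfolding v0 by (rule Ck_on_Suc_has_derivative[OF Suc.prems(3) tx(3)])
        show "t \<in> {-a'..a'}" using tx by auto
        fix h s assume s: "s \<in> {-a'..a'}"
        then have sa: "s \<in> {-a<..<a}" using a' by auto
        have "(v h has_vector_derivative (\<Sum>e\<in>Basis. (h \<bullet> e) *\<^sub>R G e (s, x, V e x s))) (at s within {-a'..a'})"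
          unfolding v_def
          by (intro has_vector_derivative_sum bounded_linear.has_vector_derivative[OF bounded_linear_scaleR_right])
            (rule V[OF tx(3) s])
        moreover have "(\<Sum>e\<in>Basis. (h \<bullet> e) *\<^sub>R G e (s, x, V e x s)) =
            ?D (s, x, u (s, x)) (\<Sum>e\<in>Basis. (h \<bullet> e) *\<^sub>R (0, e, V e x s))"
          by (simp only: linear_sum[OF D_lin[OF sa tx(3)]] linear_scale[OF D_lin[OF sa tx(3)]] G_def fst_conv snd_conv)
        moreover have "(\<Sum>e\<in>Basis. (h \<bullet> e) *\<^sub>R (0::real, e, V e x s)) = (0, h, v h s)"
          by (simp add: prod_eq_iff fst_sum snd_sum euclidean_representation v_def)
        ultimately show "(v h has_vector_derivative ?D (s, x, u (s, x)) (0, h, v h s)) (at s within {-a'..a'})"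
          by simp
      qed
      then have 1: "((\<lambda>x. u (t, x)) has_derivative (\<lambda>h. v h t)) (at x within P)"
        by (rule has_derivative_at_withinI)
      have c: "continuous_on (P \<times> {-a'<..<a'}) (\<lambda>(x, s). blinfun_scaleR_left (F (s, x, u (s, x))))"
      proof -
        have "continuous_on (P \<times> {-a'<..<a'}) (\<lambda>z. F (snd z, fst z, u (snd z, fst z)))"
          by (rule continuous_on_compose2[OF Ck_on_continuous[OF Fu], where f = "\<lambda>z. (snd z, fst z)", simplified])
            (use a' in \<open>auto intro!: continuous_intros\<close>)
        then show ?thesis by (auto simp: case_prod_beta' intro!: continuous_intros)
      qed
      \<comment> \<open>The criterion by partial derivatives wants one partial derivative at the
        point and the other one continuous. Continuity is at hand in time, so time is put second and
        swapped back afterwards.\<close>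
      have "((\<lambda>(x, s). u (s, x)) has_derivative
          (\<lambda>(tx, ty). v tx t + blinfun_scaleR_left (F (t, x, u (t, x))) ty)) (at (x, t) within P \<times> {-a'<..<a'})"
      proof (rule has_derivative_partialsI[where f = "\<lambda>x s. u (s, x)" and y = t, OF 1])
        fix y s assume ys: "y \<in> P" "s \<in> {-a'<..<a'}"
        have "((\<lambda>s. u (s, y)) has_vector_derivative F (s, y, u (s, y))) (at s)"
          using fam ys a' unfolding ode_family_def by auto
        then show "((\<lambda>s. u (s, y)) has_derivative blinfun_apply (blinfun_scaleR_left (F (s, y, u (s, y)))))
            (at s within {-a'<..<a'})"
          by (simp add: has_vector_derivative_def has_derivative_at_withinI)
      next
        show "continuous (at (x, t) within P \<times> {-a'<..<a'}) (\<lambda>(x, s). blinfun_scaleR_left (F (s, x, u (s, x))))"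
          using c tx by (simp add: continuous_on_eq_continuous_within)
      qed (use tx in auto)
      then have "((\<lambda>(x, s). u (s, x)) has_derivative (\<lambda>(h, s). v h t + s *\<^sub>R F (t, x, u (t, x)))) (at (x, t))"
        using tx pos(4) by (subst (asm) at_within_open) (auto intro: open_Times)
      then have "(((\<lambda>(x, s). u (s, x)) \<circ> (\<lambda>z. (snd z, fst z))) has_derivative
          (\<lambda>(h, s). v h t + s *\<^sub>R F (t, x, u (t, x))) \<circ> (\<lambda>z. (snd z, fst z))) (at z)"
        by (intro diff_chain_at) (auto simp: tx intro!: derivative_eq_intros)
      then show ?thesis by (simp add: o_def tx v_def)
    qed
    have "Ck_on (Suc k) ({-a'<..<a'} \<times> P) u"
    proof (rule Ck_on_Suc_I[OF op' der])
      show "Ck_on k ({-a'<..<a'} \<times> P) (\<lambda>z. ?f' z v)" for v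
        by (intro Ck_on_add Ck_on_sum op' Ck_on_compose_linear[where L = "\<lambda>y. _ *\<^sub>R y"] V_Ck
            Ck_on_subset[OF Fu]) (use a' in \<open>auto simp: linear_iff algebra_simps\<close>)
    qed
    then show "\<exists>T. open T \<and> z0 \<in> T \<and> Ck_on (Suc k) T u"
      using op' z0 a' by (intro exI[of _ "{-a'<..<a'} \<times> P"]) auto
  qed
qed

section \<open>Smooth families and local flows\<close>

lemma ode_family_smooth:
  "ode_family a L P Q F u \<Longrightarrow> smooth_on ({-a<..<a} \<times> P \<times> Q) F \<Longrightarrow> smooth_on P (\<lambda>x. u (0, x))
    \<Longrightarrow> smooth_on ({-a<..<a} \<times> P) u"
  unfolding smooth_on_def using ode_family_Ck by blast

text \<open>Existence requires a field that is Lipschitz on the whole space, so f is composed with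
  the nearest-point projection to a closed ball. The projection is 1-Lipschitz and keeps the
  constant. Solutions starting in the ball of half the radius stay where the projection is the
  identity and therefore solve the original equation.\<close>

lemma smooth_flow_exists:
  fixes f :: "'e::euclidean_space \<Rightarrow> 'e"
  assumes "open S" "smooth_on S f" "p \<in> S"
  obtains a r u where "a > 0" "r > 0" "ball p r \<subseteq> S" "smooth_on ({-a<..<a} \<times> ball p r) u"
    "\<And>x. x \<in> ball p r \<Longrightarrow> u (0, x) = x"
    "\<And>t x. t \<in> {-a<..<a} \<Longrightarrow> x \<in> ball p r \<Longrightarrow> u (t, x) \<in> S"
    "\<And>t x. t \<in> {-a<..<a} \<Longrightarrow> x \<in> ball p r \<Longrightarrow>
      ((\<lambda>s. u (s, x)) has_vector_derivative f (u (t, x))) (at t)"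
proof -
  obtain R where R: "R > 0" "cball p R \<subseteq> S" using assms(1,3) open_contains_cball by blast
  let ?K = "cball p R"
  have f1: "Ck_on (Suc 0) S f" using assms(2) unfolding smooth_on_def by blast
  have fc: "continuous_on S f" by (rule smooth_on_continuous[OF assms(2)])
  have "compact (f ` ?K)" using continuous_on_subset[OF fc R(2)] by (intro compact_continuous_image) auto
  then obtain M where M: "M > 0" "\<And>x. x \<in> ?K \<Longrightarrow> norm (f x) \<le> M"
    using compact_imp_bounded bounded_pos by (metis (no_types, lifting) imageI)
  have "compact ((\<lambda>z. Blinfun (frechet_derivative f (at z))) ` ?K)"
    using continuous_on_subset[OF continuous_on_Blinfun_frechet[OF f1] R(2)]
    by (intro compact_continuous_image) auto
  then obtain L where L: "L > 0" "\<And>x. x \<in> ?K \<Longrightarrow> norm (Blinfun (frechet_derivative f (at x))) \<le> L"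
    using compact_imp_bounded bounded_pos by (metis (no_types, lifting) imageI)
  have lip: "norm (f x - f y) \<le> L * norm (x - y)" if "x \<in> ?K" "y \<in> ?K" for x y
  proof (rule differentiable_bound[OF convex_cball _ _ that, of f "\<lambda>x. frechet_derivative f (at x)"])
    fix z assume z: "z \<in> ?K"
    then have "z \<in> S" using R by auto
    then show "(f has_derivative frechet_derivative f (at z)) (at z within ?K)"
      using smooth_on_has_derivative[OF assms(2)] has_derivative_at_withinI by blast
    show "onorm (frechet_derivative f (at z)) \<le> L"
      using L(2)[OF z] Blinfun_frechet[OF f1 \<open>z \<in> S\<close>] by (simp add: norm_blinfun.rep_eq)
  qed
  \<comment> \<open>The first bound gives L a \<le> 1/2; the second limits the displacement of a
    solution to R/4, so it cannot leave the ball of radius R when starting within R/2.\<close>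
  define a where "a = min (1 / (2 * L)) (R / (4 * M))"
  have a: "a > 0" "a \<le> 1 / (2 * L)" "a \<le> R / (4 * M)" using L M R by (auto simp: a_def)
  then have aLM: "L * a \<le> 1/2" "M * a \<le> R / 4" using L(1) M(1) by (simp_all add: field_simps)
  let ?c = "closest_point ?K"
  have c: "?c y \<in> ?K" for y using R by (intro closest_point_in_set) auto
  have c_lip: "norm (?c y - ?c z) \<le> norm (y - z)" for y z
    using closest_point_lipschitz[of ?K y z] R by (simp add: dist_norm)
  let ?sol = "\<lambda>x v. v 0 = x \<and> (\<forall>t\<in>{-a..a}. (v has_vector_derivative f (?c (v t))) (at t within {-a..a}))"
  have "\<exists>v. ?sol x v" for x
  proof (rule ode_exists[of a L "\<lambda>t y. f (?c y)"])
    have "continuous_on UNIV (\<lambda>y. f (?c y))"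
      by (rule continuous_on_compose2[OF fc])
        (use c R in \<open>auto intro!: continuous_on_closest_point\<close>)
    then show "continuous_on ({-a..a} \<times> UNIV) (\<lambda>(t, y). f (?c y))"
      unfolding case_prod_beta' by (rule continuous_on_compose2) (auto intro!: continuous_intros)
    show "norm (f (?c y) - f (?c z)) \<le> L * norm (y - z)" for y z
      using lip[OF c c, of y z] mult_left_mono[OF c_lip, of L y z] L by linarith
  qed (use a L aLM in auto)
  then obtain v where v: "\<And>x. ?sol x (v x)" by metis
  have v_near: "norm (v x t - x) \<le> R / 4" if t: "t \<in> {-a..a}" for x t
  proof -
    have "norm (v x t - v x 0) \<le> M * norm (t - 0)"
    proof (rule differentiable_bound[of "{-a..a}" "v x" "\<lambda>t h. h *\<^sub>R f (?c (v x t))"])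
      show "(v x has_derivative (\<lambda>h. h *\<^sub>R f (?c (v x s)))) (at s within {-a..a})"
        if "s \<in> {-a..a}" for s using v that by (simp add: has_vector_derivative_def)
      show "onorm (\<lambda>h. h *\<^sub>R f (?c (v x s))) \<le> M" for s
        using M(2)[OF c] by (intro onorm_le) (simp add: mult.commute[of M] mult_left_mono)
    qed (use t a in auto)
    also have "\<dots> \<le> M * a" using t M by (intro mult_left_mono) auto
    finally show ?thesis using v aLM by auto
  qed
  have v_in: "v x t \<in> ball p R" if "t \<in> {-a<..<a}" "x \<in> ball p (R/2)" for x t
  proof -
    have "norm (x - p) < R / 2" using that(2) by (simp add: dist_norm norm_minus_commute)
    moreover have "norm (v x t - x) \<le> R / 4" using that(1) by (intro v_near) auto
    ultimately have "norm (v x t - p) < R"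
      using norm_triangle_ineq[of "v x t - x" "x - p"] R(1) by simp
    then show ?thesis by (simp add: dist_norm norm_minus_commute)
  qed
  let ?u = "\<lambda>z. v (snd z) (fst z)"
  have der: "((\<lambda>s. ?u (s, x)) has_vector_derivative f (?u (t, x))) (at t)"
    if t: "t \<in> {-a<..<a}" and x: "x \<in> ball p (R/2)" for t x
  proof -
    have "(v x has_vector_derivative f (?c (v x t))) (at t within {-a..a})" using v t by auto
    moreover have "at t within {-a..a} = at t" using t by (intro at_within_interior) auto
    moreover have "?c (v x t) = v x t" using v_in[OF t x] by (intro closest_point_self) auto
    ultimately show ?thesis by simp
  qed
  have "ode_family a L (ball p (R/2)) (ball p R) (\<lambda>z. f (snd (snd z))) ?u"
    unfolding ode_family_def using a L aLM der v_in by (auto intro!: lip simp del: mem_ball) auto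
  then have "smooth_on ({-a<..<a} \<times> ball p (R/2)) ?u"
  proof (rule ode_family_smooth)
    have "open ({-a<..<a} \<times> ball p (R/2) \<times> ball p R)" by (intro open_Times) auto
    then show "smooth_on ({-a<..<a} \<times> ball p (R/2) \<times> ball p R) (\<lambda>z. f (snd (snd z)))"
      by (rule smooth_on_compose[OF _ assms(1,2)])
        (use R in \<open>auto intro!: smooth_on_linear simp: linear_iff\<close>)
    show "smooth_on (ball p (R/2)) (\<lambda>x. ?u (0, x))"
      using v smooth_on_id by simp
  qed
  moreover have "ball p R \<subseteq> S" "ball p (R/2) \<subseteq> S" using R by auto
  ultimately show thesis
    using a(1) R(1) v der v_in by (intro that[of a "R/2" ?u]) auto
qed

subsection \<open>The lemmas of Hadamard and Poincare\<close>

text \<open>A product rule in which the second factor is only continuous: where the first factor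
  vanishes, the variation of the second is multiplied by something of first order. It yields
  derivatives before the second factor is known to be differentiable.\<close>

lemma has_derivative_scaleR_vanishing:
  fixes c :: "'e::real_normed_vector \<Rightarrow> real" and n :: "'e \<Rightarrow> 'f::real_normed_vector"
  assumes c: "(c has_derivative c') (at x)" "c x = 0" and n: "isCont n x"
  shows "((\<lambda>y. c y *\<^sub>R n y) has_derivative (\<lambda>h. c' h *\<^sub>R n x)) (at x)"
proof -
  have bl: "bounded_linear c'" using c(1) has_derivative_bounded_linear by blast
  obtain K where K: "K > 0" "\<And>h. norm (c' h) \<le> norm h * K" using bounded_linear.pos_bounded[OF bl] by blast
  have "((\<lambda>y. c y *\<^sub>R (n y - n x)) has_derivative (\<lambda>h. 0)) (at x)"
    unfolding has_derivative_at_alt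
  proof (intro conjI allI impI)
    fix e :: real assume "e > 0"
    obtain d1 where d1: "d1 > 0" "\<And>y. norm (y - x) < d1 \<Longrightarrow> norm (c y - c x - c' (y - x)) \<le> 1 * norm (y - x)"
      using c(1) zero_less_one unfolding has_derivative_at_alt by blast
    have "e / (K + 1) > 0" using \<open>e > 0\<close> K by simp
    then obtain d2 where d2: "d2 > 0" "\<And>y. dist y x < d2 \<Longrightarrow> dist (n y) (n x) < e / (K + 1)"
      using n unfolding continuous_at_eps_delta by blast
    have "norm (c y *\<^sub>R (n y - n x) - c x *\<^sub>R (n x - n x) - 0) \<le> e * norm (y - x)"
      if y: "norm (y - x) < min d1 d2" for y
    proof -
      have "norm (c y) \<le> norm (c y - c' (y - x)) + norm (c' (y - x))"
        by (metis add.commute norm_triangle_sub)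
      then have "norm (c y) \<le> (K + 1) * norm (y - x)"
        using d1(2)[of y] y K(2)[of "y - x"] c(2) by (simp add: algebra_simps)
      moreover have "norm (n y - n x) \<le> e / (K + 1)" using d2(2)[of y] y by (simp add: dist_norm)
      ultimately have "norm (c y) * norm (n y - n x) \<le> (K + 1) * norm (y - x) * (e / (K + 1))"
        by (intro mult_mono) (use K in auto)
      then show ?thesis using c(2) K by (simp add: mult.commute)
    qed
    then show "\<exists>d>0. \<forall>y. norm (y - x) < d \<longrightarrow>
        norm (c y *\<^sub>R (n y - n x) - c x *\<^sub>R (n x - n x) - 0) \<le> e * norm (y - x)"
      using d1 d2 by (intro exI[of _ "min d1 d2"]) auto
  qed simp
  moreover have "((\<lambda>y. c y *\<^sub>R n x) has_derivative (\<lambda>h. c' h *\<^sub>R n x)) (at x)"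
    by (rule bounded_linear.has_derivative[OF bounded_linear_scaleR_left c(1)])
  ultimately have "((\<lambda>y. c y *\<^sub>R (n y - n x) + c y *\<^sub>R n x) has_derivative (\<lambda>h. 0 + c' h *\<^sub>R n x)) (at x)"
    by (rule has_derivative_add)
  then show ?thesis by (simp add: algebra_simps)
qed

text \<open>The coefficient \<open>g b x\<close> is the integral over t from 0 to 1 of the b-th
  partial derivative of f at p + t (x - p). It is produced as the value at time 1 of a differential
  equation, so that its smoothness in x is an instance of the theorem on parameters.\<close>

lemma hadamard_lemma:
  fixes f :: "'e::euclidean_space \<Rightarrow> real"
  assumes "r > 0" "smooth_on (ball p r) f"
  obtains g where "\<And>b. smooth_on (ball p (r/2)) (g b)"
    "\<And>x. x \<in> ball p (r/2) \<Longrightarrow> f x = f p + (\<Sum>b\<in>Basis. ((x - p) \<bullet> b) * g b x)"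
    "\<And>b. b \<in> Basis \<Longrightarrow> g b p = frechet_derivative f (at p) b"
proof -
  let ?P = "ball p (r/2)" and ?D = "\<lambda>x. frechet_derivative f (at x)"
  \<comment> \<open>Time 1 must be interior to an interval symmetric about 0; with times up to 2,
    points within r/2 are needed.\<close>
  have in_ball: "p + t *\<^sub>R (x - p) \<in> ball p r" if "t \<in> {-2..2}" "x \<in> ?P" for t x
  proof -
    have "norm (t *\<^sub>R (x - p)) \<le> 2 * norm (x - p)" using that by (auto intro!: mult_right_mono)
    moreover have "norm (x - p) < r / 2" using that(2) by (simp add: dist_norm norm_minus_commute)
    ultimately have "norm (t *\<^sub>R (x - p)) < r" by linarith
    then show ?thesis by (simp add: dist_norm)
  qed
  \<comment> \<open>The state does not occur on the right, so the Lipschitz constant is 0 and the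
    time 2 is admissible.\<close>
  define F where "F = (\<lambda>b (z :: real \<times> 'e \<times> real). ?D (p + fst z *\<^sub>R (fst (snd z) - p)) b)"
  have F: "smooth_on ({-2<..<2} \<times> ?P \<times> UNIV) (F b)" for b
    unfolding F_def
  proof (rule smooth_on_compose[where T = "ball p r" and f = "\<lambda>y. ?D y b"])
    show o: "open ({-2<..<2::real} \<times> ?P \<times> (UNIV :: real set))" by (intro open_Times) auto
    show "smooth_on ({-2<..<2::real} \<times> ?P \<times> (UNIV :: real set)) (\<lambda>z. p + fst z *\<^sub>R (fst (snd z) - p))"
      by (intro smooth_on_add smooth_on_scaleR smooth_on_diff smooth_on_const o smooth_on_linear)
        (auto simp: linear_iff)
    show "(\<lambda>z. p + fst z *\<^sub>R (fst (snd z) - p)) ` ({-2<..<2} \<times> ?P \<times> UNIV) \<subseteq> ball p r"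
      using in_ball by fastforce
  qed (use smooth_on_frechet[OF assms(2)] in auto)
  let ?sol = "\<lambda>b x v. v 0 = (0::real) \<and> (\<forall>t\<in>{-2..2}. (v has_vector_derivative F b (t, x, v t)) (at t within {-2..2}))"
  have ex: "\<exists>v. ?sol b x v" if x: "x \<in> ?P" for b x
  proof (rule ode_exists[of 2 0 "\<lambda>t y. F b (t, x, y)"])
    have "continuous_on ({-2..2} \<times> UNIV) (\<lambda>z. ?D (p + fst z *\<^sub>R (x - p)) b)"
      by (rule continuous_on_compose2[OF smooth_on_continuous[OF smooth_on_frechet[OF assms(2)]]])
        (use in_ball[OF _ x] in \<open>auto intro!: continuous_intros simp del: mem_ball\<close>)
    then show "continuous_on ({-2..2} \<times> UNIV) (\<lambda>(t, y). F b (t, x, y))"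
      by (simp add: case_prod_beta' F_def)
  qed (auto simp: F_def)
  define v where "v = (\<lambda>b x. SOME v. ?sol b x v)"
  have v: "?sol b x (v b x)" if "x \<in> ?P" for b x
    unfolding v_def by (rule someI_ex[OF ex[OF that]])
  have "ode_family 2 0 ?P UNIV (F b) (\<lambda>z. v b (snd z) (fst z))" for b
    unfolding ode_family_def
  proof (intro conjI ballI)
    fix t x assume t: "t \<in> {-2<..<2::real}" and x: "x \<in> ?P"
    have "(v b x has_vector_derivative F b (t, x, v b x t)) (at t within {-2..2})"
      using v[OF x] t by auto
    moreover have "at t within {-2..2} = at t" using t by (intro at_within_interior) auto
    ultimately show "((\<lambda>s. v b (snd (s, x)) (fst (s, x))) has_vector_derivative
        F b (t, x, v b (snd (t, x)) (fst (t, x)))) (at t)" by simp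
  qed (auto simp: F_def)
  then have "smooth_on ({-2<..<2} \<times> ?P) (\<lambda>z. v b (snd z) (fst z))" for b
    by (rule ode_family_smooth[OF _ F])
      (rule smooth_on_transform[OF _ smooth_on_const[of _ 0]], use v in auto)
  then have vs: "smooth_on ({-2<..<2} \<times> ?P) (\<lambda>z. v b (snd z) (fst z))" for b .
  have sm: "smooth_on ?P (\<lambda>x. v b x 1)" for b
  proof -
    have "smooth_on ?P (\<lambda>x. (1::real, x))" by (intro smooth_on_Pair smooth_on_const smooth_on_id) simp
    moreover have "open ({-2<..<2::real} \<times> ?P)" by (intro open_Times) auto
    moreover have "(\<lambda>x. (1::real, x)) ` ?P \<subseteq> {-2<..<2} \<times> ?P" by auto
    ultimately have "smooth_on ?P (\<lambda>x. v b (snd (1::real, x)) (fst (1::real, x)))"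
      using smooth_on_compose[OF open_ball _ vs] by blast
    then show ?thesis by simp
  qed
  have eq: "f x = f p + (\<Sum>b\<in>Basis. ((x - p) \<bullet> b) * v b x 1)" if x: "x \<in> ?P" for x
  proof -
    let ?w = "\<lambda>t. f (p + t *\<^sub>R (x - p)) - (\<Sum>b\<in>Basis. ((x - p) \<bullet> b) *\<^sub>R v b x t)"
    have "(?w has_vector_derivative 0) (at t within {-2..2})" if t: "t \<in> {-2..2}" for t
    proof -
      note inb = in_ball[OF t x]
      have "((\<lambda>t. f (p + t *\<^sub>R (x - p))) has_derivative (\<lambda>h. ?D (p + t *\<^sub>R (x - p)) (h *\<^sub>R (x - p)))) (at t within {-2..2})"
        by (rule has_derivative_compose[where f = "\<lambda>t. p + t *\<^sub>R (x - p)" and g = f, OF _ smooth_on_has_derivative[OF assms(2) inb]])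
          (auto intro!: derivative_eq_intros)
      then have "((\<lambda>t. f (p + t *\<^sub>R (x - p))) has_vector_derivative ?D (p + t *\<^sub>R (x - p)) (x - p)) (at t within {-2..2})"
        by (simp add: has_vector_derivative_def linear_scale[OF smooth_on_frechet_linear[OF assms(2) inb]])
      note 1 = this
      have 2: "((\<lambda>t. \<Sum>b\<in>Basis. ((x - p) \<bullet> b) *\<^sub>R v b x t) has_vector_derivative
          (\<Sum>b\<in>Basis. ((x - p) \<bullet> b) *\<^sub>R F b (t, x, v b x t))) (at t within {-2..2})"
        by (intro has_vector_derivative_sum bounded_linear.has_vector_derivative[OF bounded_linear_scaleR_right])
          (use v[OF x] t in auto)
      have 3: "(\<Sum>b\<in>Basis. ((x - p) \<bullet> b) *\<^sub>R F b (t, x, v b x t)) = ?D (p + t *\<^sub>R (x - p)) (x - p)"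
        using linear_basis_expansion[OF smooth_on_frechet_linear[OF assms(2) inb], of "x - p"]
        by (simp add: F_def)
      show ?thesis using has_vector_derivative_diff[OF 1 2] 3 by simp
    qed
    then show ?thesis
    proof (rule has_vector_derivative_zero_constant[OF convex_real_interval(5)])
      fix c assume c: "\<And>t. t \<in> {-2..2} \<Longrightarrow> ?w t = c"
      from c[of 0] c[of 1] v[OF x] show ?thesis by simp
    qed
  qed
  \<comment> \<open>The expansion is differentiated at p. All coordinate factors vanish there, so
    continuity of the coefficients suffices.\<close>
  have "frechet_derivative f (at p) c = v c p 1" if "c \<in> Basis" for c
  proof -
    have p: "p \<in> ?P" using assms(1) by simp
    have "isCont (\<lambda>x. v b x 1) p" for b
      using smooth_on_continuous[OF sm] p continuous_on_eq_continuous_at open_ball by blast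
    then have "((\<lambda>x. f p + (\<Sum>b\<in>Basis. ((x - p) \<bullet> b) *\<^sub>R v b x 1)) has_derivative
        (\<lambda>h. 0 + (\<Sum>b\<in>Basis. (h \<bullet> b) *\<^sub>R v b p 1))) (at p)"
      by (intro has_derivative_add has_derivative_const has_derivative_sum has_derivative_scaleR_vanishing)
        (auto intro!: derivative_eq_intros)
    then have "((\<lambda>x. f p + (\<Sum>b\<in>Basis. ((x - p) \<bullet> b) * v b x 1)) has_derivative
        (\<lambda>h. \<Sum>b\<in>Basis. (h \<bullet> b) * v b p 1)) (at p)" by simp
    then have "(f has_derivative (\<lambda>h. \<Sum>b\<in>Basis. (h \<bullet> b) * v b p 1)) (at p)"
      by (rule has_derivative_transform_within_open[OF _ open_ball p]) (rule eq[symmetric])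
    from frechet_derivative_at[OF this, symmetric] show ?thesis
      using that by (simp add: inner_Basis if_distrib[of "\<lambda>x. x * _"] cong: if_cong)
  qed
  then show thesis using sm eq by (intro that[of "\<lambda>b x. v b x 1"]) auto
qed

text \<open>The potential is the integral of the form along the segment from p to z, differentiated
  under the integral sign.\<close>

lemma poincare_lemma_1_forms:
  fixes \<omega> :: "'e::euclidean_space \<Rightarrow> 'e \<Rightarrow> real"
  assumes lin: "\<And>z. z \<in> ball p r \<Longrightarrow> linear (\<omega> z)"
    and sm: "\<And>v. smooth_on (ball p r) (\<lambda>z. \<omega> z v)"
    and closed: "\<And>z v w. z \<in> ball p r \<Longrightarrow>
      frechet_derivative (\<lambda>z. \<omega> z v) (at z) w = frechet_derivative (\<lambda>z. \<omega> z w) (at z) v"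
  obtains T where "smooth_on (ball p r) T" "\<And>z. z \<in> ball p r \<Longrightarrow> (T has_derivative \<omega> z) (at z)" "T p = 0"
proof -
  let ?S = "ball p r"
  let ?d = "\<lambda>v z. frechet_derivative (\<lambda>z. \<omega> z v) (at z)"
  let ?\<gamma> = "\<lambda>z s. p + s *\<^sub>R (z - p)"
  have \<gamma>: "?\<gamma> z s \<in> ?S" if "z \<in> ?S" "s \<in> {0..1}" for z s
  proof -
    have "norm (s *\<^sub>R (z - p)) \<le> norm (z - p)" using that by (auto intro!: mult_left_le_one_le)
    then have "norm (s *\<^sub>R (z - p)) < r" using that(1) by (simp add: dist_norm norm_minus_commute)
    then show ?thesis by (simp add: dist_norm)
  qed
  have d_lin: "linear (?d v z)" if "z \<in> ?S" for v z by (rule smooth_on_frechet_linear[OF sm that])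
  define f where "f = (\<lambda>z s. \<Sum>b\<in>Basis. ((z - p) \<bullet> b) * \<omega> (?\<gamma> z s) b)"
  define fx where "fx = (\<lambda>z s h. \<Sum>b\<in>Basis. ((z - p) \<bullet> b) * (s * ?d b (?\<gamma> z s) h) + (h \<bullet> b) * \<omega> (?\<gamma> z s) b)"
  define T where "T = (\<lambda>z. integral (cbox 0 1) (f z))"
  have f_der: "((\<lambda>z. f z s) has_derivative fx z s) (at z within ?S)" if z: "z \<in> ?S" and s: "s \<in> cbox 0 1" for z s
  proof -
    have "((\<lambda>z. \<omega> (?\<gamma> z s) b) has_derivative (\<lambda>h. ?d b (?\<gamma> z s) (s *\<^sub>R h))) (at z within ?S)" for b
      by (rule has_derivative_compose[where g = "\<lambda>z. \<omega> z b" and f = "\<lambda>z. ?\<gamma> z s", OF _ smooth_on_has_derivative[OF sm]])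
        (use \<gamma>[OF z, of s] s in \<open>auto intro!: derivative_eq_intros\<close>)
    then have "((\<lambda>z. \<omega> (?\<gamma> z s) b) has_derivative (\<lambda>h. s * ?d b (?\<gamma> z s) h)) (at z within ?S)" for b
      using linear_scale[OF d_lin[OF \<gamma>[OF z]]] s by simp
    then show ?thesis
      unfolding f_def fx_def by (auto intro!: derivative_eq_intros)
  qed
  have fx_bl: "bounded_linear (fx z s)" if "z \<in> ?S" "s \<in> cbox 0 1" for z s
    using f_der[OF that] has_derivative_bounded_linear by blast
  have cont_\<omega>: "continuous_on (?S \<times> cbox 0 1) (\<lambda>x. \<omega> (?\<gamma> (fst x) (snd x)) v)" for v
    by (rule continuous_on_compose2[OF smooth_on_continuous[OF sm]])
      (use \<gamma> in \<open>auto intro!: continuous_intros simp del: mem_ball\<close>)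
  have cont_d: "continuous_on (?S \<times> cbox 0 1) (\<lambda>x. ?d b (?\<gamma> (fst x) (snd x)) v)" for b v
    by (rule continuous_on_compose2[OF smooth_on_continuous[OF smooth_on_frechet[OF sm]]])
      (use \<gamma> in \<open>auto intro!: continuous_intros simp del: mem_ball\<close>)
  have cont_fx: "continuous_on (?S \<times> cbox 0 1) (\<lambda>x. fx (fst x) (snd x) v)" for v
    unfolding fx_def by (intro continuous_intros cont_\<omega> cont_d)
  have cont_f: "continuous_on (?S \<times> cbox 0 1) (\<lambda>x. f (fst x) (snd x))"
    unfolding f_def by (intro continuous_intros cont_\<omega>)
  have slice: "continuous_on (cbox 0 1) (\<lambda>s. h z s)"
    if "continuous_on (?S \<times> cbox 0 1) (\<lambda>x. h (fst x) (snd x))" "z \<in> ?S" for h z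
    using continuous_on_compose2[OF that(1), of "cbox 0 1" "\<lambda>s. (z, s)"] that(2)
    by (auto simp: continuous_on_Pair image_subset_iff)
  have T_der: "(T has_derivative \<omega> z) (at z)" if z: "z \<in> ?S" for z
  proof -
    let ?B = "\<lambda>x s. Blinfun (fx x s)"
    have B: "blinfun_apply (?B x s) = fx x s" if "x \<in> ?S" "s \<in> cbox 0 1" for x s
      by (rule bounded_linear_Blinfun_apply[OF fx_bl[OF that]])
    have cont_B: "continuous_on (?S \<times> cbox 0 1) (\<lambda>(x, s). ?B x s)"
    proof (rule continuous_on_blinfun_componentwise)
      fix i :: 'e
      show "continuous_on (?S \<times> cbox 0 1) (\<lambda>x. blinfun_apply (case x of (x, s) \<Rightarrow> ?B x s) i)"
        using cont_fx[of i] by (rule continuous_on_eq) (auto simp: B simp del: mem_ball)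
    qed
    have T_der0: "(T has_derivative integral (cbox 0 1) (?B z)) (at z within ?S)"
      unfolding T_def
    proof (rule leibniz_rule[OF _ _ cont_B z convex_ball])
      show "((\<lambda>x. f x t) has_derivative blinfun_apply (?B x t)) (at x within ?S)"
        if "x \<in> ?S" "t \<in> cbox 0 1" for x t using f_der[OF that] B[OF that] by simp
      show "f x integrable_on cbox 0 1" if "x \<in> ?S" for x
        by (rule integrable_continuous[OF slice[OF cont_f that]])
    qed
    have "blinfun_apply (integral (cbox 0 1) (?B z)) h = \<omega> z h" for h
    proof -
      have "?B z integrable_on cbox 0 1"
        by (rule integrable_continuous[OF slice[OF _ z]]) (use cont_B in \<open>simp add: case_prod_beta'\<close>)
      then have "blinfun_apply (integral (cbox 0 1) (?B z)) h = integral (cbox 0 1) (\<lambda>s. ?B z s h)"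
        by (rule blinfun_apply_integral)
      also have "\<dots> = integral (cbox 0 1) (\<lambda>s. fx z s h)"
        by (rule integral_cong) (simp add: B[OF z])
      also have "\<dots> = \<omega> z h"
      proof (rule integral_unique)
        \<comment> \<open>Closedness exchanges the direction of differentiation with the argument of
          the form. This makes the integrand the s-derivative of s times the form at p + s (z - p)
          applied to h, so only the endpoint s = 1 contributes.\<close>
        have "((\<lambda>s. fx z s h) has_integral 1 * \<omega> (?\<gamma> z 1) h - 0 * \<omega> (?\<gamma> z 0) h) {0..1}"
        proof (rule fundamental_theorem_of_calculus)
          fix s :: real assume s: "s \<in> {0..1}"
          note g = \<gamma>[OF z s]
          have "((\<lambda>s. \<omega> (?\<gamma> z s) h) has_derivative (\<lambda>k. ?d h (?\<gamma> z s) (k *\<^sub>R (z - p)))) (at s within {0..1})"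
            by (rule has_derivative_compose[where g = "\<lambda>z. \<omega> z h" and f = "\<lambda>s. ?\<gamma> z s", OF _ smooth_on_has_derivative[OF sm g]])
              (auto intro!: derivative_eq_intros)
          then have "((\<lambda>s. \<omega> (?\<gamma> z s) h) has_real_derivative ?d h (?\<gamma> z s) (z - p)) (at s within {0..1})"
            by (simp add: has_field_derivative_def linear_scale[OF d_lin[OF g]] mult_commute_abs)
          then have "((\<lambda>s. s * \<omega> (?\<gamma> z s) h) has_real_derivative
              \<omega> (?\<gamma> z s) h + s * ?d h (?\<gamma> z s) (z - p)) (at s within {0..1})"
            by (auto intro!: derivative_eq_intros)
          moreover have "fx z s h = \<omega> (?\<gamma> z s) h + s * ?d h (?\<gamma> z s) (z - p)"
            using linear_basis_expansion[OF d_lin[OF g], of h "z - p"]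
              linear_basis_expansion[OF lin[OF g], of h]
            by (simp add: fx_def closed[OF g] sum.distrib sum_distrib_left mult_ac)
          ultimately show "((\<lambda>s. s * \<omega> (?\<gamma> z s) h) has_vector_derivative fx z s h) (at s within {0..1})"
            by (simp add: has_real_derivative_iff_has_vector_derivative)
        qed simp
        then show "((\<lambda>s. fx z s h) has_integral \<omega> z h) (cbox 0 1)" by simp
      qed
      finally show ?thesis .
    qed
    then have "blinfun_apply (integral (cbox 0 1) (?B z)) = \<omega> z" by (rule ext)
    with T_der0 show ?thesis by (simp only: at_within_open[OF z open_ball])
  qed
  moreover have "smooth_on ?S T" using smooth_onI[OF open_ball T_der sm] by blast
  moreover have "T p = 0" by (simp add: T_def f_def)
  ultimately show thesis using that by blast
qed

subsection \<open>The smooth inverse function theorem\<close>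

text \<open>Near y0 the operators M y differ little from M y0, which bounds N y uniformly by twice
  the bound for N y0. Continuity follows from N y v - N y0 v = N y (v - M y (N y0 v)).\<close>

lemma inverse_family_continuous:
  fixes M N :: "'e::euclidean_space \<Rightarrow> 'a::euclidean_space \<Rightarrow> 'a"
  assumes V: "open V" and M_lin: "\<And>y. y \<in> V \<Longrightarrow> linear (M y)" and N_lin: "\<And>y. y \<in> V \<Longrightarrow> linear (N y)"
    and NM: "\<And>y w. y \<in> V \<Longrightarrow> N y (M y w) = w" and MN: "\<And>y w. y \<in> V \<Longrightarrow> M y (N y w) = w"
    and cont: "\<And>w. continuous_on V (\<lambda>y. M y w)"
  shows "continuous_on V (\<lambda>y. N y v)"
proof (rule continuous_at_imp_continuous_on, rule ballI)
  fix y0 assume y0: "y0 \<in> V"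
  have bl: "bounded_linear (M y)" "bounded_linear (N y)" if "y \<in> V" for y
    using M_lin[OF that] N_lin[OF that] linear_conv_bounded_linear by auto
  obtain m where m: "m > 0" "\<And>w. norm (N y0 w) \<le> norm w * m"
    using bounded_linear.pos_bounded[OF bl(2)[OF y0]] by blast
  let ?B = "\<lambda>y. Blinfun (M y)"
  have B: "blinfun_apply (?B y) = M y" if "y \<in> V" for y by (rule bounded_linear_Blinfun_apply[OF bl(1)[OF that]])
  have "continuous_on V ?B"
  proof (rule continuous_on_blinfun_componentwise)
    show "continuous_on V (\<lambda>y. blinfun_apply (?B y) i)" for i
      using cont[of i] by (rule continuous_on_eq) (simp add: B)
  qed
  then have "isCont ?B y0" using V y0 continuous_on_eq_continuous_at by blast
  moreover have "1 / (2 * m) > 0" using m by simp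
  ultimately obtain d1 where d1: "d1 > 0" "\<And>y. dist y y0 < d1 \<Longrightarrow> dist (?B y) (?B y0) < 1 / (2 * m)"
    unfolding continuous_at_eps_delta by blast
  obtain d2 where d2: "d2 > 0" "ball y0 d2 \<subseteq> V" using V y0 open_contains_ball by blast
  have bound: "norm (N y w) \<le> 2 * m * norm w" if "dist y y0 < min d1 d2" for y w
  proof -
    have y: "y \<in> V" using that d2 by (auto simp: dist_commute)
    let ?w = "N y w"
    have "norm (M y ?w - M y0 ?w) \<le> norm (?B y - ?B y0) * norm ?w"
      using norm_blinfun[of "?B y - ?B y0" ?w] by (simp add: B y y0 blinfun.diff_left)
    also have "\<dots> \<le> 1 / (2 * m) * norm ?w"
      using d1(2)[of y] that by (intro mult_right_mono) (auto simp: dist_norm)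
    finally have "norm (M y0 ?w) \<le> norm w + 1 / (2 * m) * norm ?w"
      using norm_triangle_sub[of "M y0 ?w" "M y ?w"] by (simp add: norm_minus_commute MN y)
    moreover have "norm ?w \<le> norm (M y0 ?w) * m" using m(2)[of "M y0 ?w"] NM[OF y0] by simp
    ultimately have "norm ?w \<le> (norm w + 1 / (2 * m) * norm ?w) * m"
      using m(1) by (meson mult_right_mono less_imp_le order_trans)
    also have "\<dots> = m * norm w + norm ?w / 2" using m(1) by (simp add: field_simps)
    finally show ?thesis by simp
  qed
  show "isCont (\<lambda>y. N y v) y0"
    unfolding continuous_at_eps_delta
  proof (intro allI impI)
    fix e :: real assume "e > 0"
    have "isCont (\<lambda>y. M y (N y0 v)) y0" using cont V y0 continuous_on_eq_continuous_at by blast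
    moreover have "e / (2 * m) > 0" using \<open>e > 0\<close> m by simp
    ultimately obtain d3 where d3: "d3 > 0"
      "\<And>y. dist y y0 < d3 \<Longrightarrow> dist (M y (N y0 v)) (M y0 (N y0 v)) < e / (2 * m)"
      unfolding continuous_at_eps_delta by blast
    have "dist (N y v) (N y0 v) < e" if "dist y y0 < Min {d1, d2, d3}" for y
    proof -
      have y: "y \<in> V" using that d2 by (auto simp: dist_commute)
      have "N y v - N y0 v = N y (v - M y (N y0 v))"
        by (simp add: linear_diff[OF N_lin[OF y]] NM y)
      then have "norm (N y v - N y0 v) \<le> 2 * m * norm (v - M y (N y0 v))" using bound[of y] that by simp
      also have "\<dots> < 2 * m * (e / (2 * m))"
        using d3(2)[of y] that m by (intro mult_strict_left_mono) (auto simp: dist_norm norm_minus_commute MN y0)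
      finally show ?thesis using m by (simp add: dist_norm)
    qed
    then show "\<exists>d>0. \<forall>y. dist y y0 < d \<longrightarrow> dist (N y v) (N y0 v) < e"
      using d1 d2 d3 by (intro exI[of _ "Min {d1, d2, d3}"]) auto
  qed
qed

text \<open>Inversion differentiates to - N (dM) N. For fixed y, N x v = N y v + N x (v - M x (N y
  v)), and the argument in parentheses vanishes at x = y; so continuity of N already gives this
  derivative, and the induction on k raises the order.\<close>

lemma inverse_family_Ck:
  fixes M N :: "'e::euclidean_space \<Rightarrow> 'a::euclidean_space \<Rightarrow> 'a"
  assumes V: "open V" and M_lin: "\<And>y. y \<in> V \<Longrightarrow> linear (M y)" and N_lin: "\<And>y. y \<in> V \<Longrightarrow> linear (N y)"
    and NM: "\<And>y w. y \<in> V \<Longrightarrow> N y (M y w) = w" and MN: "\<And>y w. y \<in> V \<Longrightarrow> M y (N y w) = w"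
    and "\<And>w. Ck_on k V (\<lambda>y. M y w)"
  shows "Ck_on k V (\<lambda>y. N y v)"
  using assms(6)
proof (induction k arbitrary: v)
  case 0
  then show ?case using inverse_family_continuous[OF V M_lin N_lin NM MN] by simp
next
  case (Suc k)
  have IH: "Ck_on k V (\<lambda>y. N y w)" for w
    by (rule Suc.IH[OF Ck_on_Suc_D[OF Suc.prems]])
  let ?dM = "\<lambda>w y. frechet_derivative (\<lambda>y. M y w) (at y)"
  have c: "continuous_on V (\<lambda>y. N y w)" for w
    using Ck_on_continuous[OF IH] .
  have N_exp: "N y w = (\<Sum>b\<in>Basis. (w \<bullet> b) *\<^sub>R N y b)" if "y \<in> V" for y w
    by (rule linear_basis_expansion[OF N_lin[OF that]])
  let ?f' = "\<lambda>y h. \<Sum>b\<in>Basis. (- (?dM (N y v) y h \<bullet> b)) *\<^sub>R N y b"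
  have der: "((\<lambda>y. N y v) has_derivative ?f' y) (at y)" if y: "y \<in> V" for y
  proof -
    let ?q = "\<lambda>x. v - M x (N y v)"
    have "((\<lambda>x. N y v + (\<Sum>b\<in>Basis. (?q x \<bullet> b) *\<^sub>R N x b)) has_derivative (\<lambda>h. 0 + ?f' y h)) (at y)"
    proof (intro has_derivative_add has_derivative_const has_derivative_sum has_derivative_scaleR_vanishing)
      fix b :: 'a
      show "((\<lambda>x. ?q x \<bullet> b) has_derivative (\<lambda>h. - (?dM (N y v) y h \<bullet> b))) (at y)"
        by (rule derivative_eq_intros Ck_on_Suc_has_derivative[OF Suc.prems y] refl | simp)+
      show "isCont (\<lambda>x. N x b) y" using c V y continuous_on_eq_continuous_at by blast
    qed (simp add: MN y)
    then have "((\<lambda>x. N y v + (\<Sum>b\<in>Basis. (?q x \<bullet> b) *\<^sub>R N x b)) has_derivative ?f' y) (at y)" by simp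
    then show ?thesis
    proof (rule has_derivative_transform_within_open[OF _ V y])
      show "N y v + (\<Sum>b\<in>Basis. (?q x \<bullet> b) *\<^sub>R N x b) = N x v" if "x \<in> V" for x
        using linear_diff[OF N_lin[OF that], of v "M x (N y v)"] by (simp add: N_exp[OF that, symmetric] NM that)
    qed
  qed
  have dM: "Ck_on k V (\<lambda>y. ?dM (N y v) y h)" for h
  proof -
    have "Ck_on k V (\<lambda>y. \<Sum>c\<in>Basis. (N y v \<bullet> c) *\<^sub>R ?dM c y h)"
    proof (intro Ck_on_sum V Ck_on_bilinear[where B = scaleR, OF bounded_bilinear_scaleR])
      show "Ck_on k V (\<lambda>y. N y v \<bullet> c)" if "c \<in> Basis" for c
        using Ck_on_componentwise[OF V, THEN iffD1, rule_format, OF IH that] .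
      show "Ck_on k V (\<lambda>y. ?dM c y h)" for c using Suc.prems[of c] by simp
    qed
    moreover have "(\<Sum>c\<in>Basis. (w \<bullet> c) *\<^sub>R ?dM c y h) = ?dM w y h" if y: "y \<in> V" for y w
    proof -
      have "((\<lambda>x. \<Sum>c\<in>Basis. (w \<bullet> c) *\<^sub>R M x c) has_derivative (\<lambda>h. \<Sum>c\<in>Basis. (w \<bullet> c) *\<^sub>R ?dM c y h)) (at y)"
        by (intro has_derivative_sum bounded_linear.has_derivative[OF bounded_linear_scaleR_right]
            Ck_on_Suc_has_derivative[OF Suc.prems y])
      then have "((\<lambda>x. M x w) has_derivative (\<lambda>h. \<Sum>c\<in>Basis. (w \<bullet> c) *\<^sub>R ?dM c y h)) (at y)"
        by (rule has_derivative_transform_within_open[OF _ V y])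
          (simp add: linear_basis_expansion[OF M_lin, of _ w, symmetric])
      from frechet_derivative_at[OF this, symmetric] show ?thesis by simp
    qed
    ultimately show ?thesis by (rule Ck_on_transform[OF V])
  qed
  show ?case
  proof (rule Ck_on_Suc_I[OF V der])
    fix h
    show "Ck_on k V (\<lambda>y. ?f' y h)"
    proof (intro Ck_on_sum V Ck_on_bilinear[where B = scaleR, OF bounded_bilinear_scaleR] IH)
      fix b :: 'a assume b: "b \<in> Basis"
      have "Ck_on k V (\<lambda>y. ?dM (N y v) y h \<bullet> b)"
        using Ck_on_componentwise[OF V, THEN iffD1, rule_format, OF dM b] .
      from Ck_on_compose_linear[OF linear_uminus V this]
      show "Ck_on k V (\<lambda>y. - (?dM (N y v) y h \<bullet> b))" .
    qed
  qed
qed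

text \<open>The inverse function theorem yields an inverse g that is differentiable once. The order
  then climbs: if g is of class C^k, so is the derivative of f at g y, hence its inverse, which is
  the derivative of g.\<close>

lemma smooth_inverse_function_same_space:
  fixes f :: "'a::euclidean_space \<Rightarrow> 'a"
  assumes U: "open U" "x0 \<in> U" and f: "smooth_on U f" and inj: "inj (frechet_derivative f (at x0))"
  obtains U' V g where "open U'" "x0 \<in> U'" "U' \<subseteq> U" "open V" "homeomorphism U' V f g" "smooth_on V g"
proof -
  let ?D = "\<lambda>x. frechet_derivative f (at x)"
  have f1: "Ck_on (Suc 0) U f" using f unfolding smooth_on_def by blast
  have B: "blinfun_apply (Blinfun (?D x)) = ?D x" if "x \<in> U" for x by (rule Blinfun_frechet[OF f1 that])
  have lin: "linear (?D x)" if "x \<in> U" for x by (rule smooth_on_frechet_linear[OF f that])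
  obtain I where I: "linear I" "\<And>x. I (?D x0 x) = x"
    using linear_injective_isomorphism[OF lin[OF U(2)] inj] by blast
  have "bounded_linear I" using I(1) linear_conv_bounded_linear by blast
  then have invB: "Blinfun I o\<^sub>L Blinfun (?D x0) = id_blinfun"
    by (intro blinfun_eqI) (simp add: bounded_linear_Blinfun_apply B[OF U(2)] I(2))
  have derB: "(f has_derivative blinfun_apply (Blinfun (?D x))) (at x)" if "x \<in> U" for x
    using smooth_on_has_derivative[OF f that] B[OF that] by simp
  have "\<exists>U' V g g'. open U' \<and> U' \<subseteq> U \<and> x0 \<in> U' \<and> open V \<and> homeomorphism U' V f g \<and>
      (\<forall>y\<in>V. (g has_derivative g' y) (at y) \<and> g' y = inv (blinfun_apply (Blinfun (?D (g y)))) \<and>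
        bij (blinfun_apply (Blinfun (?D (g y)))))"
    by (rule inverse_function_theorem[OF U(1) derB continuous_on_Blinfun_frechet[OF f1] U(2) invB]) blast+
  then obtain U' V g g' where UV: "open U'" "U' \<subseteq> U" "x0 \<in> U'" "open V" "homeomorphism U' V f g"
    and g: "\<And>y. y \<in> V \<Longrightarrow> (g has_derivative (g' y)) (at y)"
      "\<And>y. y \<in> V \<Longrightarrow> g' y = inv (blinfun_apply (Blinfun (?D (g y))))"
      "\<And>y. y \<in> V \<Longrightarrow> bij (blinfun_apply (Blinfun (?D (g y))))"
    by blast
  have gU: "g y \<in> U" if "y \<in> V" for y
    using UV that homeomorphism_image2 by blast
  have g': "g' y = inv (?D (g y))" "bij (?D (g y))" if "y \<in> V" for y
    using g(2,3)[OF that] B[OF gU[OF that]] by auto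
  have "Ck_on k V g" for k
  proof (induction k)
    case 0
    then show ?case using UV(5) homeomorphism_cont2 by auto
  next
    case (Suc k)
    show ?case
    proof (rule Ck_on_Suc_I[OF UV(4) g(1)])
      fix v
      show "Ck_on k V (\<lambda>y. g' y v)"
      proof (rule inverse_family_Ck[OF UV(4), where M = "\<lambda>y. ?D (g y)"])
        show "linear (g' y)" if "y \<in> V" for y using g(1)[OF that] has_derivative_linear by blast
        show "g' y (?D (g y) w) = w" "?D (g y) (g' y w) = w" if "y \<in> V" for y w
          using g'[OF that] by (simp_all add: bij_is_inj bij_is_surj surj_f_inv_f)
        show "Ck_on k V (\<lambda>y. ?D (g y) w)" for w
          using smooth_on_frechet[OF f] gU
          by (intro Ck_on_compose[OF UV(4) U(1) _ Suc.IH]) (auto simp: smooth_on_def)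
      qed (use lin gU in auto)
    qed
  qed
  then have "smooth_on V g" by (simp add: smooth_on_def)
  then show thesis using UV that by blast
qed

text \<open>A linear isomorphism between the model spaces reduces this to the case of one space. It
  is needed because product coordinates and the atlas are modelled on different types of equal
  dimension.\<close>

lemma smooth_inverse_function:
  fixes f :: "'a::euclidean_space \<Rightarrow> 'b::euclidean_space"
  assumes U: "open U" "x0 \<in> U" and f: "smooth_on U f" and inj: "inj (frechet_derivative f (at x0))"
    and dim: "DIM('a) = DIM('b)"
  obtains U' V g where "open U'" "x0 \<in> U'" "U' \<subseteq> U" "open V" "homeomorphism U' V f g" "smooth_on V g"
proof -
  obtain j :: "'b \<Rightarrow> 'a" and i where ij: "linear j" "linear i" "\<And>x. i (j x) = x" "\<And>x. j (i x) = x"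
    using isomorphisms_UNIV_UNIV[OF dim[symmetric]] by metis
  have bl: "bounded_linear j" "bounded_linear i" using ij linear_conv_bounded_linear by auto
  have cont: "continuous_on S j" "continuous_on S' i" for S S'
    using bl linear_continuous_on by auto
  have "smooth_on U (\<lambda>x. j (f x))" by (rule smooth_on_compose_linear[OF ij(1) U(1) f])
  moreover have "frechet_derivative (\<lambda>x. j (f x)) (at x0) = (\<lambda>h. j (frechet_derivative f (at x0) h))"
    using frechet_derivative_at[OF bounded_linear.has_derivative[OF bl(1) smooth_on_has_derivative[OF f U(2)]]]
    by simp
  moreover have "inj (\<lambda>h. j (frechet_derivative f (at x0) h))"
    using inj ij(3) unfolding inj_def by metis
  ultimately obtain U' V g where UV: "open U'" "x0 \<in> U'" "U' \<subseteq> U" "open V"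
    "homeomorphism U' V (\<lambda>x. j (f x)) g" "smooth_on V g"
    using smooth_inverse_function_same_space[OF U, of "\<lambda>x. j (f x)"] by metis
  have V: "i ` V = j -` V" using ij(3,4) by (auto simp: image_iff) metis
  have o: "open (i ` V)" unfolding V using UV(4) cont(1)[of UNIV] by (rule open_vimage)
  have "homeomorphism U' (i ` V) f (\<lambda>y. g (j y))"
  proof (rule homeomorphismI)
    have "continuous_on U' (\<lambda>x. i (j (f x)))"
      using homeomorphism_cont1[OF UV(5)] by (rule continuous_on_compose2[OF cont(2)[of UNIV]]) auto
    then show "continuous_on U' f" by (simp add: ij)
    show "continuous_on (i ` V) (\<lambda>y. g (j y))"
      by (rule continuous_on_compose2[OF homeomorphism_cont2[OF UV(5)] cont(1)]) (simp add: V)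
    show "f ` U' \<subseteq> i ` V" using homeomorphism_image1[OF UV(5)] by (auto simp: V)
    show "(\<lambda>y. g (j y)) ` i ` V \<subseteq> U'" using homeomorphism_image2[OF UV(5)] by (auto simp: ij)
    show "g (j (f x)) = x" if "x \<in> U'" for x using homeomorphism_apply1[OF UV(5) that] .
    show "f (g (j y)) = y" if "y \<in> i ` V" for y
      using homeomorphism_apply2[OF UV(5), of "j y"] that ij(3) V by (metis vimage_eq)
  qed
  moreover have "smooth_on (i ` V) (\<lambda>y. g (j y))"
    by (rule smooth_on_compose[OF o UV(4,6) smooth_on_linear[OF ij(1)]]) (simp add: V)
  ultimately show thesis using that UV o by blast
qed

subsection \<open>Compatible charts\<close>

lemma is_chart_homeomorphism: "is_chart G \<Longrightarrow> homeomorphism (fst G) (snd G ` fst G) (snd G) (chart_inv G)"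
  and is_chart_open: "is_chart G \<Longrightarrow> open (fst G)" "is_chart G \<Longrightarrow> open (snd G ` fst G)"
  unfolding is_chart_def by auto

lemma chart_inv_chart [simp]: "is_chart G \<Longrightarrow> q \<in> fst G \<Longrightarrow> chart_inv G (snd G q) = q"
  using homeomorphism_apply1[OF is_chart_homeomorphism] .

lemma chart_image_open:
  assumes "is_chart G" "open V" "V \<subseteq> fst G"
  shows "open (snd G ` V)"
proof -
  have "openin (top_of_set (fst G)) V" using assms by (simp add: open_subset)
  then have "openin (top_of_set (snd G ` fst G)) (snd G ` V)"
    using homeomorphism_imp_open_map[OF is_chart_homeomorphism[OF assms(1)]] by blast
  then show ?thesis using is_chart_open(2)[OF assms(1)] openin_open_eq by blast
qed

lemma chart_preimage_open:
  assumes "is_chart G" "open W"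
  shows "open {q \<in> fst G. snd G q \<in> W}"
proof -
  have "continuous_on (fst G) (snd G)"
    using homeomorphism_cont1[OF is_chart_homeomorphism[OF assms(1)]] .
  then have "open (fst G \<inter> snd G -` W)"
    using continuous_open_preimage is_chart_open(1)[OF assms(1)] assms(2) by blast
  then show ?thesis by (simp add: Int_def vimage_def)
qed

text \<open>The model space of a compatible chart may differ from that of the atlas. This allows
  product coordinates \<open>(t, y)\<close> on a manifold modelled on an abstract Euclidean space.\<close>

definition compatible_chart ::
  "('a::topological_space, 'e::euclidean_space) chart set \<Rightarrow> ('a, 'b::euclidean_space) chart \<Rightarrow> bool"
  where
  "compatible_chart A G \<longleftrightarrow> is_chart G \<and> fst G \<subseteq> points A \<and>
    (\<forall>c\<in>A. smooth_on (snd G ` (fst G \<inter> fst c)) (snd c \<circ> chart_inv G) \<and>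
           smooth_on (snd c ` (fst G \<inter> fst c)) (snd G \<circ> chart_inv c))"

text \<open>The tangent vector with components w in the chart G. The value 0 on functions that are
  not smooth near p is the convention of \<open>tangent_space\<close>, so that equality holds on the
  nose.\<close>

definition chart_vec :: "('a::topological_space, 'e::euclidean_space) chart set \<Rightarrow>
    ('a, 'b::euclidean_space) chart \<Rightarrow> 'a \<Rightarrow> 'b \<Rightarrow> 'a tvec" where
  "chart_vec A G p w = (\<lambda>f. if smooth_near A p f
     then frechet_derivative (f \<circ> chart_inv G) (at (snd G p)) w else 0)"

definition chart_comp :: "('a, 'b::euclidean_space) chart \<Rightarrow> 'a tvec \<Rightarrow> 'b" where
  "chart_comp G v = (\<Sum>b\<in>Basis. v (\<lambda>q. snd G q \<bullet> b) *\<^sub>R b)"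

lemma chart_comp_inner [simp]: "b \<in> Basis \<Longrightarrow> chart_comp G v \<bullet> b = v (\<lambda>q. snd G q \<bullet> b)"
  unfolding chart_comp_def by simp

locale manifold =
  fixes A :: "('a::{t2_space, second_countable_topology}, 'e::euclidean_space) chart set"
  assumes mfd: "smooth_manifold A"
begin

lemma atlas_chart: "c \<in> A \<Longrightarrow> is_chart c"
  using mfd unfolding smooth_manifold_def by auto

lemma atlas_compatible:
  assumes c: "c \<in> A" shows "compatible_chart A c"
  unfolding compatible_chart_def
proof (intro conjI ballI)
  have sm: "smooth_on (snd c ` (fst c \<inter> fst d)) (snd d \<circ> chart_inv c)" if "c \<in> A" "d \<in> A" for c d
    using mfd that unfolding smooth_manifold_def by blast
  fix d assume d: "d \<in> A"
  show "smooth_on (snd c ` (fst c \<inter> fst d)) (snd d \<circ> chart_inv c)" using sm c d by blast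
  show "smooth_on (snd d ` (fst c \<inter> fst d)) (snd c \<circ> chart_inv d)"
    using sm[OF d c] by (simp add: Int_commute)
qed (use c atlas_chart in \<open>auto simp: points_def\<close>)

lemma points_open: "open (points A)"
  using atlas_chart is_chart_open(1) unfolding points_def by blast

lemma compatible_is_chart: "compatible_chart A G \<Longrightarrow> is_chart G"
  unfolding compatible_chart_def by simp

text \<open>Transition maps between G and the atlas are smooth both ways, so smoothness in all
  charts of the atlas reduces to smoothness in the one chart G that contains V.\<close>

lemma smooth_fun_on_chart:
  assumes G: "compatible_chart A G" and V: "V \<subseteq> fst G"
  shows "smooth_fun_on A V f \<longleftrightarrow> open V \<and> smooth_on (snd G ` V) (f \<circ> chart_inv G)"
proof
  note ch = compatible_is_chart[OF G]
  assume f: "smooth_fun_on A V f"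
  then have oV: "open V" unfolding smooth_fun_on_def by simp
  have "smooth_on (snd G ` V) (f \<circ> chart_inv G)"
  proof (rule smooth_on_local)
    fix z assume "z \<in> snd G ` V"
    then obtain q where q: "q \<in> V" "z = snd G q" by blast
    have "q \<in> points A" using q V G unfolding compatible_chart_def by auto
    then obtain c where c: "c \<in> A" "q \<in> fst c" unfolding points_def by auto
    note chc = atlas_chart[OF c(1)]
    have oW: "open (V \<inter> fst c)" using oV is_chart_open(1)[OF chc] by auto
    have oT: "open (snd G ` (V \<inter> fst c))" by (rule chart_image_open[OF ch oW]) (use V in auto)
    have oT': "open (snd c ` (fst c \<inter> V))" by (rule chart_image_open[OF chc]) (use oW in \<open>auto simp: Int_commute\<close>)
    have "smooth_on (snd c ` (fst c \<inter> V)) (f \<circ> chart_inv c)" using f c(1) unfolding smooth_fun_on_def by blast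
    moreover have "smooth_on (snd G ` (V \<inter> fst c)) (snd c \<circ> chart_inv G)"
    proof (rule smooth_on_subset)
      show "smooth_on (snd G ` (fst G \<inter> fst c)) (snd c \<circ> chart_inv G)"
        using G c(1) unfolding compatible_chart_def by blast
    qed (use V in auto)
    ultimately have "smooth_on (snd G ` (V \<inter> fst c)) (\<lambda>z. (f \<circ> chart_inv c) ((snd c \<circ> chart_inv G) z))"
      by (rule smooth_on_compose[OF oT oT']) (use V ch in auto)
    then have "smooth_on (snd G ` (V \<inter> fst c)) (f \<circ> chart_inv G)"
      by (rule smooth_on_transform[OF oT]) (use V ch chc in auto)
    then show "\<exists>T. open T \<and> z \<in> T \<and> smooth_on T (f \<circ> chart_inv G)" using oT q c by blast
  qed
  then show "open V \<and> smooth_on (snd G ` V) (f \<circ> chart_inv G)" using oV by simp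
next
  note ch = compatible_is_chart[OF G]
  assume f: "open V \<and> smooth_on (snd G ` V) (f \<circ> chart_inv G)"
  have "smooth_on (snd c ` (fst c \<inter> V)) (f \<circ> chart_inv c)" if c: "c \<in> A" for c
  proof -
    note chc = atlas_chart[OF c(1)]
    have oT: "open (snd c ` (fst c \<inter> V))"
      by (rule chart_image_open[OF chc]) (use f is_chart_open(1)[OF chc] in auto)
    have oT': "open (snd G ` V)" by (rule chart_image_open[OF ch]) (use f V in auto)
    have "smooth_on (snd c ` (fst c \<inter> V)) (snd G \<circ> chart_inv c)"
    proof (rule smooth_on_subset)
      show "smooth_on (snd c ` (fst G \<inter> fst c)) (snd G \<circ> chart_inv c)"
        using G c(1) unfolding compatible_chart_def by blast
    qed (use V in auto)
    then have "smooth_on (snd c ` (fst c \<inter> V)) (\<lambda>z. (f \<circ> chart_inv G) ((snd G \<circ> chart_inv c) z))"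
      by (rule smooth_on_compose[OF oT oT' f[THEN conjunct2]]) (use V chc in auto)
    then show ?thesis
      by (rule smooth_on_transform[OF oT]) (use V ch chc in auto)
  qed
  then show "smooth_fun_on A V f"
    using f V G unfolding smooth_fun_on_def compatible_chart_def by auto
qed

section \<open>Functions smooth on an open set or near a point\<close>

lemma smooth_fun_on_subset: "smooth_fun_on A U f \<Longrightarrow> open V \<Longrightarrow> V \<subseteq> U \<Longrightarrow> smooth_fun_on A V f"
  unfolding smooth_fun_on_def by (blast intro: smooth_on_subset)

lemma chart_inter_open: "c \<in> A \<Longrightarrow> open U \<Longrightarrow> open (snd c ` (fst c \<inter> U))"
  by (intro chart_image_open atlas_chart open_Int is_chart_open(1)) auto

lemma smooth_fun_on_transform:
  assumes "smooth_fun_on A U f" "\<And>q. q \<in> U \<Longrightarrow> f q = g q"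
  shows "smooth_fun_on A U g"
  unfolding smooth_fun_on_def
proof (intro conjI ballI)
  show U: "open U" "U \<subseteq> points A" using assms(1) unfolding smooth_fun_on_def by auto
  fix c assume c: "c \<in> A"
  have "smooth_on (snd c ` (fst c \<inter> U)) (f \<circ> chart_inv c)"
    using assms(1) c unfolding smooth_fun_on_def by auto
  then show "smooth_on (snd c ` (fst c \<inter> U)) (g \<circ> chart_inv c)"
    by (rule smooth_on_transform[OF chart_inter_open[OF c U(1)]]) (use assms(2) atlas_chart[OF c] in auto)
qed

lemma smooth_fun_on_const: "open U \<Longrightarrow> U \<subseteq> points A \<Longrightarrow> smooth_fun_on A U (\<lambda>q. a)"
  unfolding smooth_fun_on_def by (simp add: o_def smooth_on_const)

lemma smooth_fun_on_add:
  assumes "smooth_fun_on A U f" "smooth_fun_on A U g"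
  shows "smooth_fun_on A U (\<lambda>q. f q + g q)"
  using assms chart_inter_open unfolding smooth_fun_on_def o_def by (auto intro: smooth_on_add)

lemma smooth_fun_on_mult:
  assumes "smooth_fun_on A U f" "smooth_fun_on A U g"
  shows "smooth_fun_on A U (\<lambda>q. f q * g q)"
  using assms chart_inter_open unfolding smooth_fun_on_def o_def by (auto intro: smooth_on_mult)

lemma smooth_fun_on_diff:
  assumes "smooth_fun_on A U f" "smooth_fun_on A U g"
  shows "smooth_fun_on A U (\<lambda>q. f q - g q)"
  using assms chart_inter_open unfolding smooth_fun_on_def o_def by (auto intro: smooth_on_diff)

lemma smooth_near_points: "smooth_near A p f \<Longrightarrow> p \<in> points A"
  unfolding smooth_near_def smooth_fun_on_def by auto

lemma smooth_near_within:
  assumes "smooth_near A p f" "open W" "p \<in> W"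
  obtains U where "p \<in> U" "U \<subseteq> W" "smooth_fun_on A U f"
proof -
  obtain U where U: "p \<in> U" "smooth_fun_on A U f" using assms(1) unfolding smooth_near_def by auto
  then have "open (U \<inter> W)" using assms(2) unfolding smooth_fun_on_def by auto
  then have "smooth_fun_on A (U \<inter> W) f" using smooth_fun_on_subset[OF U(2)] by simp
  then show thesis using U assms that[of "U \<inter> W"] by auto
qed

lemma smooth_near_on: "smooth_fun_on A U f \<Longrightarrow> p \<in> U \<Longrightarrow> smooth_near A p f"
  unfolding smooth_near_def by auto

lemma smooth_near_transform:
  assumes "smooth_near A p f" "open W" "p \<in> W" "\<And>q. q \<in> W \<Longrightarrow> f q = g q"
  shows "smooth_near A p g"
proof -
  obtain U where U: "p \<in> U" "U \<subseteq> W" "smooth_fun_on A U f" using smooth_near_within[OF assms(1-3)] .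
  then have "smooth_fun_on A U g" using smooth_fun_on_transform[OF U(3)] assms(4) by blast
  then show ?thesis using U(1) unfolding smooth_near_def by blast
qed

lemma smooth_near2:
  assumes "smooth_near A p f" "smooth_near A p g" "open W" "p \<in> W"
  obtains U where "p \<in> U" "U \<subseteq> W" "smooth_fun_on A U f" "smooth_fun_on A U g"
proof -
  obtain U where U: "p \<in> U" "U \<subseteq> W" "smooth_fun_on A U f" using smooth_near_within assms by blast
  then have "open U" unfolding smooth_fun_on_def by auto
  then obtain U' where U': "p \<in> U'" "U' \<subseteq> U" "smooth_fun_on A U' g"
    using smooth_near_within[OF assms(2)] U by metis
  then have "smooth_fun_on A U' f" using U(3) smooth_fun_on_subset unfolding smooth_fun_on_def by metis
  then show thesis using U U' that by blast
qed

lemma smooth_near_add: "smooth_near A p f \<Longrightarrow> smooth_near A p g \<Longrightarrow> smooth_near A p (\<lambda>q. f q + g q)"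
  by (erule (1) smooth_near2[OF _ _ open_UNIV UNIV_I]) (blast intro: smooth_near_on smooth_fun_on_add)

lemma smooth_near_mult: "smooth_near A p f \<Longrightarrow> smooth_near A p g \<Longrightarrow> smooth_near A p (\<lambda>q. f q * g q)"
  by (erule (1) smooth_near2[OF _ _ open_UNIV UNIV_I]) (blast intro: smooth_near_on smooth_fun_on_mult)

lemma smooth_near_const: "p \<in> points A \<Longrightarrow> smooth_near A p (\<lambda>q. a)"
  using smooth_near_on[OF smooth_fun_on_const[OF points_open]] by simp

lemma smooth_near_sum:
  "finite I \<Longrightarrow> p \<in> points A \<Longrightarrow> (\<And>i. i \<in> I \<Longrightarrow> smooth_near A p (f i)) \<Longrightarrow>
    smooth_near A p (\<lambda>q. \<Sum>i\<in>I. f i q)"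
  by (induction I rule: finite_induct) (auto intro: smooth_near_const smooth_near_add)

lemma smooth_near_chartI:
  assumes G: "compatible_chart A G" and V: "open V" "V \<subseteq> fst G" "p \<in> V"
    and F: "smooth_on (snd G ` V) F" "\<And>q. q \<in> V \<Longrightarrow> f q = F (snd G q)"
  shows "smooth_near A p f"
proof (rule smooth_near_on[OF _ V(3)])
  note ch = compatible_is_chart[OF G]
  have "smooth_on (snd G ` V) (f \<circ> chart_inv G)"
    by (rule smooth_on_transform[OF chart_image_open[OF ch V(1,2)] F(1)]) (use V F ch in auto)
  then show "smooth_fun_on A V f" using V by (simp add: smooth_fun_on_chart[OF G V(2)])
qed

lemma smooth_near_coord:
  assumes "compatible_chart A G" "p \<in> fst G"
  shows "smooth_near A p (\<lambda>q. snd G q \<bullet> b)"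
  using is_chart_open(1)[OF compatible_is_chart[OF assms(1)]] assms(2)
    is_chart_open(2)[OF compatible_is_chart[OF assms(1)]]
  by (intro smooth_near_chartI[OF assms(1), of "fst G" p "\<lambda>x. x \<bullet> b"] smooth_on_inner_left smooth_on_id) auto

subsection \<open>Tangent vectors in coordinates\<close>

lemma tangent_add: "v \<in> tangent_space A p \<Longrightarrow> smooth_near A p f \<Longrightarrow> smooth_near A p g \<Longrightarrow>
    v (\<lambda>q. f q + g q) = v f + v g"
  and tangent_mult: "v \<in> tangent_space A p \<Longrightarrow> smooth_near A p f \<Longrightarrow> smooth_near A p g \<Longrightarrow>
    v (\<lambda>q. f q * g q) = f p * v g + g p * v f"
  and tangent_scale: "v \<in> tangent_space A p \<Longrightarrow> smooth_near A p f \<Longrightarrow> v (\<lambda>q. a * f q) = a * v f"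
  and tangent_not_smooth: "v \<in> tangent_space A p \<Longrightarrow> \<not> smooth_near A p f \<Longrightarrow> v f = 0"
  unfolding tangent_space_def by blast+

text \<open>The indicator i of W is idempotent with i p = 1, so v i = 2 v i and v i = 0. Hence
  multiplying a function by i does not change its derivative, and f i = g i.\<close>

lemma tangent_cong:
  assumes v: "v \<in> tangent_space A p" and W: "open W" "p \<in> W" and eq: "\<And>q. q \<in> W \<Longrightarrow> f q = g q"
  shows "v f = v g"
proof (cases "smooth_near A p f")
  case True
  then have g: "smooth_near A p g" by (rule smooth_near_transform[OF _ W eq])
  let ?i = "\<lambda>q. if q \<in> W then 1 else 0 :: real"
  have i: "smooth_near A p ?i"
    by (rule smooth_near_transform[OF smooth_near_const[OF smooth_near_points[OF True], of 1] W]) simp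
  have "(\<lambda>q. ?i q * ?i q) = ?i" by auto
  then have "v ?i = 0" using tangent_mult[OF v i i] W by simp
  then have "v (\<lambda>q. f q * ?i q) = v f" "v (\<lambda>q. g q * ?i q) = v g"
    using tangent_mult[OF v True i] tangent_mult[OF v g i] W by simp_all
  moreover have "(\<lambda>q. f q * ?i q) = (\<lambda>q. g q * ?i q)" using eq by auto
  ultimately show ?thesis by simp
next
  case False
  then have "\<not> smooth_near A p g" using smooth_near_transform[OF _ W, of g f] eq by auto
  then show ?thesis using False tangent_not_smooth[OF v] by simp
qed

lemma tangent_const: "v \<in> tangent_space A p \<Longrightarrow> v (\<lambda>q. a) = 0"
proof (cases "p \<in> points A")
  case True
  assume v: "v \<in> tangent_space A p"
  have "v (\<lambda>q. 1) = 0"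
    using tangent_mult[OF v smooth_near_const[OF True, of 1] smooth_near_const[OF True, of 1]] by simp
  then show ?thesis using tangent_scale[OF v smooth_near_const[OF True, of 1], of a] by simp
qed (use tangent_not_smooth smooth_near_points in blast)

lemma tangent_sum:
  assumes v: "v \<in> tangent_space A p" and p: "p \<in> points A" and I: "finite I"
    and f: "\<And>i. i \<in> I \<Longrightarrow> smooth_near A p (f i)"
  shows "v (\<lambda>q. \<Sum>i\<in>I. f i q) = (\<Sum>i\<in>I. v (f i))"
  using I f
proof (induction I rule: finite_induct)
  case empty
  then show ?case using tangent_const[OF v] by simp
next
  case (insert i I)
  have "smooth_near A p (\<lambda>q. \<Sum>i\<in>I. f i q)" using insert by (intro smooth_near_sum p) auto
  then show ?case using insert tangent_add[OF v, of "f i"] by simp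
qed

lemma tangent_diff:
  assumes v: "v \<in> tangent_space A p" and f: "smooth_near A p f" and g: "smooth_near A p g"
  shows "v (\<lambda>q. f q - g q) = v f - v g"
proof -
  have g': "smooth_near A p (\<lambda>q. - 1 * g q)"
    by (intro smooth_near_mult smooth_near_const smooth_near_points[OF g] g)
  have "(\<lambda>q. f q - g q) = (\<lambda>q. f q + - 1 * g q)" by auto
  then show ?thesis using tangent_add[OF v f g'] tangent_scale[OF v g, of "- 1"] by simp
qed

lemma tcomb_in:
  assumes "u \<in> tangent_space A p" "v \<in> tangent_space A p"
  shows "tcomb a u b v \<in> tangent_space A p"
  using assms unfolding tangent_space_def tcomb_def by (auto simp: algebra_simps)

lemma tzero_in: "tzero \<in> tangent_space A p"
  unfolding tangent_space_def tzero_def by auto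

lemma chart_near:
  assumes G: "compatible_chart A G" and p: "p \<in> fst G" and f: "smooth_near A p f"
  obtains r where "r > 0" "ball (snd G p) r \<subseteq> snd G ` fst G" "smooth_on (ball (snd G p) r) (f \<circ> chart_inv G)"
proof -
  note ch = compatible_is_chart[OF G]
  obtain U where U: "p \<in> U" "U \<subseteq> fst G" "smooth_fun_on A U f"
    using smooth_near_within[OF f is_chart_open(1)[OF ch] p] .
  then have *: "open U" "smooth_on (snd G ` U) (f \<circ> chart_inv G)" using smooth_fun_on_chart[OF G] by auto
  have "open (snd G ` U)" by (rule chart_image_open[OF ch *(1) U(2)])
  then obtain r where "r > 0" "ball (snd G p) r \<subseteq> snd G ` U" using U(1) open_contains_ball by blast
  then show thesis using that *(2) U(2) smooth_on_subset by (meson image_mono order_trans)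
qed

lemma chart_near_derivative:
  assumes G: "compatible_chart A G" and p: "p \<in> fst G" and f: "smooth_near A p f"
  shows "((f \<circ> chart_inv G) has_derivative (\<lambda>w. chart_vec A G p w f)) (at (snd G p))"
proof -
  obtain r where r: "r > 0" "smooth_on (ball (snd G p) r) (f \<circ> chart_inv G)"
    using chart_near[OF assms] by metis
  then have "((f \<circ> chart_inv G) has_derivative frechet_derivative (f \<circ> chart_inv G) (at (snd G p))) (at (snd G p))"
    by (intro smooth_on_has_derivative) auto
  then show ?thesis using f by (simp add: chart_vec_def)
qed

lemma chart_vec_eqI:
  assumes G: "compatible_chart A G" and p: "p \<in> fst G" and f: "smooth_near A p f"
    and D: "((f \<circ> chart_inv G) has_derivative D) (at (snd G p))"
  shows "chart_vec A G p w f = D w"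
  using has_derivative_unique[OF chart_near_derivative[OF G p f] D] by metis

lemma chart_vec_in:
  assumes G: "compatible_chart A G" and p: "p \<in> fst G"
  shows "chart_vec A G p w \<in> tangent_space A p"
proof -
  note der = chart_near_derivative[OF G p] and eqI = chart_vec_eqI[OF G p]
  have inv: "chart_inv G (snd G p) = p" using compatible_is_chart[OF G] p by simp
  have pA: "p \<in> points A" using G p unfolding compatible_chart_def by auto
  have "chart_vec A G p w (\<lambda>q. f q + g q) = chart_vec A G p w f + chart_vec A G p w g"
    "chart_vec A G p w (\<lambda>q. f q * g q) = f p * chart_vec A G p w g + g p * chart_vec A G p w f"
    if fg: "smooth_near A p f" "smooth_near A p g" for f g
  proof -
    show "chart_vec A G p w (\<lambda>q. f q + g q) = chart_vec A G p w f + chart_vec A G p w g"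
      using has_derivative_add[OF der[OF fg(1)] der[OF fg(2)]]
      by (intro eqI smooth_near_add fg) (simp add: o_def)
    have "((\<lambda>q. f q * g q) \<circ> chart_inv G has_derivative
        (\<lambda>w. f p * chart_vec A G p w g + g p * chart_vec A G p w f)) (at (snd G p))"
      using has_derivative_mult[OF der[OF fg(1)] der[OF fg(2)]] by (simp add: o_def inv mult.commute)
    then show "chart_vec A G p w (\<lambda>q. f q * g q) = f p * chart_vec A G p w g + g p * chart_vec A G p w f"
      by (intro eqI smooth_near_mult fg)
  qed
  moreover have "chart_vec A G p w (\<lambda>q. a * f q) = a * chart_vec A G p w f" if f: "smooth_near A p f" for a f
    using has_derivative_mult_right[OF der[OF f], of a]
    by (intro eqI smooth_near_mult smooth_near_const f pA) (simp add: o_def)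
  ultimately show ?thesis unfolding tangent_space_def by (auto simp: chart_vec_def)
qed

lemma chart_vec_apply:
  assumes G: "compatible_chart A G" and V: "open V" "V \<subseteq> fst G" "p \<in> V"
    and F: "smooth_on (snd G ` V) F" "\<And>q. q \<in> V \<Longrightarrow> f q = F (snd G q)"
  shows "chart_vec A G p w f = frechet_derivative F (at (snd G p)) w"
proof (rule chart_vec_eqI[OF G _ smooth_near_chartI[OF assms]])
  show "p \<in> fst G" using V by auto
  have "(F has_derivative frechet_derivative F (at (snd G p))) (at (snd G p))"
    by (rule smooth_on_has_derivative[OF F(1)]) (use V in auto)
  then show "(f \<circ> chart_inv G has_derivative frechet_derivative F (at (snd G p))) (at (snd G p))"
    by (rule has_derivative_transform_within_open[OF _ chart_image_open[OF compatible_is_chart[OF G] V(1,2)]])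
      (use V F compatible_is_chart[OF G] in auto)
qed

lemma chart_comp_vec [simp]:
  assumes G: "compatible_chart A G" and p: "p \<in> fst G"
  shows "chart_comp G (chart_vec A G p w) = w"
proof (rule euclidean_eqI)
  fix b :: 'b assume b: "b \<in> Basis"
  note ch = compatible_is_chart[OF G]
  have D: "((\<lambda>x. x \<bullet> b) has_derivative (\<lambda>x. x \<bullet> b)) (at z)" for z
    by (simp add: bounded_linear_imp_has_derivative bounded_linear_inner_left)
  have "chart_vec A G p w (\<lambda>q. snd G q \<bullet> b) = frechet_derivative (\<lambda>x. x \<bullet> b) (at (snd G p)) w"
    by (rule chart_vec_apply[OF G is_chart_open(1)[OF ch] order_refl p
          smooth_on_inner_left[OF is_chart_open(2)[OF ch] smooth_on_id] refl])
  then show "chart_comp G (chart_vec A G p w) \<bullet> b = w \<bullet> b"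
    using b frechet_derivative_at[OF D, symmetric] by simp
qed

text \<open>Every derivation is a coordinate vector. Hadamard's expansion writes f as a constant
  plus products of a coordinate difference with a smooth coefficient; in the product rule the
  coordinate differences vanish at p, which leaves the values of v on the coordinates times the
  partial derivatives of f.\<close>

lemma chart_vec_comp [simp]:
  assumes G: "compatible_chart A G" and p: "p \<in> fst G" and v: "v \<in> tangent_space A p"
  shows "chart_vec A G p (chart_comp G v) = v"
proof
  fix f
  note ch = compatible_is_chart[OF G]
  have pA: "p \<in> points A" using G p unfolding compatible_chart_def by auto
  show "chart_vec A G p (chart_comp G v) f = v f"
  proof (cases "smooth_near A p f")
    case True
    obtain r where r: "r > 0" "ball (snd G p) r \<subseteq> snd G ` fst G"
      "smooth_on (ball (snd G p) r) (f \<circ> chart_inv G)"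
      using chart_near[OF G p True] .
    obtain g where g: "\<And>b. smooth_on (ball (snd G p) (r/2)) (g b)"
      and f_eq: "\<And>x. x \<in> ball (snd G p) (r/2) \<Longrightarrow> (f \<circ> chart_inv G) x =
        (f \<circ> chart_inv G) (snd G p) + (\<Sum>b\<in>Basis. ((x - snd G p) \<bullet> b) * g b x)"
      and g_p: "\<And>b. b \<in> Basis \<Longrightarrow> g b (snd G p) = frechet_derivative (f \<circ> chart_inv G) (at (snd G p)) b"
      using hadamard_lemma[OF r(1,3)] by blast
    define W where "W = {q \<in> fst G. snd G q \<in> ball (snd G p) (r/2)}"
    have W: "open W" "W \<subseteq> fst G" "p \<in> W"
      unfolding W_def using p r(1) by (auto intro: chart_preimage_open[OF ch] simp del: mem_ball)
    let ?x = "\<lambda>b q. snd G q \<bullet> b - snd G p \<bullet> b" and ?g = "\<lambda>b q. g b (snd G q)"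
    have xs: "smooth_near A p (\<lambda>q. snd G q \<bullet> b)" for b by (rule smooth_near_coord[OF G p])
    have x0: "smooth_near A p (?x b)" for b
      by (rule smooth_near_chartI[OF G W, of "\<lambda>y. y \<bullet> b - snd G p \<bullet> b"])
        (auto intro!: smooth_on_diff smooth_on_inner_left smooth_on_id smooth_on_const chart_image_open[OF ch] W)
    have gs: "smooth_near A p (?g b)" for b
      by (rule smooth_near_chartI[OF G W, of "g b"])
        (rule smooth_on_subset[OF g], auto simp: W_def)
    have "v (?x b) = v (\<lambda>q. snd G q \<bullet> b)" for b
      using tangent_diff[OF v xs smooth_near_const[OF pA]] tangent_const[OF v] by simp
    then have vxg: "v (\<lambda>q. ?x b q * ?g b q) = g b (snd G p) * v (\<lambda>q. snd G q \<bullet> b)" for b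
      using tangent_mult[OF v x0 gs] by simp
    have "v f = v (\<lambda>q. f p + (\<Sum>b\<in>Basis. ?x b q * ?g b q))"
    proof (rule tangent_cong[OF v W(1,3)])
      fix q assume "q \<in> W"
      then show "f q = f p + (\<Sum>b\<in>Basis. ?x b q * ?g b q)"
        using f_eq[of "snd G q"] ch p by (simp add: W_def inner_diff_left)
    qed
    also have "\<dots> = v (\<lambda>q. \<Sum>b\<in>Basis. ?x b q * ?g b q)"
      using tangent_add[OF v smooth_near_const[OF pA] smooth_near_sum[OF finite_Basis pA smooth_near_mult[OF x0 gs]]]
        tangent_const[OF v] by simp
    also have "\<dots> = (\<Sum>b\<in>Basis. v (\<lambda>q. ?x b q * ?g b q))"
      by (rule tangent_sum[OF v pA finite_Basis smooth_near_mult[OF x0 gs]])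
    also have "\<dots> = (\<Sum>b\<in>Basis. v (\<lambda>q. snd G q \<bullet> b) *\<^sub>R frechet_derivative (f \<circ> chart_inv G) (at (snd G p)) b)"
      by (rule sum.cong) (simp_all add: vxg g_p)
    also have "\<dots> = frechet_derivative (f \<circ> chart_inv G) (at (snd G p)) (chart_comp G v)"
      using linear_basis_expansion[OF smooth_on_frechet_linear[OF r(3)], of "snd G p" "chart_comp G v"] r(1)
      by simp
    finally show ?thesis using True by (simp add: chart_vec_def)
  qed (simp add: chart_vec_def tangent_not_smooth[OF v])
qed

lemma tangent_eqI:
  assumes "compatible_chart A G" "p \<in> fst G" "u \<in> tangent_space A p" "v \<in> tangent_space A p"
    and "\<And>b. b \<in> Basis \<Longrightarrow> u (\<lambda>q. snd G q \<bullet> b) = v (\<lambda>q. snd G q \<bullet> b)"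
  shows "u = v"
proof -
  have "chart_comp G u = chart_comp G v" by (rule euclidean_eqI) (simp only: chart_comp_inner assms(5))
  then have "chart_vec A G p (chart_comp G u) = chart_vec A G p (chart_comp G v)" by (rule arg_cong)
  then show ?thesis unfolding chart_vec_comp[OF assms(1,2,3)] chart_vec_comp[OF assms(1,2,4)] .
qed

lemma tcomb_chart_vec:
  assumes G: "compatible_chart A G" and p: "p \<in> fst G"
  shows "tcomb a (chart_vec A G p u) b (chart_vec A G p w) = chart_vec A G p (a *\<^sub>R u + b *\<^sub>R w)"
proof (rule tangent_eqI[OF G p tcomb_in[OF chart_vec_in[OF G p] chart_vec_in[OF G p]] chart_vec_in[OF G p]])
  fix e :: 'b assume e: "e \<in> Basis"
  have *: "chart_vec A G p w (\<lambda>q. snd G q \<bullet> e) = w \<bullet> e" for w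
    using chart_comp_inner[OF e, of G "chart_vec A G p w"] by (simp add: G p)
  show "tcomb a (chart_vec A G p u) b (chart_vec A G p w) (\<lambda>q. snd G q \<bullet> e) =
      chart_vec A G p (a *\<^sub>R u + b *\<^sub>R w) (\<lambda>q. snd G q \<bullet> e)"
    by (simp add: tcomb_def * inner_add_left)
qed

lemma chart_vec_zero: "compatible_chart A G \<Longrightarrow> p \<in> fst G \<Longrightarrow> chart_vec A G p 0 = tzero"
  using tcomb_chart_vec[of G p 0 0 0 0] by (simp add: tcomb_def tzero_def)

subsection \<open>Vector fields\<close>

lemma vector_field_on_subset: "vector_field_on A U X \<Longrightarrow> open V \<Longrightarrow> V \<subseteq> U \<Longrightarrow> vector_field_on A V X"
  unfolding vector_field_on_def by auto

lemma vector_field_on_in: "vector_field_on A U X \<Longrightarrow> p \<in> U \<Longrightarrow> X p \<in> tangent_space A p"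
  and vector_field_on_smooth: "vector_field_on A U X \<Longrightarrow> W \<subseteq> U \<Longrightarrow> smooth_fun_on A W f \<Longrightarrow> smooth_fun_on A W (\<lambda>p. X p f)"
  and vector_field_on_open: "vector_field_on A U X \<Longrightarrow> open U"
  and vector_field_on_points: "vector_field_on A U X \<Longrightarrow> U \<subseteq> points A"
  unfolding vector_field_on_def by auto

lemma vector_field_near:
  assumes "vector_field_on A U X" "p \<in> U" "smooth_near A p f"
  shows "smooth_near A p (\<lambda>q. X q f)"
proof -
  obtain W where "p \<in> W" "W \<subseteq> U" "smooth_fun_on A W f"
    using smooth_near_within[OF assms(3) vector_field_on_open[OF assms(1)] assms(2)] .
  then show ?thesis using vector_field_on_smooth[OF assms(1)] smooth_near_on by blast
qed

lemma vector_field_on_comp: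
  assumes G: "compatible_chart A G" and X: "vector_field_on A V X" and V: "V \<subseteq> fst G"
  shows "smooth_on (snd G ` V) (\<lambda>z. chart_comp G (X (chart_inv G z)))"
proof -
  note ch = compatible_is_chart[OF G] and oV = vector_field_on_open[OF X]
  note oI = chart_image_open[OF ch oV V]
  show ?thesis
  proof (rule iffD2[OF smooth_on_componentwise[OF oI]], rule ballI)
    fix b :: 'b assume b: "b \<in> Basis"
    have "smooth_on (snd G ` V) ((\<lambda>q. snd G q \<bullet> b) \<circ> chart_inv G)"
      by (rule smooth_on_transform[OF oI smooth_on_inner_left[OF oI smooth_on_id, of b]]) (use V ch in auto)
    then have "smooth_fun_on A V (\<lambda>q. snd G q \<bullet> b)" using oV by (simp add: smooth_fun_on_chart[OF G V])
    from vector_field_on_smooth[OF X order_refl this]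
    show "smooth_on (snd G ` V) (\<lambda>z. chart_comp G (X (chart_inv G z)) \<bullet> b)"
      using b by (simp add: smooth_fun_on_chart[OF G V] o_def)
  qed
qed

lemma vector_field_on_chart_vec:
  assumes G: "compatible_chart A G" and V: "open V" "V \<subseteq> fst G" and w: "smooth_on (snd G ` V) w"
    and X: "\<And>p. p \<in> V \<Longrightarrow> X p = chart_vec A G p (w (snd G p))"
  shows "vector_field_on A V X"
  unfolding vector_field_on_def
proof (intro conjI ballI allI impI)
  note ch = compatible_is_chart[OF G]
  show "open V" by fact
  show "V \<subseteq> points A" using V G unfolding compatible_chart_def by auto
  show "X p \<in> tangent_space A p" if "p \<in> V" for p
    using chart_vec_in[OF G, of p] that V X by auto
  fix W f assume W: "W \<subseteq> V" "smooth_fun_on A W f"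
  then have WG: "W \<subseteq> fst G" using V by auto
  have f: "open W" "smooth_on (snd G ` W) (f \<circ> chart_inv G)" using W smooth_fun_on_chart[OF G WG] by auto
  note oI = chart_image_open[OF ch f(1) WG]
  have "smooth_on (snd G ` W) (\<lambda>z. frechet_derivative (f \<circ> chart_inv G) (at z) (w z))"
    by (rule smooth_on_frechet_apply[OF oI oI f(2) smooth_on_id _ smooth_on_subset[OF w]]) (use W in auto)
  then have "smooth_on (snd G ` W) ((\<lambda>p. X p f) \<circ> chart_inv G)"
  proof (rule smooth_on_transform[OF oI])
    fix z assume "z \<in> snd G ` W"
    then obtain q where q: "q \<in> W" "z = snd G q" by blast
    then have "q \<in> V" "q \<in> fst G" using W WG by auto
    then show "frechet_derivative (f \<circ> chart_inv G) (at z) (w z) = ((\<lambda>p. X p f) \<circ> chart_inv G) z"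
      using q ch by (simp add: X chart_vec_def smooth_near_on[OF W(2)])
  qed
  then show "smooth_fun_on A W (\<lambda>p. X p f)" using f(1) by (simp add: smooth_fun_on_chart[OF G WG])
qed

text \<open>In the product rule for the commutator the mixed terms X f Y g + X g Y f are symmetric
  in X and Y and cancel. The rules for the inner field hold only near p, so they are inserted under
  the outer derivation by locality.\<close>

lemma lie_bracket_vector_field:
  assumes X: "vector_field_on A U X" and Y: "vector_field_on A U Y"
  shows "vector_field_on A U (lie_bracket A X Y)"
  unfolding vector_field_on_def
proof (intro conjI ballI allI impI)
  show oU: "open U" "U \<subseteq> points A" using X unfolding vector_field_on_def by auto
  show "lie_bracket A X Y p \<in> tangent_space A p" if p: "p \<in> U" for p
  proof -
    note Xp = vector_field_on_in[OF X p] and Yp = vector_field_on_in[OF Y p]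
    note nX = vector_field_near[OF X p] and nY = vector_field_near[OF Y p]
    have "lie_bracket A X Y p (\<lambda>q. f q + g q) = lie_bracket A X Y p f + lie_bracket A X Y p g"
      "lie_bracket A X Y p (\<lambda>q. f q * g q) = f p * lie_bracket A X Y p g + g p * lie_bracket A X Y p f"
      if fg: "smooth_near A p f" "smooth_near A p g" for f g
    proof -
      obtain W where W: "p \<in> W" "W \<subseteq> U" "smooth_fun_on A W f" "smooth_fun_on A W g"
        using smooth_near2[OF fg oU(1) p] .
      then have oW: "open W" unfolding smooth_fun_on_def by auto
      have sq: "smooth_near A q f" "smooth_near A q g" if "q \<in> W" for q
        using W that smooth_near_on by blast+
      have ad: "Z q (\<lambda>q. f q + g q) = Z q f + Z q g"
        and mu: "Z q (\<lambda>q. f q * g q) = f q * Z q g + g q * Z q f"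
        if "q \<in> W" "vector_field_on A U Z" for q Z
        using tangent_add tangent_mult sq[OF that(1)] vector_field_on_in[OF that(2), of q] W(2) that(1) by blast+
      have "X p (\<lambda>q. Y q (\<lambda>q. f q + g q)) = X p (\<lambda>q. Y q f + Y q g)"
        "Y p (\<lambda>q. X q (\<lambda>q. f q + g q)) = Y p (\<lambda>q. X q f + X q g)"
        using ad X Y by (auto intro!: tangent_cong[OF Xp oW W(1)] tangent_cong[OF Yp oW W(1)])
      then show "lie_bracket A X Y p (\<lambda>q. f q + g q) = lie_bracket A X Y p f + lie_bracket A X Y p g"
        using tangent_add[OF Xp nY[OF fg(1)] nY[OF fg(2)]] tangent_add[OF Yp nX[OF fg(1)] nX[OF fg(2)]]
        by (simp add: lie_bracket_def fg smooth_near_add)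
      have "X p (\<lambda>q. Y q (\<lambda>q. f q * g q)) = X p (\<lambda>q. f q * Y q g + g q * Y q f)"
        "Y p (\<lambda>q. X q (\<lambda>q. f q * g q)) = Y p (\<lambda>q. f q * X q g + g q * X q f)"
        using mu X Y by (auto intro!: tangent_cong[OF Xp oW W(1)] tangent_cong[OF Yp oW W(1)])
      moreover have "X p (\<lambda>q. f q * Y q g + g q * Y q f) =
          f p * X p (\<lambda>q. Y q g) + Y p g * X p f + (g p * X p (\<lambda>q. Y q f) + Y p f * X p g)"
        by (simp add: tangent_add[OF Xp] tangent_mult[OF Xp] smooth_near_mult fg nY)
      moreover have "Y p (\<lambda>q. f q * X q g + g q * X q f) =
          f p * Y p (\<lambda>q. X q g) + X p g * Y p f + (g p * Y p (\<lambda>q. X q f) + X p f * Y p g)"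
        by (simp add: tangent_add[OF Yp] tangent_mult[OF Yp] smooth_near_mult fg nX)
      ultimately show "lie_bracket A X Y p (\<lambda>q. f q * g q) = f p * lie_bracket A X Y p g + g p * lie_bracket A X Y p f"
        by (simp add: lie_bracket_def fg smooth_near_mult algebra_simps)
    qed
    moreover have "lie_bracket A X Y p (\<lambda>q. a * f q) = a * lie_bracket A X Y p f"
      if f: "smooth_near A p f" for a f
    proof -
      obtain W where W: "p \<in> W" "W \<subseteq> U" "smooth_fun_on A W f"
        using smooth_near_within[OF f oU(1) p] .
      then have oW: "open W" unfolding smooth_fun_on_def by auto
      have sc: "Z q (\<lambda>q. a * f q) = a * Z q f" if "q \<in> W" "vector_field_on A U Z" for q Z
        using tangent_scale[OF vector_field_on_in[OF that(2), of q]] smooth_near_on[OF W(3) that(1)] W(2) that(1) by blast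
      have "X p (\<lambda>q. Y q (\<lambda>q. a * f q)) = X p (\<lambda>q. a * Y q f)"
        "Y p (\<lambda>q. X q (\<lambda>q. a * f q)) = Y p (\<lambda>q. a * X q f)"
        using sc X Y by (auto intro!: tangent_cong[OF Xp oW W(1)] tangent_cong[OF Yp oW W(1)])
      moreover have "smooth_near A p (\<lambda>q. a * f q)"
        using f p oU by (intro smooth_near_mult smooth_near_const) auto
      ultimately show ?thesis
        by (simp add: lie_bracket_def f tangent_scale[OF Xp nY[OF f]] tangent_scale[OF Yp nX[OF f]] right_diff_distrib)
    qed
    ultimately show ?thesis unfolding tangent_space_def by (auto simp: lie_bracket_def)
  qed
  fix W f assume W: "W \<subseteq> U" "smooth_fun_on A W f"
  have "smooth_fun_on A W (\<lambda>p. X p (\<lambda>q. Y q f) - Y p (\<lambda>q. X q f))"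
    by (intro smooth_fun_on_diff vector_field_on_smooth[OF X W(1)] vector_field_on_smooth[OF Y W(1)] W(2))
  then show "smooth_fun_on A W (\<lambda>p. lie_bracket A X Y p f)"
    by (rule smooth_fun_on_transform) (simp add: lie_bracket_def smooth_near_on[OF W(2)])
qed

text \<open>Tangent vectors are determined by the coordinate functions, and a field applied to a
  coordinate is a component; one more derivation then gives the derivative of that
  component.\<close>

lemma lie_bracket_chart:
  assumes G: "compatible_chart A G" and V: "open V" "V \<subseteq> fst G" and p: "p \<in> V"
    and x: "smooth_on (snd G ` V) x" "\<And>q. q \<in> V \<Longrightarrow> X q = chart_vec A G q (x (snd G q))"
    and y: "smooth_on (snd G ` V) y" "\<And>q. q \<in> V \<Longrightarrow> Y q = chart_vec A G q (y (snd G q))"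
  shows "lie_bracket A X Y p = chart_vec A G p
    (frechet_derivative y (at (snd G p)) (x (snd G p)) - frechet_derivative x (at (snd G p)) (y (snd G p)))"
proof -
  note ch = compatible_is_chart[OF G]
  note oI = chart_image_open[OF ch V]
  have pG: "p \<in> fst G" using p V by auto
  have X: "vector_field_on A V X" and Y: "vector_field_on A V Y"
    using vector_field_on_chart_vec[OF G V] x y by blast+
  have one: "Z p (\<lambda>q. Z' q (\<lambda>q. snd G q \<bullet> b)) = frechet_derivative z' (at (snd G p)) (z (snd G p)) \<bullet> b"
    if b: "b \<in> Basis" and "\<And>q. q \<in> V \<Longrightarrow> Z q = chart_vec A G q (z (snd G q))"
      and z': "smooth_on (snd G ` V) z'" "\<And>q. q \<in> V \<Longrightarrow> Z' q = chart_vec A G q (z' (snd G q))"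
    for b Z Z' z z'
  proof -
    have "Z' q (\<lambda>q. snd G q \<bullet> b) = z' (snd G q) \<bullet> b" if "q \<in> V" for q
    proof -
      have "Z' q (\<lambda>q. snd G q \<bullet> b) = chart_comp G (Z' q) \<bullet> b" using b by simp
      then show ?thesis using z'(2)[OF that] G V that by auto
    qed
    then have "Z p (\<lambda>q. Z' q (\<lambda>q. snd G q \<bullet> b)) = frechet_derivative (\<lambda>x. z' x \<bullet> b) (at (snd G p)) (z (snd G p))"
      unfolding that(2)[OF p] by (rule chart_vec_apply[OF G V p smooth_on_inner_left[OF oI z'(1)]])
    moreover have "((\<lambda>x. z' x \<bullet> b) has_derivative (\<lambda>h. frechet_derivative z' (at (snd G p)) h \<bullet> b)) (at (snd G p))"
      by (intro bounded_linear.has_derivative[OF bounded_linear_inner_left] smooth_on_has_derivative[OF z'(1)])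
        (use p in auto)
    ultimately show ?thesis using frechet_derivative_at by metis
  qed
  show ?thesis
  proof (rule tangent_eqI[OF G pG vector_field_on_in[OF lie_bracket_vector_field[OF X Y] p] chart_vec_in[OF G pG]])
    fix b :: 'b assume b: "b \<in> Basis"
    have *: "chart_vec A G p w (\<lambda>q. snd G q \<bullet> b) = w \<bullet> b" for w
      using chart_comp_inner[OF b, of G "chart_vec A G p w"] by (simp add: G pG)
    show "lie_bracket A X Y p (\<lambda>q. snd G q \<bullet> b) = chart_vec A G p
        (frechet_derivative y (at (snd G p)) (x (snd G p)) - frechet_derivative x (at (snd G p)) (y (snd G p)))
        (\<lambda>q. snd G q \<bullet> b)"
      using one[OF b x(2) y] one[OF b y(2) x]
      by (simp add: lie_bracket_def smooth_near_coord[OF G pG] * inner_diff_left)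
  qed
qed

end

text \<open>The chain rule for the coordinate expression E of F. G and H may be modelled on
  unrelated spaces, as the projections of a product require.\<close>

lemma pushforward_chart_vec:
  assumes "manifold A" "manifold B" and G: "compatible_chart A G" and H: "compatible_chart B H"
    and V: "open V" "V \<subseteq> fst G" "p \<in> V" and F: "F ` V \<subseteq> fst H"
    and E: "smooth_on (snd G ` V) E" "\<And>q. q \<in> V \<Longrightarrow> snd H (F q) = E (snd G q)"
  shows "pushforward B F p (chart_vec A G p w) =
    chart_vec B H (F p) (frechet_derivative E (at (snd G p)) w)"
proof
  interpret A: manifold A by fact
  interpret B: manifold B by fact
  note chG = A.compatible_is_chart[OF G] and chH = B.compatible_is_chart[OF H]
  note oI = chart_image_open[OF chG V(1,2)]
  fix f
  show "pushforward B F p (chart_vec A G p w) f = chart_vec B H (F p) (frechet_derivative E (at (snd G p)) w) f"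
  proof (cases "smooth_near B (F p) f")
    case True
    have FpH: "F p \<in> fst H" using F V by auto
    obtain r where r: "r > 0" "ball (snd H (F p)) r \<subseteq> snd H ` fst H"
      "smooth_on (ball (snd H (F p)) r) (f \<circ> chart_inv H)"
      using B.chart_near[OF H FpH True] .
    let ?T = "ball (snd H (F p)) r"
    \<comment> \<open>Shrinks V to the points sent into the ball on which the coordinate expression
      of f is known to be smooth.\<close>
    define V' where "V' = {q \<in> fst G. snd G q \<in> snd G ` V \<inter> E -` ?T}"
    have "open (snd G ` V \<inter> E -` ?T)"
      by (rule continuous_open_preimage[OF smooth_on_continuous[OF E(1)] oI]) simp
    then have oV': "open V'" unfolding V'_def by (rule chart_preimage_open[OF chG])
    have V'V: "V' \<subseteq> V" unfolding V'_def using chG V(2) by (auto) (metis chart_inv_chart subsetD)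
    have V'G: "V' \<subseteq> fst G" "p \<in> V'" unfolding V'_def using V E(2)[of p] r(1) by auto
    have E': "smooth_on (snd G ` V') E" using smooth_on_subset[OF E(1)] V'V by blast
    have EV': "E ` snd G ` V' \<subseteq> ?T" unfolding V'_def by auto
    note oI' = chart_image_open[OF chG oV' V'G(1)]
    have c: "smooth_on (snd G ` V') (\<lambda>x. (f \<circ> chart_inv H) (E x))"
      by (rule smooth_on_compose[OF oI' open_ball r(3) E' EV'])
    have eq: "(f \<circ> F) q = (f \<circ> chart_inv H) (E (snd G q))" if "q \<in> V'" for q
    proof -
      have "q \<in> V" using that V'V by blast
      then have "chart_inv H (E (snd G q)) = F q"
        using chart_inv_chart[OF chH, of "F q"] F E(2)[of q] by auto
      then show ?thesis by simp
    qed
    have Ep: "E (snd G p) = snd H (F p)" using E(2)[OF V(3)] by simp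
    have "chart_vec A G p w (f \<circ> F) = frechet_derivative (\<lambda>x. (f \<circ> chart_inv H) (E x)) (at (snd G p)) w"
      by (rule A.chart_vec_apply[OF G oV' V'G c eq])
    also have "((\<lambda>x. (f \<circ> chart_inv H) (E x)) has_derivative
        (\<lambda>w. frechet_derivative (f \<circ> chart_inv H) (at (E (snd G p))) (frechet_derivative E (at (snd G p)) w))) (at (snd G p))"
      using V(3) Ep r(1)
      by (intro has_derivative_compose[of E _ "snd G p" _ "f \<circ> chart_inv H"] smooth_on_has_derivative[OF E(1)] smooth_on_has_derivative[OF r(3)]) auto
    from frechet_derivative_at[OF this, symmetric]
    have "frechet_derivative (\<lambda>x. (f \<circ> chart_inv H) (E x)) (at (snd G p)) w =
        chart_vec B H (F p) (frechet_derivative E (at (snd G p)) w) f"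
      using True Ep by (simp add: chart_vec_def)
    finally show ?thesis using True by (simp add: pushforward_def)
  qed (simp add: pushforward_def chart_vec_def)
qed

subsection \<open>Open subsets of Euclidean spaces as manifolds\<close>

lemma chart_inv_id [simp]: "z \<in> S \<Longrightarrow> chart_inv (S, id) z = z"
  unfolding chart_inv_def by (simp add: inv_into_def) (metis (mono_tags, lifting) someI_ex)

lemma is_chart_id:
  fixes S :: "'e::euclidean_space set"
  assumes "open S" shows "is_chart (S, id)"
proof -
  have "homeomorphism S S id (chart_inv (S, id))"
    by (rule homeomorphismI) (auto intro: continuous_on_eq[OF continuous_on_id'])
  then show ?thesis using assms unfolding is_chart_def by simp
qed

lemma manifold_id:
  fixes S :: "'e::euclidean_space set"
  assumes "open S" "S \<noteq> {}" shows "manifold {(S, id)}"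
proof -
  have "smooth_on S (id \<circ> chart_inv (S, id))"
    by (rule smooth_on_transform[OF assms(1) smooth_on_id]) simp
  then show ?thesis
    using assms is_chart_id[OF assms(1)] unfolding manifold_def smooth_manifold_def points_def by simp
qed

subsection \<open>Almost coKaehler structures\<close>

locale almost_coKaehler_manifold =
  fixes n :: nat
    and A :: "('a::{t2_space, second_countable_topology}, 'e::euclidean_space) chart set"
    and \<phi> :: "'a \<Rightarrow> 'a tvec \<Rightarrow> 'a tvec"
    and \<xi> :: "'a vfield"
    and \<eta> :: "'a \<Rightarrow> 'a tvec \<Rightarrow> real"
    and g :: "'a \<Rightarrow> 'a tvec \<Rightarrow> 'a tvec \<Rightarrow> real"
  assumes aCK: "almost_coKaehler n A \<phi> \<xi> \<eta> g"

sublocale almost_coKaehler_manifold \<subseteq> manifold A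
  using aCK unfolding almost_coKaehler_def almost_contact_metric_def manifold_def by simp

context almost_coKaehler_manifold
begin

section \<open>The structure equations and their algebraic consequences\<close>

lemma dim_model: "DIM('e) = 2 * n + 1" "n \<ge> 1"
  and metric: "riemannian_metric A g"
  and \<xi>_vf: "vector_field_on A (points A) \<xi>"
  and \<eta>_form: "one_form A \<eta>"
  and \<phi>_endo: "endomorphism_field A \<phi>"
  and \<eta>_\<xi>: "p \<in> points A \<Longrightarrow> \<eta> p (\<xi> p) = 1"
  and \<phi>_\<phi>: "p \<in> points A \<Longrightarrow> v \<in> tangent_space A p \<Longrightarrow> \<phi> p (\<phi> p v) = tcomb (- 1) v (\<eta> p v) (\<xi> p)"
  and g_\<phi>_\<phi>: "p \<in> points A \<Longrightarrow> u \<in> tangent_space A p \<Longrightarrow> v \<in> tangent_space A p \<Longrightarrow>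
    g p (\<phi> p u) (\<phi> p v) = g p u v - \<eta> p u * \<eta> p v"
  and \<eta>_closed: "closed_1 A \<eta>"
  and \<Phi>_closed: "closed_2 A (fundamental_form \<phi> g)"
  using aCK unfolding almost_coKaehler_def almost_contact_metric_def by blast+

lemma \<xi>_in: "p \<in> points A \<Longrightarrow> \<xi> p \<in> tangent_space A p"
  using vector_field_on_in[OF \<xi>_vf] .

lemma \<phi>_in: "p \<in> points A \<Longrightarrow> u \<in> tangent_space A p \<Longrightarrow> \<phi> p u \<in> tangent_space A p"
  and \<phi>_tcomb: "p \<in> points A \<Longrightarrow> u \<in> tangent_space A p \<Longrightarrow> v \<in> tangent_space A p \<Longrightarrow>
    \<phi> p (tcomb a u b v) = tcomb a (\<phi> p u) b (\<phi> p v)"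
  and \<phi>_vf: "vector_field_on A U X \<Longrightarrow> vector_field_on A U (\<lambda>p. \<phi> p (X p))"
  using \<phi>_endo unfolding endomorphism_field_def by blast+

lemma \<eta>_tcomb: "p \<in> points A \<Longrightarrow> u \<in> tangent_space A p \<Longrightarrow> v \<in> tangent_space A p \<Longrightarrow>
    \<eta> p (tcomb a u b v) = a * \<eta> p u + b * \<eta> p v"
  and \<eta>_smooth: "vector_field_on A U X \<Longrightarrow> smooth_fun_on A U (\<lambda>p. \<eta> p (X p))"
  using \<eta>_form unfolding one_form_def by blast+

lemma g_sym: "p \<in> points A \<Longrightarrow> u \<in> tangent_space A p \<Longrightarrow> v \<in> tangent_space A p \<Longrightarrow> g p u v = g p v u"
  and g_pos: "p \<in> points A \<Longrightarrow> u \<in> tangent_space A p \<Longrightarrow> u \<noteq> tzero \<Longrightarrow> g p u u > 0"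
  and g_smooth: "vector_field_on A U X \<Longrightarrow> vector_field_on A U Y \<Longrightarrow> smooth_fun_on A U (\<lambda>p. g p (X p) (Y p))"
  and g_tcomb_left: "p \<in> points A \<Longrightarrow> u \<in> tangent_space A p \<Longrightarrow> v \<in> tangent_space A p \<Longrightarrow>
    w \<in> tangent_space A p \<Longrightarrow> g p (tcomb a u b v) w = a * g p u w + b * g p v w"
  using metric unfolding riemannian_metric_def by blast+

lemma g_tcomb_right: "p \<in> points A \<Longrightarrow> u \<in> tangent_space A p \<Longrightarrow> v \<in> tangent_space A p \<Longrightarrow>
    w \<in> tangent_space A p \<Longrightarrow> g p w (tcomb a u b v) = a * g p w u + b * g p w v"
  using g_sym g_tcomb_left tcomb_in by metis

lemma g_tzero:
  assumes "p \<in> points A" "u \<in> tangent_space A p"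
  shows "g p tzero u = 0" "g p u tzero = 0"
  using g_tcomb_left[OF assms(1,2,2,2), of 0 0] g_tcomb_right[OF assms(1,2,2,2), of 0 0]
  by (simp_all add: tcomb_def tzero_def)

lemma \<eta>_tzero: "p \<in> points A \<Longrightarrow> \<eta> p tzero = 0"
  using \<eta>_tcomb[of p tzero tzero 0 0] tzero_in by (simp add: tcomb_def tzero_def)

lemma \<phi>_tzero: "p \<in> points A \<Longrightarrow> \<phi> p tzero = tzero"
  using \<phi>_tcomb[of p tzero tzero 0 0] tzero_in by (simp add: tcomb_def tzero_def)

lemma \<phi>_\<xi>:
  assumes p: "p \<in> points A" shows "\<phi> p (\<xi> p) = tzero"
proof (rule ccontr)
  let ?w = "\<phi> p (\<xi> p)"
  assume nz: "?w \<noteq> tzero"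
  note xi = \<xi>_in[OF p]
  note w = \<phi>_in[OF p xi]
  have "\<phi> p ?w = tzero" using \<phi>_\<phi>[OF p xi] \<eta>_\<xi>[OF p] by (simp add: tcomb_def tzero_def)
  then have "tcomb (- 1) ?w (\<eta> p ?w) (\<xi> p) = tzero" using \<phi>_\<phi>[OF p w] \<phi>_tzero[OF p] by simp
  then have "- 1 * ?w f + \<eta> p ?w * \<xi> p f = 0" for f
    unfolding tcomb_def tzero_def by (rule fun_cong)
  then have w_eq: "?w = tcomb (\<eta> p ?w) (\<xi> p) 0 (\<xi> p)"
    unfolding tcomb_def by (simp add: fun_eq_iff)
  have "\<phi> p ?w = tcomb (\<eta> p ?w) ?w 0 ?w"
    using \<phi>_tcomb[OF p xi xi, of "\<eta> p ?w" 0] unfolding w_eq[symmetric] .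
  with \<open>\<phi> p ?w = tzero\<close> have "\<eta> p ?w = 0 \<or> ?w = tzero" by (auto simp: tcomb_def tzero_def fun_eq_iff)
  moreover have "?w = tzero" if "\<eta> p ?w = 0"
    by (subst w_eq) (simp add: that tcomb_def tzero_def)
  ultimately show False using nz by blast
qed

text \<open>The third power of \<phi> is computed in two ways, squaring first on v or on \<phi>v;
  the difference is \<eta>(\<phi>v) \<xi>.\<close>

lemma \<eta>_\<phi>:
  assumes p: "p \<in> points A" and v: "v \<in> tangent_space A p" shows "\<eta> p (\<phi> p v) = 0"
proof -
  note xi = \<xi>_in[OF p] and w = \<phi>_in[OF p v]
  have "\<phi> p (\<phi> p (\<phi> p v)) = tcomb (- 1) (\<phi> p v) (\<eta> p v) tzero"
    using \<phi>_tcomb[OF p v xi] \<phi>_\<phi>[OF p v] \<phi>_\<xi>[OF p] by simp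
  then have "tcomb (- 1) (\<phi> p v) (\<eta> p (\<phi> p v)) (\<xi> p) = tcomb (- 1) (\<phi> p v) (\<eta> p v) tzero"
    using \<phi>_\<phi>[OF p w] by simp
  then have "tcomb (\<eta> p (\<phi> p v)) (\<xi> p) 0 (\<xi> p) = tzero" by (auto simp: tcomb_def tzero_def fun_eq_iff)
  then have "\<eta> p (tcomb (\<eta> p (\<phi> p v)) (\<xi> p) 0 (\<xi> p)) = \<eta> p tzero" by (rule arg_cong)
  then show ?thesis unfolding \<eta>_tcomb[OF p xi xi] \<eta>_tzero[OF p] using \<eta>_\<xi>[OF p] by simp
qed

lemma g_\<xi>:
  assumes p: "p \<in> points A" and v: "v \<in> tangent_space A p" shows "g p (\<xi> p) v = \<eta> p v"
  using g_\<phi>_\<phi>[OF p \<xi>_in[OF p] v] \<phi>_\<xi>[OF p] g_tzero[OF p \<phi>_in[OF p v]] \<eta>_\<xi>[OF p] by simp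

lemma g_\<phi>_skew:
  assumes p: "p \<in> points A" and u: "u \<in> tangent_space A p" and v: "v \<in> tangent_space A p"
  shows "g p (\<phi> p u) v = - g p u (\<phi> p v)"
proof -
  have "g p u (\<phi> p v) = g p (\<phi> p u) (\<phi> p (\<phi> p v))"
    using g_\<phi>_\<phi>[OF p u \<phi>_in[OF p v]] \<eta>_\<phi>[OF p v] by simp
  also have "\<dots> = - g p (\<phi> p u) v + \<eta> p v * g p (\<phi> p u) (\<xi> p)"
    using g_tcomb_right[OF p v \<xi>_in[OF p] \<phi>_in[OF p u]] \<phi>_\<phi>[OF p v] by simp
  also have "g p (\<phi> p u) (\<xi> p) = 0"
    using g_sym[OF p \<phi>_in[OF p u] \<xi>_in[OF p]] g_\<xi>[OF p \<phi>_in[OF p u]] \<eta>_\<phi>[OF p u] by simp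
  finally show ?thesis by simp
qed

section \<open>Lie derivatives along the Reeb field\<close>

abbreviation "\<phi>f X \<equiv> (\<lambda>q. \<phi> q (X q))"
abbreviation "L X \<equiv> lie_bracket A \<xi> X"
abbreviation "P X \<equiv> lie_deriv_endo A \<xi> \<phi> X"
abbreviation "T \<equiv> lie_deriv_2 A \<xi> (on_fields g)"

lemma \<xi>_vf_on: "vector_field_on A U X \<Longrightarrow> vector_field_on A U \<xi>"
  by (rule vector_field_on_subset[OF \<xi>_vf vector_field_on_open vector_field_on_points])

lemma L_vf: "vector_field_on A U X \<Longrightarrow> vector_field_on A U (L X)"
  by (intro lie_bracket_vector_field \<xi>_vf_on)

lemma tcomb_vf:
  assumes X: "vector_field_on A U X" and Y: "vector_field_on A U Y"
  shows "vector_field_on A U (\<lambda>p. tcomb a (X p) b (Y p))"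
  unfolding vector_field_on_def
proof (intro conjI ballI allI impI)
  show "open U" "U \<subseteq> points A" using X unfolding vector_field_on_def by auto
  show "tcomb a (X p) b (Y p) \<in> tangent_space A p" if "p \<in> U" for p
    using X Y that by (intro tcomb_in vector_field_on_in)
  fix W f assume W: "W \<subseteq> U" "smooth_fun_on A W f"
  have "open W" "W \<subseteq> points A" using W(2) unfolding smooth_fun_on_def by auto
  then show "smooth_fun_on A W (\<lambda>p. tcomb a (X p) b (Y p) f)"
    unfolding tcomb_def
    by (intro smooth_fun_on_add smooth_fun_on_mult smooth_fun_on_const
        vector_field_on_smooth[OF X W] vector_field_on_smooth[OF Y W])
qed

lemma P_vf: "vector_field_on A U X \<Longrightarrow> vector_field_on A U (P X)"
  unfolding lie_deriv_endo_def by (intro tcomb_vf \<phi>_vf L_vf)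

lemma \<xi>_cong:
  assumes X: "vector_field_on A U X" and p: "p \<in> U" and eq: "\<And>q. q \<in> U \<Longrightarrow> f q = h q"
  shows "\<xi> p f = \<xi> p h"
  using tangent_cong[OF \<xi>_in vector_field_on_open[OF X] p eq] vector_field_on_points[OF X] p by auto

text \<open>The vanishing of the Lie derivative of \<eta>: in d\<eta>(\<xi>, X) = 0 the term
  X(\<eta>(\<xi>)) drops out, since \<eta>(\<xi>) is constant.\<close>

lemma \<xi>_\<eta>:
  assumes X: "vector_field_on A U X" and p: "p \<in> U"
  shows "\<xi> p (\<lambda>q. \<eta> q (X q)) = \<eta> p (L X p)"
proof -
  have "X p (\<lambda>q. \<eta> q (\<xi> q)) = X p (\<lambda>q. 1)"
    using tangent_cong[OF vector_field_on_in[OF X p] vector_field_on_open[OF X] p, of "\<lambda>q. \<eta> q (\<xi> q)" "\<lambda>q. 1"]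
      \<eta>_\<xi> vector_field_on_points[OF X] by auto
  also have "\<dots> = 0" by (rule tangent_const[OF vector_field_on_in[OF X p]])
  finally show ?thesis
    using \<eta>_closed \<xi>_vf_on[OF X] X p unfolding closed_1_def ext_deriv_1_def by fastforce
qed

lemma lie_bracket_swap: "lie_bracket A X Y p = tcomb (- 1) (lie_bracket A Y X p) 0 (lie_bracket A Y X p)"
  unfolding lie_bracket_def tcomb_def by auto

text \<open>The vanishing of the Lie derivative of \<Phi>: of the six terms of d\<Phi>(\<xi>, X, Y)
  those with \<xi> as an argument of \<Phi> are zero. The skewness of \<phi> puts the last one into
  the stated order.\<close>

lemma \<xi>_\<Phi>:
  assumes X: "vector_field_on A U X" and Y: "vector_field_on A U Y" and p: "p \<in> U"
  shows "\<xi> p (\<lambda>q. g q (X q) (\<phi> q (Y q))) = g p (L X p) (\<phi> p (Y p)) + g p (X p) (\<phi> p (L Y p))"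
proof -
  have pA: "q \<in> points A" if "q \<in> U" for q using vector_field_on_points[OF X] that by auto
  note Xp = vector_field_on_in[OF X] and Yp = vector_field_on_in[OF Y] and LY = vector_field_on_in[OF L_vf[OF Y]]
  note oU = vector_field_on_open[OF X]
  have "X p (\<lambda>q. g q (Y q) (\<phi> q (\<xi> q))) = X p (\<lambda>q. 0)"
    by (rule tangent_cong[OF Xp[OF p] oU p]) (simp add: \<phi>_\<xi> g_tzero pA Yp)
  then have 1: "X p (on_fields (fundamental_form \<phi> g) Y \<xi>) = 0"
    using tangent_const[OF Xp[OF p]] by (simp add: on_fields_def fundamental_form_def)
  have "Y p (\<lambda>q. g q (\<xi> q) (\<phi> q (X q))) = Y p (\<lambda>q. 0)"
    by (rule tangent_cong[OF Yp[OF p] oU p]) (simp add: g_\<xi> \<phi>_in \<eta>_\<phi> pA Xp)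
  then have 2: "Y p (on_fields (fundamental_form \<phi> g) \<xi> X) = 0"
    using tangent_const[OF Yp[OF p]] by (simp add: on_fields_def fundamental_form_def)
  have 3: "on_fields (fundamental_form \<phi> g) (lie_bracket A X Y) \<xi> p = 0"
    using vector_field_on_in[OF lie_bracket_vector_field[OF X Y] p]
    by (simp add: on_fields_def fundamental_form_def \<phi>_\<xi> g_tzero pA p)
  have 4: "on_fields (fundamental_form \<phi> g) (lie_bracket A Y \<xi>) X p = g p (X p) (\<phi> p (L Y p))"
    unfolding on_fields_def fundamental_form_def lie_bracket_swap[of Y \<xi>]
    using g_tcomb_left[OF pA[OF p] LY[OF p] LY[OF p] \<phi>_in[OF pA[OF p] Xp[OF p]]]
      g_\<phi>_skew[OF pA[OF p] Xp[OF p] LY[OF p]] g_sym[OF pA[OF p] LY[OF p] \<phi>_in[OF pA[OF p] Xp[OF p]]]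
    by simp
  have "ext_deriv_2 A (fundamental_form \<phi> g) \<xi> X Y p = 0"
    using \<Phi>_closed \<xi>_vf_on[OF X] X Y p unfolding closed_2_def by blast
  then show ?thesis
    unfolding ext_deriv_2_def using 1 2 3 4 by (simp add: on_fields_def fundamental_form_def)
qed

lemma T_\<phi>:
  assumes X: "vector_field_on A U X" and Y: "vector_field_on A U Y" and p: "p \<in> U"
  shows "T X (\<phi>f Y) p = - g p (X p) (P Y p)"
proof -
  have pA: "p \<in> points A" using vector_field_on_points[OF X] p by auto
  have "T X (\<phi>f Y) p = g p (X p) (\<phi> p (L Y p)) - g p (X p) (L (\<phi>f Y) p)"
    unfolding lie_deriv_2_def on_fields_def using \<xi>_\<Phi>[OF X Y p] by simp
  also have "\<dots> = - g p (X p) (P Y p)"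
    unfolding lie_deriv_endo_def
    using g_tcomb_right[OF pA vector_field_on_in[OF L_vf[OF \<phi>_vf[OF Y]] p]
        \<phi>_in[OF pA vector_field_on_in[OF L_vf[OF Y] p]] vector_field_on_in[OF X p]] by simp
  finally show ?thesis .
qed

text \<open>Writing \<open>g(X, Y) = \<Phi>(\<phi> X, Y) + \<eta>(X) \<eta>(Y)\<close> before differentiating makes \<open>T\<close> visibly
  tensorial.\<close>

lemma T_eq:
  assumes X: "vector_field_on A U X" and Y: "vector_field_on A U Y" and p: "p \<in> U"
  shows "T X Y p = g p (P X p) (\<phi> p (Y p))"
proof -
  have pA: "q \<in> points A" if "q \<in> U" for q using vector_field_on_points[OF X] that by auto
  note pA' = pA[OF p]
  note Xp = vector_field_on_in[OF X] and Yp = vector_field_on_in[OF Y]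
    and LX = vector_field_on_in[OF L_vf[OF X] p] and LY = vector_field_on_in[OF L_vf[OF Y] p]
    and L\<phi>X = vector_field_on_in[OF L_vf[OF \<phi>_vf[OF X]] p]
  note xi = \<xi>_in[OF pA']
  have s\<Phi>: "smooth_near A p (\<lambda>q. g q (\<phi> q (X q)) (\<phi> q (Y q)))"
    using smooth_near_on[OF g_smooth[OF \<phi>_vf[OF X] \<phi>_vf[OF Y]] p] .
  have s\<eta>: "smooth_near A p (\<lambda>q. \<eta> q (X q))" "smooth_near A p (\<lambda>q. \<eta> q (Y q))"
    using smooth_near_on[OF \<eta>_smooth[OF X] p] smooth_near_on[OF \<eta>_smooth[OF Y] p] .
  have "\<xi> p (\<lambda>q. g q (X q) (Y q)) = \<xi> p (\<lambda>q. g q (\<phi> q (X q)) (\<phi> q (Y q)) + \<eta> q (X q) * \<eta> q (Y q))"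
    by (rule \<xi>_cong[OF X p]) (simp add: g_\<phi>_\<phi> pA Xp Yp)
  also have "\<dots> = \<xi> p (\<lambda>q. g q (\<phi> q (X q)) (\<phi> q (Y q))) + \<xi> p (\<lambda>q. \<eta> q (X q) * \<eta> q (Y q))"
    by (rule tangent_add[OF xi s\<Phi> smooth_near_mult[OF s\<eta>]])
  also have "\<dots> = g p (L (\<phi>f X) p) (\<phi> p (Y p)) + g p (\<phi> p (X p)) (\<phi> p (L Y p)) +
      (\<eta> p (X p) * \<eta> p (L Y p) + \<eta> p (Y p) * \<eta> p (L X p))"
    using \<xi>_\<Phi>[OF \<phi>_vf[OF X] Y p] tangent_mult[OF xi s\<eta>] \<xi>_\<eta>[OF X p] \<xi>_\<eta>[OF Y p] by simp
  finally have "T X Y p = g p (L (\<phi>f X) p) (\<phi> p (Y p)) - g p (\<phi> p (L X p)) (\<phi> p (Y p))"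
    unfolding lie_deriv_2_def on_fields_def
    using g_\<phi>_\<phi>[OF pA' Xp[OF p] LY] g_\<phi>_\<phi>[OF pA' LX Yp[OF p]] by simp
  also have "\<dots> = g p (P X p) (\<phi> p (Y p))"
    unfolding lie_deriv_endo_def
    using g_tcomb_left[OF pA' L\<phi>X \<phi>_in[OF pA' LX] \<phi>_in[OF pA' Yp[OF p]]] by simp
  finally show ?thesis .
qed

lemma T_sym:
  assumes X: "vector_field_on A U X" and Y: "vector_field_on A U Y" and p: "p \<in> U"
  shows "T X Y p = T Y X p"
proof -
  have pA: "q \<in> points A" if "q \<in> U" for q using vector_field_on_points[OF X] that by auto
  note Xp = vector_field_on_in[OF X] and Yp = vector_field_on_in[OF Y]
    and LX = vector_field_on_in[OF L_vf[OF X] p] and LY = vector_field_on_in[OF L_vf[OF Y] p]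
  have "\<xi> p (\<lambda>q. g q (X q) (Y q)) = \<xi> p (\<lambda>q. g q (Y q) (X q))"
    by (rule \<xi>_cong[OF X p]) (simp add: g_sym[OF pA Xp Yp])
  then show ?thesis
    unfolding lie_deriv_2_def on_fields_def
    using g_sym[OF pA[OF p] Xp[OF p] LY] g_sym[OF pA[OF p] LX Yp[OF p]] by simp
qed

text \<open>Symmetry of T moves P to the second argument. In this form one more differentiation
  leaves Q on the second argument, the same place as in the other formula for the second
  derivative.\<close>

lemma T_eq':
  assumes X: "vector_field_on A U X" and Y: "vector_field_on A U Y" and p: "p \<in> U"
  shows "T X Y p = g p (\<phi> p (X p)) (P Y p)"
  using T_sym[OF X Y p] T_eq[OF Y X p] vector_field_on_points[OF X] p
    g_sym[of p "P Y p" "\<phi> p (X p)"] \<phi>_in vector_field_on_in[OF X p] vector_field_on_in[OF P_vf[OF Y] p]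
  by auto

section \<open>The second Lie derivative of the metric\<close>

abbreviation "T2 \<equiv> lie_deriv_2 A \<xi> T"
abbreviation "Q Y \<equiv> (\<lambda>p. tcomb 1 (L (P Y) p) (- 1) (P (L Y) p))"

text \<open>The Leibniz rule for g(\<phi>X, PY) gives T(\<phi>X, PY) + g(PX, PY) + g(\<phi>X, QY),
  and the first two terms cancel because T(\<phi>X, PY) = - g(PX, PY).\<close>

lemma T2_eq:
  assumes X: "vector_field_on A U X" and Y: "vector_field_on A U Y" and p: "p \<in> U"
  shows "T2 X Y p = g p (\<phi> p (X p)) (Q Y p)"
proof -
  have pA: "p \<in> points A" using vector_field_on_points[OF X] p by auto
  note \<phi>X = \<phi>_vf[OF X] and PY = P_vf[OF Y]
  note \<phi>Xp = vector_field_on_in[OF \<phi>X p] and PYp = vector_field_on_in[OF PY p]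
    and LPY = vector_field_on_in[OF L_vf[OF PY] p] and PLY = vector_field_on_in[OF P_vf[OF L_vf[OF Y]] p]
    and L\<phi>X = vector_field_on_in[OF L_vf[OF \<phi>X] p] and LX = vector_field_on_in[OF L_vf[OF X] p]
  have "\<xi> p (T X Y) = \<xi> p (\<lambda>q. g q (\<phi> q (X q)) (P Y q))"
    by (rule \<xi>_cong[OF X p]) (rule T_eq'[OF X Y])
  then have 1: "T2 X Y p = \<xi> p (\<lambda>q. g q (\<phi> q (X q)) (P Y q))
      - g p (\<phi> p (L X p)) (P Y p) - g p (\<phi> p (X p)) (P (L Y) p)"
    unfolding lie_deriv_2_def[of A \<xi> T] using T_eq'[OF L_vf[OF X] Y p] T_eq'[OF X L_vf[OF Y] p] by simp
  have 2: "\<xi> p (\<lambda>q. g q (\<phi> q (X q)) (P Y q)) =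
      T (\<phi>f X) (P Y) p + g p (L (\<phi>f X) p) (P Y p) + g p (\<phi> p (X p)) (L (P Y) p)"
    by (simp add: lie_deriv_2_def[of A \<xi> "on_fields g"] on_fields_def)
  have 3: "T (\<phi>f X) (P Y) p = - g p (P X p) (P Y p)"
    using T_sym[OF \<phi>X PY p] T_\<phi>[OF PY X p] g_sym[OF pA PYp vector_field_on_in[OF P_vf[OF X] p]] by simp
  have 4: "g p (P X p) (P Y p) = g p (L (\<phi>f X) p) (P Y p) - g p (\<phi> p (L X p)) (P Y p)"
    using g_tcomb_left[OF pA L\<phi>X \<phi>_in[OF pA LX] PYp, of 1 "- 1"]
    by (simp add: lie_deriv_endo_def[of A \<xi> \<phi> X])
  show ?thesis unfolding g_tcomb_right[OF pA LPY PLY \<phi>Xp] using 1 2 3 4 by simp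
qed

text \<open>One of the two terms T(X, PY) arises from differentiating g in - g(X, PY), the other
  from L(\<phi>Y) = \<phi>(LY) + PY in the second slot of T.\<close>

lemma T2_\<phi>:
  assumes X: "vector_field_on A U X" and Y: "vector_field_on A U Y" and p: "p \<in> U"
  shows "T2 X (\<phi>f Y) p = - 2 * T X (P Y) p - g p (X p) (Q Y p)"
proof -
  have pA: "p \<in> points A" using vector_field_on_points[OF X] p by auto
  note \<phi>Y = \<phi>_vf[OF Y] and PY = P_vf[OF Y] and PX = P_vf[OF X] and LY = L_vf[OF Y]
  note Xp = vector_field_on_in[OF X p] and PYp = vector_field_on_in[OF PY p] and PXp = vector_field_on_in[OF PX p]
    and LPY = vector_field_on_in[OF L_vf[OF PY] p] and PLY = vector_field_on_in[OF P_vf[OF LY] p]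
    and L\<phi>Y = vector_field_on_in[OF L_vf[OF \<phi>Y] p] and LYp = vector_field_on_in[OF LY p]
  note \<phi>L = \<phi>_in[OF pA L\<phi>Y] \<phi>_in[OF pA \<phi>_in[OF pA LYp]]
  have "\<xi> p (T X (\<phi>f Y)) = \<xi> p (\<lambda>q. - 1 * g q (X q) (P Y q))"
    by (rule \<xi>_cong[OF X p]) (simp add: T_\<phi>[OF X Y])
  also have "\<dots> = - \<xi> p (\<lambda>q. g q (X q) (P Y q))"
    using tangent_scale[OF \<xi>_in[OF pA] smooth_near_on[OF g_smooth[OF X PY] p], of "- 1"] by simp
  also have "\<dots> = - T X (P Y) p - g p (L X p) (P Y p) - g p (X p) (L (P Y) p)"
    by (simp add: lie_deriv_2_def[of A \<xi> "on_fields g"] on_fields_def)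
  finally have "T2 X (\<phi>f Y) p = - T X (P Y) p - g p (X p) (L (P Y) p) - T X (L (\<phi>f Y)) p"
    unfolding lie_deriv_2_def[of A \<xi> T] using T_\<phi>[OF L_vf[OF X] Y p] by simp
  \<comment> \<open>T is an operator on fields, so its additivity is taken from the pointwise
    formula \<open>T_eq\<close>.\<close>
  moreover have "T X (L (\<phi>f Y)) p - T X (\<phi>f (L Y)) p = T X (P Y) p"
    unfolding T_eq[OF X L_vf[OF \<phi>Y] p] T_eq[OF X \<phi>_vf[OF LY] p] T_eq[OF X PY p]
    using \<phi>_tcomb[OF pA L\<phi>Y \<phi>_in[OF pA LYp], of 1 "- 1"] g_tcomb_right[OF pA \<phi>L PXp, of 1 "- 1"]
    by (simp add: lie_deriv_endo_def[of A \<xi> \<phi> Y])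
  moreover have "T X (\<phi>f (L Y)) p = - g p (X p) (P (L Y) p)" by (rule T_\<phi>[OF X LY p])
  moreover have "g p (X p) (Q Y p) = g p (X p) (L (P Y) p) - g p (X p) (P (L Y) p)"
    using g_tcomb_right[OF pA LPY PLY Xp, of 1 "- 1"] by simp
  ultimately show ?thesis by simp
qed

text \<open>The first formula is taken at (X, X), the second at (\<phi>X, \<phi>X). The factor turns
  them into f g(\<phi>X, PX) and - f g(\<phi>X, PX), while the Q-terms are g(\<phi>X, QX) and its
  negative. Adding both equations leaves - 2 T(\<phi>X, PX) = 0, which is 2 g(PX, PX) = 0;
  positivity of g concludes.\<close>

lemma mixed_killing_P:
  assumes mk: "mixed_killing A g \<xi>" and X: "vector_field_on A U X" and p: "p \<in> U"
  shows "P X p = tzero"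
proof (rule ccontr)
  obtain f where f: "\<And>U X Y p. vector_field_on A U X \<Longrightarrow> vector_field_on A U Y \<Longrightarrow> p \<in> U \<Longrightarrow>
      T2 X Y p = f p * T X Y p"
    using mk unfolding mixed_killing_def by blast
  have pA: "p \<in> points A" using vector_field_on_points[OF X] p by auto
  note \<phi>X = \<phi>_vf[OF X] and PX = P_vf[OF X]
  have "T2 X X p = f p * g p (\<phi> p (X p)) (P X p)" using f[OF X X p] T_eq'[OF X X p] by simp
  moreover have "T2 (\<phi>f X) (\<phi>f X) p = - f p * g p (\<phi> p (X p)) (P X p)"
    using f[OF \<phi>X \<phi>X p] T_\<phi>[OF \<phi>X X p] by simp
  ultimately have "T (\<phi>f X) (P X) p = 0"
    using T2_eq[OF X X p] T2_\<phi>[OF \<phi>X X p] by simp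
  moreover have "T (\<phi>f X) (P X) p = - g p (P X p) (P X p)"
    using T_sym[OF \<phi>X PX p] T_\<phi>[OF PX X p] by simp
  moreover assume "P X p \<noteq> tzero"
  ultimately show False using g_pos[OF pA vector_field_on_in[OF PX p]] by simp
qed

lemma h_vanishes_iff: "h_vanishes A \<phi> \<xi> \<longleftrightarrow> (\<forall>U X. vector_field_on A U X \<longrightarrow> (\<forall>p\<in>U. P X p = tzero))"
  unfolding h_vanishes_def h_tensor_def by (simp add: tzero_def fun_eq_iff)

lemma h_vanishes_T:
  assumes h: "h_vanishes A \<phi> \<xi>" and X: "vector_field_on A U X" and Y: "vector_field_on A U Y" and p: "p \<in> U"
  shows "T X Y p = 0"
proof -
  have "p \<in> points A" using vector_field_on_points[OF X] p by auto
  moreover have "P X p = tzero" using h X p unfolding h_vanishes_iff by blast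
  ultimately show ?thesis
    using T_eq[OF X Y p] g_tzero(1) \<phi>_in vector_field_on_in[OF Y p] by simp
qed

text \<open>In the converse direction the Reeb field is Killing, so both sides of the mixed Killing
  equation are 0 and the constant 1 serves as factor.\<close>

lemma mixed_killing_iff: "mixed_killing A g \<xi> \<longleftrightarrow> h_vanishes A \<phi> \<xi>"
proof
  assume "mixed_killing A g \<xi>"
  then show "h_vanishes A \<phi> \<xi>" unfolding h_vanishes_iff using mixed_killing_P by blast
next
  assume h: "h_vanishes A \<phi> \<xi>"
  have "T2 X Y p = 1 * T X Y p"
    if X: "vector_field_on A U X" and Y: "vector_field_on A U Y" and p: "p \<in> U" for U X Y p
  proof -
    have "\<xi> p (T X Y) = \<xi> p (\<lambda>q. 0)"
      by (rule \<xi>_cong[OF X p]) (rule h_vanishes_T[OF h X Y])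
    also have "\<dots> = 0" using tangent_const[OF \<xi>_in] vector_field_on_points[OF X] p by auto
    finally show ?thesis
      unfolding lie_deriv_2_def[of A \<xi> T]
      using h_vanishes_T[OF h L_vf[OF X] Y p] h_vanishes_T[OF h X L_vf[OF Y] p] h_vanishes_T[OF h X Y p] by simp
  qed
  moreover have "smooth_fun_on A (points A) (\<lambda>p. 1)" using smooth_fun_on_const[OF points_open] by simp
  moreover have "\<exists>p. p \<in> points A" using mfd unfolding smooth_manifold_def by blast
  ultimately show "mixed_killing A g \<xi>"
    unfolding mixed_killing_def using \<xi>_vf by (intro conjI exI[of _ "\<lambda>p. 1"]) auto
qed

end

subsection \<open>Coordinates adapted to the Reeb vector field\<close>

text \<open>The new coordinates are given through their inverse, a parametrisation \<Psi> of part of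
  an old chart, because a flow supplies \<Psi> directly. Coordinate vectors are then transformed by
  the derivative of \<Psi>.\<close>

lemma (in manifold) compatible_chart_compose:
  fixes c :: "('a, 'c::euclidean_space) chart" and \<Psi> :: "'b::euclidean_space \<Rightarrow> 'c"
  assumes c: "compatible_chart A c" and W: "open W" "open (\<Psi> ` W)" "\<Psi> ` W \<subseteq> snd c ` fst c"
    and \<Psi>: "smooth_on W \<Psi>" and h: "smooth_on (\<Psi> ` W) h" "\<forall>z\<in>W. h (\<Psi> z) = z"
  defines "G \<equiv> ({q \<in> fst c. snd c q \<in> \<Psi> ` W}, h \<circ> snd c)"
  shows "compatible_chart A G" "snd G ` fst G = W" "\<And>z. z \<in> W \<Longrightarrow> chart_inv G z = chart_inv c (\<Psi> z)"
    "\<And>q w. q \<in> fst G \<Longrightarrow> chart_vec A G q w = chart_vec A c q (frechet_derivative \<Psi> (at (snd G q)) w)"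
    "\<And>q. q \<in> fst G \<Longrightarrow> \<Psi> (snd G q) = snd c q"
proof -
  note ch = compatible_is_chart[OF c]
  have hom: "homeomorphism (fst c) (snd c ` fst c) (snd c) (chart_inv c)" by (rule is_chart_homeomorphism[OF ch])
  have fG: "fst G = {q \<in> fst c. snd c q \<in> \<Psi> ` W}" and sG: "snd G = h \<circ> snd c" by (simp_all add: G_def)
  show \<Psi>G: "\<Psi> (snd G q) = snd c q" if "q \<in> fst G" for q using that h(2) by (auto simp: fG sG)
  have inW: "chart_inv c (\<Psi> z) \<in> fst G" "snd G (chart_inv c (\<Psi> z)) = z" if "z \<in> W" for z
  proof -
    have "\<Psi> z \<in> snd c ` fst c" using W(3) that by auto
    then have "chart_inv c (\<Psi> z) \<in> fst c" "snd c (chart_inv c (\<Psi> z)) = \<Psi> z" using ch by auto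
    then show "chart_inv c (\<Psi> z) \<in> fst G" "snd G (chart_inv c (\<Psi> z)) = z"
      using that h(2) by (auto simp: fG sG)
  qed
  have GW: "snd G q \<in> W" if "q \<in> fst G" for q using that h(2) by (auto simp: fG sG)
  show img: "snd G ` fst G = W"
  proof
    show "W \<subseteq> snd G ` fst G" using inW by (metis image_eqI subsetI)
  qed (use GW in auto)
  have inj: "inj_on (snd G) (fst G)"
  proof (rule inj_onI)
    fix x y assume xy: "x \<in> fst G" "y \<in> fst G" "snd G x = snd G y"
    then have "snd c x = snd c y" using \<Psi>G by metis
    then show "x = y" using xy chart_inv_chart[OF ch] by (metis (no_types, lifting) fG mem_Collect_eq)
  qed
  show inv: "chart_inv G z = chart_inv c (\<Psi> z)" if "z \<in> W" for z
    unfolding chart_inv_def[of G] using inW[OF that] inj by (metis inv_into_f_f)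
  have cont_sG: "continuous_on (fst G) (snd G)"
    unfolding sG by (rule continuous_on_compose)
      (auto intro: continuous_on_subset[OF homeomorphism_cont1[OF hom]]
        continuous_on_subset[OF smooth_on_continuous[OF h(1)]] simp: fG)
  have cont_inv: "continuous_on W (chart_inv G)"
  proof (rule continuous_on_eq)
    show "continuous_on W (\<lambda>z. chart_inv c (\<Psi> z))"
      by (rule continuous_on_compose2[OF homeomorphism_cont2[OF hom] smooth_on_continuous[OF \<Psi>] W(3)])
  qed (simp add: inv)
  have "open (fst G)" unfolding fG by (rule chart_preimage_open[OF ch W(2)])
  moreover have "homeomorphism (fst G) W (snd G) (chart_inv G)"
    by (rule homeomorphismI[OF cont_sG cont_inv]) (use img inW inv inj GW in \<open>auto simp: chart_inv_def\<close>)
  ultimately have chG: "is_chart G" unfolding is_chart_def using W(1) by (simp add: img)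
  have Gc: "fst G \<subseteq> fst c" by (auto simp: fG)
  show cG: "compatible_chart A G"
    unfolding compatible_chart_def
  proof (intro conjI ballI)
    show "is_chart G" by fact
    show "fst G \<subseteq> points A" using Gc c unfolding compatible_chart_def by auto
    fix d assume d: "d \<in> A"
    note chd = atlas_chart[OF d]
    have o: "open (fst G \<inter> fst d)" "open (fst c \<inter> fst d)"
      using is_chart_open(1)[OF chG] is_chart_open(1)[OF chd] is_chart_open(1)[OF ch] by auto
    have oG: "open (snd G ` (fst G \<inter> fst d))" by (rule chart_image_open[OF chG o(1)]) auto
    have oc: "open (snd c ` (fst c \<inter> fst d))" by (rule chart_image_open[OF ch o(2)]) auto
    have od: "open (snd d ` (fst G \<inter> fst d))" by (rule chart_image_open[OF chd o(1)]) auto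
    have TW: "snd G ` (fst G \<inter> fst d) \<subseteq> W" using GW by auto
    have "smooth_on (snd G ` (fst G \<inter> fst d)) (\<lambda>z. (snd d \<circ> chart_inv c) (\<Psi> z))"
    proof (rule smooth_on_compose[OF oG oc _ smooth_on_subset[OF \<Psi> TW]])
      show "smooth_on (snd c ` (fst c \<inter> fst d)) (snd d \<circ> chart_inv c)"
        using c d unfolding compatible_chart_def by blast
      show "\<Psi> ` snd G ` (fst G \<inter> fst d) \<subseteq> snd c ` (fst c \<inter> fst d)" using \<Psi>G Gc by auto
    qed
    then show "smooth_on (snd G ` (fst G \<inter> fst d)) (snd d \<circ> chart_inv G)"
      by (rule smooth_on_transform[OF oG]) (use TW inv in auto)
    have "smooth_on (snd d ` (fst G \<inter> fst d)) (\<lambda>z. h ((snd c \<circ> chart_inv d) z))"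
    proof (rule smooth_on_compose[OF od W(2) h(1)])
      have "smooth_on (snd d ` (fst c \<inter> fst d)) (snd c \<circ> chart_inv d)"
        using c d unfolding compatible_chart_def by blast
      then show "smooth_on (snd d ` (fst G \<inter> fst d)) (snd c \<circ> chart_inv d)"
        by (rule smooth_on_subset) (use Gc in auto)
      show "(snd c \<circ> chart_inv d) ` snd d ` (fst G \<inter> fst d) \<subseteq> \<Psi> ` W" using chd by (auto simp: fG)
    qed
    then show "smooth_on (snd d ` (fst G \<inter> fst d)) (snd G \<circ> chart_inv d)" by (simp add: sG o_def)
  qed
  show "chart_vec A G q w = chart_vec A c q (frechet_derivative \<Psi> (at (snd G q)) w)" if q: "q \<in> fst G" for q w
  proof
    fix f
    have qc: "q \<in> fst c" using q Gc by auto
    show "chart_vec A G q w f = chart_vec A c q (frechet_derivative \<Psi> (at (snd G q)) w) f"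
    proof (cases "smooth_near A q f")
      case True
      have "((\<lambda>z. (f \<circ> chart_inv c) (\<Psi> z)) has_derivative
          (\<lambda>w. chart_vec A c q (frechet_derivative \<Psi> (at (snd G q)) w) f)) (at (snd G q))"
      proof (rule has_derivative_compose[OF smooth_on_has_derivative[OF \<Psi> GW[OF q]]])
        show "((f \<circ> chart_inv c) has_derivative (\<lambda>w. chart_vec A c q w f)) (at (\<Psi> (snd G q)))"
          using chart_near_derivative[OF c qc True] \<Psi>G[OF q] by simp
      qed
      then have "((f \<circ> chart_inv G) has_derivative
          (\<lambda>w. chart_vec A c q (frechet_derivative \<Psi> (at (snd G q)) w) f)) (at (snd G q))"
        by (rule has_derivative_transform_within_open[OF _ W(1) GW[OF q]]) (simp add: inv)
      then show ?thesis by (rule chart_vec_eqI[OF cG q True])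
    qed (simp add: chart_vec_def)
  qed
qed

lemma open_contains_box:
  fixes U :: "(real \<times> 'f::euclidean_space) set"
  assumes "open U" "(0, 0) \<in> U"
  obtains a r where "a > 0" "r > 0" "{-a<..<a} \<times> ball 0 r \<subseteq> U"
proof -
  obtain X Y where XY: "open X" "open Y" "(0, 0) \<in> X \<times> Y" "X \<times> Y \<subseteq> U"
    using open_prod_elim[OF assms] by metis
  obtain a where a: "a > 0" "ball 0 a \<subseteq> X" using XY open_contains_ball by blast
  obtain r where r: "r > 0" "ball 0 r \<subseteq> Y" using XY open_contains_ball by blast
  have "{-a<..<a} \<subseteq> X" using a(2) by (auto simp: subset_iff dist_real_def)
  then show thesis using that[OF a(1) r(1)] r(2) XY(4) by blast
qed

context almost_coKaehler_manifold
begin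

text \<open>The Reeb field has unit \<open>\<eta>\<close>-component. So a local potential \<open>T\<close> of \<open>\<eta>\<close> measures the time along its
  flow \<open>u\<close>. Starting the flow at time \<open>T\<close> from a hyperplane tangent to \<open>ker \<eta>\<close> gives coordinates
  \<open>(t, y)\<close> in which \<open>\<xi>\<close> is the derivative in \<open>t\<close> and \<open>\<eta> = dt\<close>.\<close>

lemma reeb_chart_exists:
  assumes p0: "p0 \<in> points A" and dim: "DIM('f::euclidean_space) = 2 * n"
  obtains G :: "('a, real \<times> 'f::euclidean_space) chart" and a r where "compatible_chart A G" "p0 \<in> fst G" "a > 0" "r > 0"
    "snd G ` fst G = {-a<..<a} \<times> ball 0 r"
    "\<And>q. q \<in> fst G \<Longrightarrow> \<xi> q = chart_vec A G q (1, 0)"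
    "\<And>q \<tau> w. q \<in> fst G \<Longrightarrow> \<eta> q (chart_vec A G q (\<tau>, w)) = \<tau>"
proof -
  obtain c where cA: "c \<in> A" "p0 \<in> fst c" using p0 unfolding points_def by auto
  note c = atlas_compatible[OF cA(1)] and ch = atlas_chart[OF cA(1)]
  define z0 where "z0 = snd c p0"
  define \<Omega> where "\<Omega> = snd c ` fst c"
  have o: "open (fst c)" "open \<Omega>" unfolding \<Omega>_def using is_chart_open[OF ch] by auto
  have cA': "fst c \<subseteq> points A" using cA unfolding points_def by auto
  have ci: "chart_inv c z \<in> fst c" "snd c (chart_inv c z) = z" if "z \<in> \<Omega>" for z
    using that ch unfolding \<Omega>_def by auto
  have z0: "z0 \<in> \<Omega>" using cA unfolding z0_def \<Omega>_def by auto
  define xi where "xi = (\<lambda>z. chart_comp c (\<xi> (chart_inv c z)))"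
  have \<xi>c: "vector_field_on A (fst c) \<xi>" by (rule vector_field_on_subset[OF \<xi>_vf o(1) cA'])
  have xi: "smooth_on \<Omega> xi" unfolding xi_def \<Omega>_def by (rule vector_field_on_comp[OF c \<xi>c order_refl])
  have \<xi>_xi: "\<xi> q = chart_vec A c q (xi (snd c q))" if "q \<in> fst c" for q
    using chart_vec_comp[OF c that \<xi>_in] that cA' ch by (auto simp: xi_def)
  define \<omega> where "\<omega> = (\<lambda>z v. \<eta> (chart_inv c z) (chart_vec A c (chart_inv c z) v))"
  have \<omega>_lin: "linear (\<omega> z)" if z: "z \<in> \<Omega>" for z
  proof -
    let ?p = "chart_inv c z"
    have pA: "?p \<in> points A" using ci(1)[OF z] cA' by auto
    have *: "\<omega> z (s *\<^sub>R u + t *\<^sub>R v) = s * \<omega> z u + t * \<omega> z v" for s t u v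
      unfolding \<omega>_def tcomb_chart_vec[OF c ci(1)[OF z], symmetric]
      by (rule \<eta>_tcomb[OF pA]) (rule chart_vec_in[OF c ci(1)[OF z]])+
    show ?thesis by (rule linearI) (use *[of 1 _ 1] *[of _ _ 0] in auto)
  qed
  have const_vf: "vector_field_on A (fst c) (\<lambda>q. chart_vec A c q v)" for v
    by (rule vector_field_on_chart_vec[OF c o(1) order_refl smooth_on_const refl])
  have \<omega>_sm: "smooth_on \<Omega> (\<lambda>z. \<omega> z v)" for v
  proof -
    have "smooth_fun_on A (fst c) (\<lambda>q. \<eta> q (chart_vec A c q v))" by (rule \<eta>_smooth[OF const_vf])
    then show ?thesis by (simp add: smooth_fun_on_chart[OF c order_refl] o_def \<omega>_def \<Omega>_def)
  qed
  \<comment> \<open>Fields with constant components commute, so closedness of \<eta> on them is the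
    symmetry of the derivative of its coordinate expression.\<close>
  have \<omega>_closed: "frechet_derivative (\<lambda>z. \<omega> z v) (at z) w = frechet_derivative (\<lambda>z. \<omega> z w) (at z) v"
    if z: "z \<in> \<Omega>" for z v w
  proof -
    let ?p = "chart_inv c z" and ?E = "\<lambda>v q. chart_vec A c q v"
    note p = ci[OF z]
    have app: "?E v ?p (\<lambda>q. \<eta> q (?E w q)) = frechet_derivative (\<lambda>z. \<omega> z w) (at z) v" for v w
      using chart_vec_apply[OF c o(1) order_refl p(1) \<omega>_sm[unfolded \<Omega>_def], of "\<lambda>q. \<eta> q (?E w q)" w v] ch p(2)
      by (simp add: \<omega>_def)
    have "lie_bracket A (?E v) (?E w) ?p = tzero"
      using lie_bracket_chart[OF c o(1) order_refl p(1) smooth_on_const refl smooth_on_const refl, of v w]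
        chart_vec_zero[OF c p(1)] by simp
    then have "\<eta> ?p (lie_bracket A (?E v) (?E w) ?p) = 0" using \<eta>_tzero p(1) cA' by auto
    moreover have "ext_deriv_1 A \<eta> (?E v) (?E w) ?p = 0"
      using \<eta>_closed const_vf p(1) unfolding closed_1_def by blast
    ultimately show ?thesis unfolding ext_deriv_1_def app by simp
  qed
  have \<omega>_xi: "\<omega> z (xi z) = 1" if z: "z \<in> \<Omega>" for z
    using \<xi>_xi[OF ci(1)[OF z]] \<eta>_\<xi>[of "chart_inv c z"] ci[OF z] cA' by (auto simp: \<omega>_def)
  obtain R where R: "R > 0" "ball z0 R \<subseteq> \<Omega>" using o(2) z0 open_contains_ball by blast
  obtain T where T: "smooth_on (ball z0 R) T" "\<And>z. z \<in> ball z0 R \<Longrightarrow> (T has_derivative \<omega> z) (at z)" "T z0 = 0"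
    by (rule poincare_lemma_1_forms[of z0 R \<omega>]) (use R \<omega>_lin \<omega>_closed smooth_on_subset[OF \<omega>_sm] in blast)+
  have z0R: "z0 \<in> ball z0 R" using R by simp
  obtain a1 r1 u where u: "a1 > 0" "r1 > 0" "ball z0 r1 \<subseteq> ball z0 R"
    "smooth_on ({-a1<..<a1} \<times> ball z0 r1) u"
    "\<And>x. x \<in> ball z0 r1 \<Longrightarrow> u (0, x) = x"
    "\<And>t x. t \<in> {-a1<..<a1} \<Longrightarrow> x \<in> ball z0 r1 \<Longrightarrow> u (t, x) \<in> ball z0 R"
    "\<And>t x. t \<in> {-a1<..<a1} \<Longrightarrow> x \<in> ball z0 r1 \<Longrightarrow>
      ((\<lambda>s. u (s, x)) has_vector_derivative xi (u (t, x))) (at t)"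
    by (rule smooth_flow_exists[OF open_ball smooth_on_subset[OF xi R(2)] z0R]) blast
  let ?Du = "\<lambda>z. frechet_derivative u (at z)"
  have op1: "open ({-a1<..<a1} \<times> ball z0 r1)" by (intro open_Times) auto
  have Du_t: "?Du (t, x) (1, 0) = xi (u (t, x))" if tx: "t \<in> {-a1<..<a1}" "x \<in> ball z0 r1" for t x
  proof -
    have "((\<lambda>s. u (s, x)) has_derivative (\<lambda>h. ?Du (t, x) (h, 0))) (at t)"
      by (rule has_derivative_compose[OF _ smooth_on_has_derivative[OF u(4)]])
        (use tx in \<open>auto intro!: derivative_eq_intros\<close>)
    from has_derivative_unique[OF this u(7)[OF tx, unfolded has_vector_derivative_def]]
    show ?thesis by (metis scaleR_one)
  qed
  \<comment> \<open>Along a flow line the derivative of the potential is \<omega>(xi) = 1.\<close>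
  have T_u: "T (u (t, x)) = t + T x" if t: "t \<in> {-a1<..<a1}" and x: "x \<in> ball z0 r1" for t x
  proof -
    have "((\<lambda>s. T (u (s, x)) - s) has_vector_derivative 0) (at s within {-a1<..<a1})" if s: "s \<in> {-a1<..<a1}" for s
    proof -
      note us = u(6)[OF s x]
      have "((\<lambda>s. T (u (s, x))) has_derivative (\<lambda>h. \<omega> (u (s, x)) (h *\<^sub>R xi (u (s, x))))) (at s)"
        by (rule has_derivative_compose[OF u(7)[OF s x, unfolded has_vector_derivative_def] T(2)[OF us]])
      moreover have "\<omega> (u (s, x)) (h *\<^sub>R xi (u (s, x))) = h" for h
        using linear_scale[OF \<omega>_lin, of "u (s, x)"] \<omega>_xi[of "u (s, x)"] us R by auto
      ultimately have "((\<lambda>s. T (u (s, x)) - s) has_derivative (\<lambda>h. h - h)) (at s)"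
        by (intro has_derivative_diff) auto
      then show ?thesis by (simp add: has_vector_derivative_def has_derivative_at_withinI)
    qed
    then show ?thesis
    proof (rule has_vector_derivative_zero_constant[OF convex_real_interval(8)])
      fix k assume k: "\<And>s. s \<in> {-a1<..<a1} \<Longrightarrow> T (u (s, x)) - s = k"
      show ?thesis using k[OF t] k[of 0] u(1) u(5)[OF x] by simp
    qed
  qed
  define K where "K = {v. \<omega> z0 v = 0}"
  note lin0 = \<omega>_lin[OF z0]
  obtain l :: "'f \<Rightarrow> 'e" where l: "linear l" "l ` UNIV = K" "\<And>x. norm (l x) = norm x"
  proof -
    \<comment> \<open>The vector representing the linear form at z0, nonzero since the form takes
      the value 1 on xi. Its orthogonal complement K has dimension 2n, whence an isometry from
      'f.\<close>
    define v where "v = (\<Sum>b\<in>Basis. \<omega> z0 b *\<^sub>R b)"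
    have v: "\<omega> z0 w = v \<bullet> w" for w
      unfolding v_def linear_basis_expansion[OF lin0, of w]
      by (simp add: inner_sum_left) (simp add: inner_commute mult.commute)
    then have "v \<noteq> 0" using \<omega>_xi[OF z0] by auto
    then have "dim K = DIM('e) - 1" unfolding K_def v by (rule dim_hyperplane)
    then have "dim (UNIV :: 'f set) = dim K" using dim dim_model by simp
    moreover have "subspace K" unfolding K_def v by (rule subspace_hyperplane)
    ultimately obtain f where "linear f" "f ` (UNIV :: 'f set) = K" "\<And>x. x \<in> UNIV \<Longrightarrow> norm (f x) = norm x"
      using isometry_subspaces[OF subspace_UNIV] by blast
    then show thesis using that by simp
  qed
  have lK: "\<omega> z0 (l w) = 0" for w using l(2) unfolding K_def by auto
  have l0: "l 0 = 0" by (rule linear_0[OF l(1)])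
  have l_bl: "bounded_linear l" using l(1) linear_conv_bounded_linear by blast
  have lr: "z0 + l y \<in> ball z0 r1" if "y \<in> ball 0 r1" for y using that l(3)[of y] by (simp add: dist_norm)
  \<comment> \<open>The affine hyperplane through z0 is tangent to the zero level of the potential
    at z0 but need not lie in it. Subtracting the potential at the starting point from the flow time
    makes the potential equal to the first coordinate on the whole neighbourhood.\<close>
  let ?b = "\<lambda>z. T (z0 + l (snd z))"
  define m where "m = (\<lambda>z :: real \<times> 'f. (fst z - ?b z, z0 + l (snd z)))"
  define \<Psi> where "\<Psi> = (\<lambda>z. u (m z))"
  have op0: "open ((UNIV :: real set) \<times> ball (0::'f) r1)" by (intro open_Times) auto
  have m_sm: "smooth_on (UNIV \<times> ball 0 r1) m"
  proof -
    have 1: "smooth_on (UNIV \<times> ball 0 r1) (\<lambda>z :: real \<times> 'f. z0 + l (snd z))"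
      by (intro smooth_on_add smooth_on_const op0 smooth_on_linear) (simp add: linear_iff linear_add[OF l(1)] linear_scale[OF l(1)])
    have 2: "smooth_on ((UNIV :: real set) \<times> ball 0 r1) ?b"
      by (rule smooth_on_compose[OF op0 open_ball T(1) 1]) (use lr u(3) in auto)
    show ?thesis unfolding m_def
      by (intro smooth_on_Pair smooth_on_diff op0 1 2 smooth_on_linear linear_fst_snd)
  qed
  \<comment> \<open>The coordinates for which the corrected time and the starting point are in the
    domain of the flow.\<close>
  define N where "N = (UNIV \<times> ball 0 r1) \<inter> m -` ({-a1<..<a1} \<times> ball z0 r1)"
  have oN: "open N" unfolding N_def
    by (rule continuous_open_preimage[OF smooth_on_continuous[OF m_sm] op0 op1])
  have mN: "m z \<in> {-a1<..<a1} \<times> ball z0 r1" "snd z \<in> ball 0 r1" if "z \<in> N" for z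
    using that unfolding N_def by auto
  have m_smN: "smooth_on N m" by (rule smooth_on_subset[OF m_sm]) (auto simp: N_def)
  have \<Psi>_sm: "smooth_on N \<Psi>" unfolding \<Psi>_def
    by (rule smooth_on_compose[OF oN op1 u(4) m_smN]) (use mN(1) in blast)
  have \<Psi>_R: "\<Psi> z \<in> ball z0 R" if "z \<in> N" for z
    using mN(1)[OF that] u(6)[of "fst (m z)" "snd (m z)"] unfolding \<Psi>_def by (auto simp: mem_Times_iff simp del: mem_ball)
  have T_\<Psi>: "T (\<Psi> z) = fst z" if "z \<in> N" for z
    using mN(1)[OF that] T_u[of "fst (m z)" "snd (m z)"] unfolding \<Psi>_def
    by (auto simp: mem_Times_iff m_def simp del: mem_ball)
  let ?D\<Psi> = "\<lambda>z. frechet_derivative \<Psi> (at z)"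
  have m_der: "(m has_derivative (\<lambda>h. (fst h - \<omega> (z0 + l (snd z)) (l (snd h)), l (snd h)))) (at z)"
    if z: "z \<in> N" for z
  proof -
    have 0: "((\<lambda>z. l (snd z)) has_derivative (\<lambda>h. l (snd h))) (at z)"
      by (rule bounded_linear.has_derivative[OF l_bl has_derivative_snd]) (rule has_derivative_ident)
    then have 1: "((\<lambda>z. z0 + l (snd z)) has_derivative (\<lambda>h. l (snd h))) (at z)"
      by (auto intro!: derivative_eq_intros)
    have "z0 + l (snd z) \<in> ball z0 R" using lr[OF mN(2)[OF z]] u(3) by blast
    from has_derivative_compose[OF 1 T(2)[OF this]]
    have "(?b has_derivative (\<lambda>h. \<omega> (z0 + l (snd z)) (l (snd h)))) (at z)" .
    then show ?thesis unfolding m_def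
      by (intro has_derivative_Pair has_derivative_diff has_derivative_fst has_derivative_ident 1)
  qed
  have D\<Psi>: "?D\<Psi> z h = ?Du (m z) (fst h - \<omega> (z0 + l (snd z)) (l (snd h)), l (snd h))" if z: "z \<in> N" for z h
  proof -
    have "(\<Psi> has_derivative (\<lambda>h. ?Du (m z) (fst h - \<omega> (z0 + l (snd z)) (l (snd h)), l (snd h)))) (at z)"
      unfolding \<Psi>_def
      by (rule has_derivative_compose[OF m_der[OF z] smooth_on_has_derivative[OF u(4) mN(1)[OF z]]])
    from frechet_derivative_at[OF this, symmetric] show ?thesis by simp
  qed
  have D\<Psi>_t: "?D\<Psi> z (1, 0) = xi (\<Psi> z)" if z: "z \<in> N" for z
  proof -
    have "\<omega> (z0 + l (snd z)) 0 = 0"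
      by (rule linear_0[OF \<omega>_lin]) (use lr[OF mN(2)[OF z]] u(3) R(2) in blast)
    then have "?D\<Psi> z (1, 0) = ?Du (m z) (1, 0)" by (simp add: D\<Psi>[OF z] l0)
    also have "\<dots> = xi (\<Psi> z)"
      using Du_t[of "fst (m z)" "snd (m z)"] mN(1)[OF z] by (simp add: \<Psi>_def mem_Times_iff del: mem_ball)
    finally show ?thesis .
  qed
  \<comment> \<open>Differentiating \<open>T (\<Psi> z) = fst z\<close> gives \<eta> = dt in the new
    coordinates.\<close>
  have D\<Psi>_T: "\<omega> (\<Psi> z) (?D\<Psi> z h) = fst h" if z: "z \<in> N" for z h
  proof -
    have "((\<lambda>z. T (\<Psi> z)) has_derivative (\<lambda>h. \<omega> (\<Psi> z) (?D\<Psi> z h))) (at z)"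
      by (rule has_derivative_compose[OF smooth_on_has_derivative[OF \<Psi>_sm z] T(2)[OF \<Psi>_R[OF z]]])
    then have "(fst has_derivative (\<lambda>h. \<omega> (\<Psi> z) (?D\<Psi> z h))) (at z)"
      by (rule has_derivative_transform_within_open[OF _ oN z]) (rule T_\<Psi>)
    moreover have "(fst has_derivative fst) (at z)"
      by (rule bounded_linear_imp_has_derivative[OF bounded_linear_fst])
    ultimately show ?thesis using has_derivative_unique by metis
  qed
  have m0: "m (0, 0) = (0, z0)" by (simp add: m_def l0 T(3))
  have N0: "(0, 0) \<in> N" using u(1,2) m0 by (simp add: N_def)
  have \<Psi>0: "\<Psi> (0, 0) = z0" using m0 u(2,5) by (simp add: \<Psi>_def)
  \<comment> \<open>The form \<omega> reads off the t-component of a vector in the kernel; what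
    remains is the isometry \<open>l\<close>, since the flow at time 0 is the identity.\<close>
  have "inj (?D\<Psi> (0, 0))"
  proof -
    have lin: "linear (?D\<Psi> (0, 0))" by (rule smooth_on_frechet_linear[OF \<Psi>_sm N0])
    have Du0: "?Du (0, z0) (0, v) = v" for v
    proof -
      have z0r: "z0 \<in> ball z0 r1" using u(2) by simp
      have "((\<lambda>x. u (0, x)) has_derivative (\<lambda>h. ?Du (0, z0) (0, h))) (at z0)"
        by (rule has_derivative_compose[OF _ smooth_on_has_derivative[OF u(4)]])
          (use u(1,2) in \<open>auto intro!: derivative_eq_intros\<close>)
      then have "((\<lambda>x. x) has_derivative (\<lambda>h. ?Du (0, z0) (0, h))) (at z0)"
        by (rule has_derivative_transform_within_open[OF _ open_ball z0r]) (rule u(5))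
      from has_derivative_unique[OF this has_derivative_ident] show ?thesis by metis
    qed
    have "h = 0" if h: "?D\<Psi> (0, 0) h = 0" for h
    proof -
      have "fst h = 0" using D\<Psi>_T[OF N0, of h] h linear_0[OF \<omega>_lin, of z0] z0 \<Psi>0 by simp
      then have "l (snd h) = 0" using D\<Psi>[OF N0, of h] h lK Du0 by (simp add: m0 l0)
      then have "snd h = 0" using l(3)[of "snd h"] by simp
      then show ?thesis using \<open>fst h = 0\<close> by (simp add: prod_eq_iff)
    qed
    then show ?thesis using linear_injective_0[OF lin] by blast
  qed
  moreover have "DIM(real \<times> 'f) = DIM('e)" using dim dim_model by simp
  ultimately obtain U' V h where UV: "open U'" "(0, 0) \<in> U'" "U' \<subseteq> N" "open V" "homeomorphism U' V \<Psi> h" "smooth_on V h"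
    using smooth_inverse_function[OF oN N0 \<Psi>_sm] by metis
  obtain a r where ar: "a > 0" "r > 0" "{-a<..<a} \<times> ball 0 r \<subseteq> U'" using open_contains_box[OF UV(1,2)] .
  define W where "W = {-a<..<a} \<times> ball (0::'f) r"
  have W: "open W" "W \<subseteq> U'" "W \<subseteq> N" using ar UV by (auto simp: W_def intro: open_Times)
  have \<Psi>WV: "\<Psi> ` W \<subseteq> V" using homeomorphism_image1[OF UV(5)] W by auto
  have "openin (top_of_set V) (\<Psi> ` W)"
    by (rule homeomorphism_imp_open_map[OF UV(5)]) (use W in \<open>simp add: open_subset\<close>)
  then have o\<Psi>W: "open (\<Psi> ` W)" using UV(4) openin_open_eq by blast
  have \<Psi>W\<Omega>: "\<Psi> ` W \<subseteq> snd c ` fst c" using \<Psi>_R W(3) R(2) unfolding \<Omega>_def by blast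
  have h\<Psi>: "\<forall>z\<in>W. h (\<Psi> z) = z" using homeomorphism_apply1[OF UV(5)] W(2) by blast
  define G where "G = ({q \<in> fst c. snd c q \<in> \<Psi> ` W}, h \<circ> snd c)"
  note G = compatible_chart_compose[OF c W(1) o\<Psi>W \<Psi>W\<Omega> smooth_on_subset[OF \<Psi>_sm W(3)]
      smooth_on_subset[OF UV(6) \<Psi>WV] h\<Psi>, folded G_def]
  have Gc: "fst G \<subseteq> fst c" by (auto simp: G_def)
  have GN: "snd G q \<in> N" if "q \<in> fst G" for q using G(2) that W(3) by blast
  show thesis
  proof (rule that[OF G(1) _ ar(1,2)])
    have "(0, 0) \<in> W" using ar by (simp add: W_def)
    then show "p0 \<in> fst G" unfolding G_def using cA(2) \<Psi>0 by (auto simp: z0_def image_iff intro!: bexI[of _ "(0, 0)"])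
    show "snd G ` fst G = {-a<..<a} \<times> ball 0 r" using G(2) by (simp add: W_def)
    fix q assume q: "q \<in> fst G"
    then have qc: "q \<in> fst c" using Gc by auto
    show "\<xi> q = chart_vec A G q (1, 0)"
      unfolding G(4)[OF q] D\<Psi>_t[OF GN[OF q]] G(5)[OF q] by (rule \<xi>_xi[OF qc])
    show "\<eta> q (chart_vec A G q (\<tau>, w)) = \<tau>" for \<tau> w
      using D\<Psi>_T[OF GN[OF q], of "(\<tau>, w)"] qc ch unfolding G(4)[OF q] G(5)[OF q] by (simp add: \<omega>_def)
  qed
qed

end

subsection \<open>The local product structure\<close>

lemma chart_comp_tcomb: "chart_comp H (tcomb a u b v) = a *\<^sub>R chart_comp H u + b *\<^sub>R chart_comp H v"
  unfolding chart_comp_def tcomb_def by (simp add: scaleR_left_distrib sum.distrib scaleR_sum_right)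

lemma chart_comp_tzero: "chart_comp H tzero = 0"
  unfolding chart_comp_def tzero_def by simp

lemma frechet_derivative_lift:
  assumes "(x has_derivative D) (at (snd z))"
  shows "frechet_derivative (\<lambda>z. (0::real, x (snd z))) (at z) h = (0, D (snd h))"
proof -
  have "((\<lambda>z. x (snd z)) has_derivative (\<lambda>h. D (snd h))) (at z)"
    by (rule has_derivative_compose[OF has_derivative_snd[OF has_derivative_ident] assms])
  then have "((\<lambda>z. (0::real, x (snd z))) has_derivative (\<lambda>h. (0, D (snd h)))) (at z)"
    by (intro has_derivative_Pair has_derivative_const)
  from frechet_derivative_at[OF this, symmetric] show ?thesis by simp
qed

locale reeb_coordinates = almost_coKaehler_manifold n A \<phi> \<xi> \<eta> g
  for n :: nat
    and A :: "('a::{t2_space, second_countable_topology}, 'e::euclidean_space) chart set"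
    and \<phi> \<xi> \<eta> g +
  fixes G :: "('a, real \<times> 'f::euclidean_space) chart" and a r :: real
  assumes G: "compatible_chart A G" and a: "a > 0" and r: "r > 0"
    and G_img: "snd G ` fst G = {-a<..<a} \<times> ball 0 r"
    and \<xi>_G: "q \<in> fst G \<Longrightarrow> \<xi> q = chart_vec A G q (1, 0)"
    and \<eta>_G: "q \<in> fst G \<Longrightarrow> \<eta> q (chart_vec A G q (\<tau>, w)) = \<tau>"
    and h0: "h_vanishes A \<phi> \<xi>"
begin

section \<open>The slice, its cylinders and lifted tangent vectors\<close>

abbreviation "Y\<^sub>0 \<equiv> ball (0::'f) r"
abbreviation "H \<equiv> (Y\<^sub>0, id :: 'f \<Rightarrow> 'f)"
abbreviation "B \<equiv> {H}"
abbreviation "pr q \<equiv> snd (snd G q)"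
abbreviation "cyl V \<equiv> {q \<in> fst G. pr q \<in> V}"
abbreviation "\<sigma> y \<equiv> chart_inv G (0, y)"
abbreviation "lift q u \<equiv> chart_vec A G q (0, chart_comp H u)"
abbreviation "lift_field X \<equiv> (\<lambda>q. lift q (X (pr q)))"

text \<open>The metric induced on the slice t = 0. The slice is carried over to a ball in the model
  space with the identity chart, so the second factor has points of type 'f.\<close>

definition k :: "'f \<Rightarrow> 'f tvec \<Rightarrow> 'f tvec \<Rightarrow> real" where
  "k y u v = g (\<sigma> y) (lift (\<sigma> y) u) (lift (\<sigma> y) v)"

text \<open>Discarding the t-component loses nothing: the image of \<phi> lies in the kernel of
  \<eta>, and \<eta> = dt.\<close>

definition J :: "'f \<Rightarrow> 'f tvec \<Rightarrow> 'f tvec" where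
  "J y u = chart_vec B H y (snd (chart_comp G (\<phi> (\<sigma> y) (lift (\<sigma> y) u))))"

lemma B_manifold: "manifold B"
  by (rule manifold_id) (use r in auto)

sublocale B: manifold B by (rule B_manifold)

lemma H: "compatible_chart B H" by (rule B.atlas_compatible) simp

lemma points_B: "points B = Y\<^sub>0" unfolding points_def by simp

lemma chG: "is_chart G" by (rule compatible_is_chart[OF G])

lemma G_points: "q \<in> fst G \<Longrightarrow> q \<in> points A" using G unfolding compatible_chart_def by auto

lemma \<sigma>: "y \<in> Y\<^sub>0 \<Longrightarrow> \<sigma> y \<in> fst G" "y \<in> Y\<^sub>0 \<Longrightarrow> snd G (\<sigma> y) = (0, y)"
proof -
  assume "y \<in> Y\<^sub>0"
  then have "(0, y) \<in> snd G ` fst G" unfolding G_img using a by simp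
  then show "\<sigma> y \<in> fst G" "snd G (\<sigma> y) = (0, y)" using chG by auto
qed

lemma pr_in: "q \<in> fst G \<Longrightarrow> pr q \<in> Y\<^sub>0"
proof -
  assume "q \<in> fst G"
  then have "snd G q \<in> snd G ` fst G" by blast
  then show "pr q \<in> Y\<^sub>0" unfolding G_img mem_Times_iff by blast
qed

lemma cyl_open: "open V \<Longrightarrow> open (cyl V)"
  using chart_preimage_open[OF chG, of "UNIV \<times> V"] by (simp add: open_Times mem_Times_iff)

lemma cyl_img: "V \<subseteq> Y\<^sub>0 \<Longrightarrow> snd G ` cyl V = {-a<..<a} \<times> V"
proof
  assume V: "V \<subseteq> Y\<^sub>0"
  show "snd G ` cyl V \<subseteq> {-a<..<a} \<times> V"
  proof
    fix z assume "z \<in> snd G ` cyl V"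
    then have "z \<in> snd G ` fst G" "snd z \<in> V" by auto
    then show "z \<in> {-a<..<a} \<times> V" unfolding G_img by (simp add: mem_Times_iff)
  qed
  show "{-a<..<a} \<times> V \<subseteq> snd G ` cyl V"
  proof
    fix z assume z: "z \<in> {-a<..<a} \<times> V"
    then have "z \<in> snd G ` fst G" using V unfolding G_img by auto
    then show "z \<in> snd G ` cyl V" using z by (auto simp: mem_Times_iff)
  qed
qed

lemma lift_in: "q \<in> fst G \<Longrightarrow> lift q u \<in> tangent_space A q"
  by (rule chart_vec_in[OF G])

lemma lift_tcomb: "q \<in> fst G \<Longrightarrow> lift q (tcomb s u t v) = tcomb s (lift q u) t (lift q v)"
  by (simp add: tcomb_chart_vec[OF G] chart_comp_tcomb)

lemma lift_inj:
  assumes "q \<in> fst G" "y \<in> Y\<^sub>0" "u \<in> tangent_space B y" "v \<in> tangent_space B y" "lift q u = lift q v"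
  shows "u = v"
proof -
  have "chart_comp G (lift q u) = chart_comp G (lift q v)" using assms(5) by (rule arg_cong)
  then have "chart_vec B H y (chart_comp H u) = chart_vec B H y (chart_comp H v)"
    by (simp add: chart_comp_vec[OF G assms(1)])
  then show ?thesis using assms(2-4) by (simp add: B.chart_vec_comp[OF H])
qed

lemma fst_chart_comp: "q \<in> fst G \<Longrightarrow> v \<in> tangent_space A q \<Longrightarrow> fst (chart_comp G v) = \<eta> q v"
  using \<eta>_G[of q "fst (chart_comp G v)" "snd (chart_comp G v)"] by (simp add: chart_vec_comp[OF G])

lemma \<eta>_lift: "q \<in> fst G \<Longrightarrow> \<eta> q (lift q u) = 0"
  by (rule \<eta>_G)

lemma lift_field_smooth_comp:
  assumes X: "vector_field_on B V X"
  shows "smooth_on V (\<lambda>y. chart_comp H (X y))" "V \<subseteq> Y\<^sub>0" "open V"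
proof -
  show V: "V \<subseteq> Y\<^sub>0" "open V"
    using B.vector_field_on_points[OF X] B.vector_field_on_open[OF X] by (auto simp: points_B)
  have "smooth_on (id ` V) (\<lambda>z. chart_comp H (X (chart_inv H z)))"
    using B.vector_field_on_comp[OF H X] V by simp
  then have "smooth_on V (\<lambda>z. chart_comp H (X (chart_inv H z)))" by simp
  then show "smooth_on V (\<lambda>y. chart_comp H (X y))"
    by (rule smooth_on_transform[OF V(2)]) (use V(1) in auto)
qed

lemma lift_smooth:
  assumes X: "vector_field_on B V X"
  shows "smooth_on (snd G ` cyl V) (\<lambda>z. (0::real, chart_comp H (X (snd z))))"
proof -
  note c = lift_field_smooth_comp[OF X]
  have o: "open ({-a<..<a} \<times> V)" using c(3) by (intro open_Times) auto
  show ?thesis unfolding cyl_img[OF c(2)]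
    by (intro smooth_on_Pair o smooth_on_const smooth_on_compose[OF o c(3,1)] smooth_on_linear linear_fst_snd) auto
qed

lemma lift_field_vf:
  assumes X: "vector_field_on B V X"
  shows "vector_field_on A (cyl V) (lift_field X)"
  by (rule vector_field_on_chart_vec[OF G cyl_open[OF lift_field_smooth_comp(3)[OF X]] _ lift_smooth[OF X]]) auto

lemma slice_smooth:
  assumes V: "open V" "V \<subseteq> Y\<^sub>0" and F: "smooth_on (snd G ` cyl V) F"
  shows "smooth_on V (\<lambda>y. F (0, y))"
proof (rule smooth_on_compose[OF V(1) _ F])
  show "open (snd G ` cyl V)" by (rule chart_image_open[OF chG cyl_open[OF V(1)]]) auto
  show "smooth_on V (\<lambda>y. (0::real, y))" by (intro smooth_on_Pair V smooth_on_const smooth_on_id)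
  show "(\<lambda>y. (0, y)) ` V \<subseteq> snd G ` cyl V" unfolding cyl_img[OF V(2)] using a by auto
qed

lemma smooth_fun_on_B:
  assumes V: "open V" "V \<subseteq> Y\<^sub>0" and F: "smooth_on V F"
  shows "smooth_fun_on B V F"
proof -
  have "smooth_on V (F \<circ> chart_inv H)"
    by (rule smooth_on_transform[OF V(1) F]) (use V(2) in auto)
  then show ?thesis using V by (subst B.smooth_fun_on_chart[OF H]) auto
qed

text \<open>The coordinates map a cylinder onto a full interval times V, so the segment in t from q
  to the slice stays in it, and along this segment f has derivative 0.\<close>

lemma constant_along_\<xi>:
  assumes V: "open V" "V \<subseteq> Y\<^sub>0" and f: "smooth_fun_on A (cyl V) f" and 0: "\<And>q. q \<in> cyl V \<Longrightarrow> \<xi> q f = 0"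
    and q: "q \<in> cyl V"
  shows "f q = f (\<sigma> (pr q))"
proof -
  let ?F = "f \<circ> chart_inv G"
  have fs: "smooth_on (snd G ` cyl V) ?F" using f by (subst (asm) smooth_fun_on_chart[OF G]) auto
  obtain t y where ty: "snd G q = (t, y)" by (cases "snd G q")
  have "(t, y) \<in> snd G ` cyl V" using imageI[OF q, of "snd G"] unfolding ty .
  then have tV: "t \<in> {-a<..<a}" "y \<in> V" unfolding cyl_img[OF V(2)] by auto
  have "((\<lambda>s. ?F (s, y)) has_vector_derivative 0) (at s within {-a<..<a})" if s: "s \<in> {-a<..<a}" for s
  proof -
    have "(s, y) \<in> snd G ` cyl V" unfolding cyl_img[OF V(2)] using s tV by auto
    then obtain p where p: "p \<in> cyl V" "snd G p = (s, y)" unfolding image_iff by force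
    have pG: "p \<in> fst G" using p by auto
    have "((\<lambda>s. ?F (s, y)) has_derivative (\<lambda>h. chart_vec A G p (h, 0) f)) (at s)"
      by (rule has_derivative_compose[where f = "\<lambda>s. (s, y)" and g = ?F])
        (use chart_near_derivative[OF G pG smooth_near_on[OF f p(1)]] p(2) in \<open>auto intro!: derivative_eq_intros\<close>)
    moreover have "chart_vec A G p (h, 0) f = h *\<^sub>R 0" for h
    proof -
      have "chart_vec A G p (h, 0) = tcomb h (\<xi> p) 0 (\<xi> p)"
        unfolding \<xi>_G[OF pG] by (simp add: tcomb_chart_vec[OF G pG])
      then show ?thesis using 0[OF p(1)] by (simp add: tcomb_def)
    qed
    ultimately show ?thesis unfolding has_vector_derivative_def by (simp add: has_derivative_at_withinI)
  qed
  then have "?F (t, y) = ?F (0, y)"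
  proof (rule has_vector_derivative_zero_constant[OF convex_real_interval(8)])
    fix c assume c: "\<And>s. s \<in> {-a<..<a} \<Longrightarrow> ?F (s, y) = c"
    show ?thesis using c[OF tV(1)] c[of 0] a by simp
  qed
  moreover have "chart_inv G (t, y) = q" using chart_inv_chart[OF chG, of q] q ty by simp
  ultimately show ?thesis by (simp add: ty)
qed

text \<open>Both \<xi> and X have components independent of t, and \<xi> has constant ones; hence
  they commute.\<close>

lemma L_lift:
  assumes V: "open V" and x: "smooth_on (snd G ` cyl V) (\<lambda>z. (0::real, x (snd z)))"
    and X: "\<And>q. q \<in> cyl V \<Longrightarrow> X q = chart_vec A G q (0, x (pr q))"
    and x': "smooth_on V x" and q: "q \<in> cyl V"
  shows "L X q = tzero"
proof -
  have D: "(x has_derivative frechet_derivative x (at (pr q))) (at (snd (snd G q)))"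
    by (rule smooth_on_has_derivative[OF x']) (use q in auto)
  have lin: "linear (frechet_derivative x (at (pr q)))" by (rule smooth_on_frechet_linear[OF x']) (use q in auto)
  have "L X q = chart_vec A G q (frechet_derivative (\<lambda>z. (0::real, x (snd z))) (at (snd G q)) (1, 0)
      - frechet_derivative (\<lambda>z. (1::real, 0::'f)) (at (snd G q)) (0, x (pr q)))"
    by (rule lie_bracket_chart[where x = "\<lambda>z. (1, 0)" and y = "\<lambda>z. (0, x (snd z))",
          OF G cyl_open[OF V] _ q smooth_on_const _ x]) (use \<xi>_G X in auto)
  also have "\<dots> = chart_vec A G q 0" by (simp add: frechet_derivative_lift[OF D] linear_0[OF lin] zero_prod_def)
  also have "\<dots> = tzero" by (rule chart_vec_zero[OF G]) (use q in auto)
  finally show ?thesis .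
qed

lemma L_lift_field:
  assumes X: "vector_field_on B V X" and q: "q \<in> cyl V"
  shows "L (lift_field X) q = tzero"
  using L_lift[OF lift_field_smooth_comp(3)[OF X] lift_smooth[OF X] refl lift_field_smooth_comp(1)[OF X] q] .

text \<open>Both brackets have the same coordinate formula; the t-components of the lifts are
  constantly 0 and stay so. This matches the bracket terms of the exterior derivatives on the slice
  and on the manifold.\<close>

lemma lift_bracket:
  assumes X: "vector_field_on B V X" and Y: "vector_field_on B V Y" and y: "y \<in> V"
  shows "lift (\<sigma> y) (lie_bracket B X Y y) = lie_bracket A (lift_field X) (lift_field Y) (\<sigma> y)"
proof -
  note cX = lift_field_smooth_comp[OF X] and cY = lift_field_smooth_comp[OF Y]
  have yY: "y \<in> Y\<^sub>0" using y cX by auto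
  note s = \<sigma>[OF yY]
  let ?x = "\<lambda>y. chart_comp H (X y)" and ?y = "\<lambda>y. chart_comp H (Y y)"
  have rep: "Z q = chart_vec B H q (chart_comp H (Z (snd H q)))" if "vector_field_on B V Z" "q \<in> V" for Z q
    using B.chart_vec_comp[OF H _ B.vector_field_on_in[OF that]] cX(2) that(2) by auto
  have "lie_bracket B X Y y = chart_vec B H y
      (frechet_derivative ?y (at (snd H y)) (?x (snd H y)) - frechet_derivative ?x (at (snd H y)) (?y (snd H y)))"
    by (rule B.lie_bracket_chart[where x = ?x and y = ?y, OF H cX(3) _ y])
      (use cX cY rep[OF X] rep[OF Y] in simp_all)
  then have 1: "chart_comp H (lie_bracket B X Y y) = frechet_derivative ?y (at y) (?x y) - frechet_derivative ?x (at y) (?y y)"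
    using B.chart_comp_vec[OF H, of y] yY by simp
  have sy: "\<sigma> y \<in> cyl V" using s y by simp
  have "lie_bracket A (lift_field X) (lift_field Y) (\<sigma> y) = chart_vec A G (\<sigma> y)
      (frechet_derivative (\<lambda>z. (0::real, ?y (snd z))) (at (snd G (\<sigma> y))) (0, ?x (pr (\<sigma> y)))
      - frechet_derivative (\<lambda>z. (0::real, ?x (snd z))) (at (snd G (\<sigma> y))) (0, ?y (pr (\<sigma> y))))"
    by (rule lie_bracket_chart[OF G cyl_open[OF cX(3)] _ sy lift_smooth[OF X] refl lift_smooth[OF Y] refl]) auto
  moreover have "(?x has_derivative frechet_derivative ?x (at y)) (at (snd (0::real, y)))"
    "(?y has_derivative frechet_derivative ?y (at y)) (at (snd (0::real, y)))"
    using smooth_on_has_derivative[OF cX(1) y] smooth_on_has_derivative[OF cY(1) y] by simp_all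
  note this[THEN frechet_derivative_lift]
  ultimately show ?thesis by (simp add: s 1)
qed

lemma \<phi>_lift:
  assumes y: "y \<in> Y\<^sub>0"
  shows "\<phi> (\<sigma> y) (lift (\<sigma> y) u) = lift (\<sigma> y) (J y u)"
proof -
  note s = \<sigma>(1)[OF y]
  let ?v = "\<phi> (\<sigma> y) (lift (\<sigma> y) u)"
  have v: "?v \<in> tangent_space A (\<sigma> y)" by (rule \<phi>_in[OF G_points[OF s] lift_in[OF s]])
  have "fst (chart_comp G ?v) = 0"
    using fst_chart_comp[OF s v] \<eta>_\<phi>[OF G_points[OF s] lift_in[OF s]] by simp
  then have "chart_comp G ?v = (0, snd (chart_comp G ?v))" by (metis prod.collapse)
  moreover have "chart_comp H (J y u) = snd (chart_comp G ?v)"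
    unfolding J_def using y by (intro B.chart_comp_vec[OF H]) simp
  ultimately show ?thesis using chart_vec_comp[OF G s v] by metis
qed

lemma J_in: "y \<in> Y\<^sub>0 \<Longrightarrow> J y u \<in> tangent_space B y"
  unfolding J_def by (intro B.chart_vec_in[OF H]) simp

section \<open>The almost Kaehler structure of the slice\<close>

lemma k_smooth:
  assumes X: "vector_field_on B V X" and Y: "vector_field_on B V Y"
  shows "smooth_fun_on B V (\<lambda>y. k y (X y) (Y y))"
proof -
  note V = lift_field_smooth_comp(3,2)[OF X]
  have "smooth_fun_on A (cyl V) (\<lambda>q. g q (lift_field X q) (lift_field Y q))"
    by (rule g_smooth[OF lift_field_vf[OF X] lift_field_vf[OF Y]])
  then have "smooth_on (snd G ` cyl V) ((\<lambda>q. g q (lift_field X q) (lift_field Y q)) \<circ> chart_inv G)"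
    by (subst (asm) smooth_fun_on_chart[OF G]) auto
  from slice_smooth[OF V this]
  have "smooth_on V (\<lambda>y. k y (X y) (Y y))"
    by (rule smooth_on_transform[OF V(1)]) (use V(2) \<sigma> in \<open>auto simp: k_def subset_iff simp del: mem_ball\<close>)
  then show ?thesis by (rule smooth_fun_on_B[OF V])
qed

lemma J_smooth:
  assumes X: "vector_field_on B V X"
  shows "vector_field_on B V (\<lambda>y. J y (X y))"
proof -
  note V = lift_field_smooth_comp(3,2)[OF X]
  let ?w = "\<lambda>z. snd (chart_comp G (\<phi> (chart_inv G z) (lift_field X (chart_inv G z))))"
  have o: "open (snd G ` cyl V)" by (rule chart_image_open[OF chG cyl_open[OF V(1)]]) auto
  have "smooth_on (snd G ` cyl V) ?w"
    using vector_field_on_comp[OF G \<phi>_vf[OF lift_field_vf[OF X]]] by (intro smooth_on_snd[OF o]) auto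
  from slice_smooth[OF V this]
  have w: "smooth_on (snd H ` V) (\<lambda>y. ?w (0, y))" by simp
  show ?thesis
  proof (rule B.vector_field_on_chart_vec[where w = "\<lambda>y. ?w (0, y)", OF H V(1) _ w])
    show "V \<subseteq> fst H" using V by simp
    fix y assume "y \<in> V"
    then have "y \<in> Y\<^sub>0" using V by auto
    then show "J y (X y) = chart_vec B H y (?w (0, snd H y))" by (simp add: J_def \<sigma>(2) del: mem_ball)
  qed
qed

text \<open>Lifted fields commute with \<xi> and \<Phi> is invariant, so \<Phi> on two lifts does
  not depend on t. Equality on the whole cylinder, not just on the slice, is what permits
  differentiating it.\<close>

lemma \<Phi>_lift_eq:
  assumes X: "vector_field_on B V X" and Y: "vector_field_on B V Y" and q: "q \<in> cyl V"
  shows "on_fields (fundamental_form \<phi> g) (lift_field X) (lift_field Y) q =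
    on_fields (fundamental_form J k) X Y (pr q)"
proof -
  note V = lift_field_smooth_comp(3,2)[OF X] and lX = lift_field_vf[OF X] and lY = lift_field_vf[OF Y]
  let ?f = "\<lambda>q. g q (lift_field X q) (\<phi> q (lift_field Y q))"
  have "\<xi> p ?f = 0" if p: "p \<in> cyl V" for p
  proof -
    have pG: "p \<in> fst G" using p by auto
    show ?thesis
      unfolding \<xi>_\<Phi>[OF lX lY p] L_lift_field[OF X p] L_lift_field[OF Y p] \<phi>_tzero[OF G_points[OF pG]]
      using g_tzero[OF G_points[OF pG]] \<phi>_in[OF G_points[OF pG]] lift_in[OF pG] by simp
  qed
  then have "?f q = ?f (\<sigma> (pr q))"
    by (rule constant_along_\<xi>[OF V g_smooth[OF lX \<phi>_vf[OF lY]] _ q])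
  moreover have y: "pr q \<in> Y\<^sub>0" using q pr_in by auto
  ultimately show ?thesis
    unfolding on_fields_def fundamental_form_def k_def using \<phi>_lift[OF y] \<sigma>(2)[OF y] by simp
qed

text \<open>The chain rule for the projection (t, y) to y: a lifted vector differentiates a function
  pulled back from the slice as the vector itself differentiates the original.\<close>

lemma lift_apply:
  assumes V: "open V" "V \<subseteq> Y\<^sub>0" "y \<in> V" and f: "\<And>q. q \<in> cyl V \<Longrightarrow> f q = F (pr q)" and F: "smooth_fun_on B V F"
    and u: "u \<in> tangent_space B y"
  shows "lift (\<sigma> y) u f = u F"
proof -
  have yY: "y \<in> Y\<^sub>0" using V by auto
  note s = \<sigma>[OF yY]
  have "smooth_on V (F \<circ> chart_inv H)" using F B.smooth_fun_on_chart[OF H, of V F] V(2) by simp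
  then have F': "smooth_on V F" by (rule smooth_on_transform[OF V(1)]) (use V(2) in auto)
  have o: "open (snd G ` cyl V)" by (rule chart_image_open[OF chG cyl_open[OF V(1)]]) auto
  have sm: "smooth_on (snd G ` cyl V) (\<lambda>z. F (snd z))"
    by (rule smooth_on_compose[OF o V(1) F' smooth_on_linear[OF linear_fst_snd(2)]]) (auto simp: cyl_img[OF V(2)])
  have "lift (\<sigma> y) u f = frechet_derivative (\<lambda>z. F (snd z)) (at (snd G (\<sigma> y))) (0, chart_comp H u)"
    by (rule chart_vec_apply[OF G cyl_open[OF V(1)] _ _ sm f]) (use s V(3) in auto)
  also have "((\<lambda>z. F (snd z)) has_derivative (\<lambda>h. frechet_derivative F (at y) (snd h))) (at (snd G (\<sigma> y)))"
    by (rule has_derivative_compose[OF has_derivative_snd[OF has_derivative_ident]])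
      (use smooth_on_has_derivative[OF F' V(3)] s in simp)
  from frechet_derivative_at[OF this, symmetric]
  have "frechet_derivative (\<lambda>z. F (snd z)) (at (snd G (\<sigma> y))) (0, chart_comp H u) =
      frechet_derivative F (at y) (chart_comp H u)" by simp
  also have "\<dots> = chart_vec B H y (chart_comp H u) F"
    using B.chart_vec_apply[OF H V(1) _ V(3), of F F "chart_comp H u"] V(2) F' by simp
  also have "\<dots> = u F" using B.chart_vec_comp[OF H _ u] yY by simp
  finally show ?thesis .
qed

text \<open>Each of the six terms of the exterior derivative on the slice equals the corresponding
  term for the lifted fields at \<sigma> y: derivatives through pullback, brackets through
  compatibility with lifting.\<close>

lemma \<Phi>_B_closed: "closed_2 B (fundamental_form J k)"
  unfolding closed_2_def
proof (intro allI impI ballI)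
  fix V X Y Z y
  assume X: "vector_field_on B V X" and Y: "vector_field_on B V Y" and Z: "vector_field_on B V Z" and y: "y \<in> V"
  note V = lift_field_smooth_comp(3,2)[OF X]
  have yY: "y \<in> Y\<^sub>0" using y V by auto
  note s = \<sigma>[OF yY]
  have sy: "\<sigma> y \<in> cyl V" using s y by simp
  let ?\<Phi> = "fundamental_form \<phi> g" and ?\<omega> = "fundamental_form J k"
  have der: "lift_field X (\<sigma> y) (on_fields ?\<Phi> (lift_field Y) (lift_field Z)) = X y (on_fields ?\<omega> Y Z)"
    if X: "vector_field_on B V X" and Y: "vector_field_on B V Y" and Z: "vector_field_on B V Z" for X Y Z
  proof -
    have "smooth_fun_on B V (on_fields ?\<omega> Y Z)"
      unfolding on_fields_def fundamental_form_def by (rule k_smooth[OF Y J_smooth[OF Z]])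
    from lift_apply[OF V y \<Phi>_lift_eq[OF Y Z] this B.vector_field_on_in[OF X y]]
    show ?thesis by (simp add: s)
  qed
  have br: "on_fields ?\<Phi> (lie_bracket A (lift_field X) (lift_field Y)) (lift_field Z) (\<sigma> y) =
      on_fields ?\<omega> (lie_bracket B X Y) Z y"
    if X: "vector_field_on B V X" and Y: "vector_field_on B V Y" and Z: "vector_field_on B V Z" for X Y Z
    unfolding on_fields_def fundamental_form_def k_def
    by (simp add: lift_bracket[OF X Y y, symmetric] s \<phi>_lift[OF yY])
  have "ext_deriv_2 A ?\<Phi> (lift_field X) (lift_field Y) (lift_field Z) (\<sigma> y) = 0"
    using \<Phi>_closed lift_field_vf[OF X] lift_field_vf[OF Y] lift_field_vf[OF Z] sy unfolding closed_2_def by blast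
  then show "ext_deriv_2 B ?\<omega> X Y Z y = 0"
    unfolding ext_deriv_2_def der[OF X Y Z] der[OF Y Z X] der[OF Z X Y] br[OF X Y Z] br[OF Y Z X] br[OF Z X Y] .
qed

text \<open>The identities are checked after lifting, which is injective. Since \<eta> vanishes on
  lifts, the \<xi>-term in the square of \<phi> and the \<eta>-term in the compatibility with g
  disappear, leaving the Hermitian equations.\<close>

lemma almost_Kaehler_slice: "almost_Kaehler B J k"
proof -
  have k_lin: "k y (tcomb s u t v) w = s * k y u w + t * k y v w" if y: "y \<in> Y\<^sub>0" for y s t u v w
    unfolding k_def lift_tcomb[OF \<sigma>(1)[OF y]]
    by (intro g_tcomb_left G_points \<sigma>(1)[OF y] lift_in)
  have k_sym: "k y u v = k y v u" if y: "y \<in> Y\<^sub>0" for y u v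
    unfolding k_def by (intro g_sym G_points \<sigma>(1)[OF y] lift_in)
  have k_pos: "k y u u > 0" if y: "y \<in> Y\<^sub>0" and u: "u \<in> tangent_space B y" "u \<noteq> tzero" for y u
  proof -
    have "lift (\<sigma> y) tzero = tzero"
      using chart_vec_zero[OF G \<sigma>(1)[OF y]] by (simp add: chart_comp_tzero zero_prod_def)
    then have "lift (\<sigma> y) u \<noteq> tzero"
      using lift_inj[OF \<sigma>(1)[OF y] y u(1) B.tzero_in] u(2) by auto
    then show ?thesis unfolding k_def by (intro g_pos G_points \<sigma>(1)[OF y] lift_in)
  qed
  have J_lin: "J y (tcomb s u t v) = tcomb s (J y u) t (J y v)" if y: "y \<in> Y\<^sub>0" for y s t u v
  proof (rule lift_inj[OF \<sigma>(1)[OF y] y J_in[OF y] B.tcomb_in[OF J_in[OF y] J_in[OF y]]])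
    note s = \<sigma>(1)[OF y]
    show "lift (\<sigma> y) (J y (tcomb s u t v)) = lift (\<sigma> y) (tcomb s (J y u) t (J y v))"
      unfolding \<phi>_lift[OF y, symmetric] lift_tcomb[OF s] by (rule \<phi>_tcomb[OF G_points[OF s] lift_in[OF s] lift_in[OF s]])
  qed
  have J_J: "J y (J y v) = tcomb (- 1) v 0 v" if y: "y \<in> Y\<^sub>0" and v: "v \<in> tangent_space B y" for y v
  proof (rule lift_inj[OF \<sigma>(1)[OF y] y J_in[OF y] B.tcomb_in[OF v v]])
    note s = \<sigma>(1)[OF y]
    have "lift (\<sigma> y) (J y (J y v)) = tcomb (- 1) (lift (\<sigma> y) v) 0 (\<xi> (\<sigma> y))"
      unfolding \<phi>_lift[OF y, symmetric] using \<phi>_\<phi>[OF G_points[OF s] lift_in[OF s]] \<eta>_lift[OF s] by simp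
    then show "lift (\<sigma> y) (J y (J y v)) = lift (\<sigma> y) (tcomb (- 1) v 0 v)"
      unfolding lift_tcomb[OF s] by (simp add: tcomb_def)
  qed
  have k_J: "k y (J y u) (J y v) = k y u v" if y: "y \<in> Y\<^sub>0" for y u v
  proof -
    note s = \<sigma>(1)[OF y]
    show ?thesis unfolding k_def \<phi>_lift[OF y, symmetric]
      using g_\<phi>_\<phi>[OF G_points[OF s] lift_in[OF s] lift_in[OF s]] \<eta>_lift[OF s] by simp
  qed
  have "riemannian_metric B k"
    unfolding riemannian_metric_def points_B using k_lin k_sym k_pos k_smooth by blast
  moreover have "endomorphism_field B J"
    unfolding endomorphism_field_def points_B using J_in J_lin J_smooth by blast
  ultimately show ?thesis
    unfolding almost_Kaehler_def points_B using B.mfd J_J k_J \<Phi>_B_closed by blast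
qed

text \<open>Here h = 0 enters: it gives T = 0, and since the constant coordinate fields commute with
  \<xi>, the components of g in the y-directions do not depend on t.\<close>

lemma g_lift_eq:
  assumes q: "q \<in> fst G"
  shows "g q (chart_vec A G q (0, u)) (chart_vec A G q (0, v)) =
    g (\<sigma> (pr q)) (chart_vec A G (\<sigma> (pr q)) (0, u)) (chart_vec A G (\<sigma> (pr q)) (0, v))"
proof -
  let ?E = "\<lambda>u q. chart_vec A G q (0, u)"
  let ?f = "\<lambda>q. g q (?E u q) (?E v q)"
  have c: "cyl Y\<^sub>0 = fst G" using pr_in by auto
  have E: "vector_field_on A (cyl Y\<^sub>0) (?E u)" for u
    unfolding c by (rule vector_field_on_chart_vec[OF G is_chart_open(1)[OF chG] order_refl smooth_on_const refl])
  have LE: "L (?E u) p = tzero" if "p \<in> cyl Y\<^sub>0" for u p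
    by (rule L_lift[OF open_ball _ refl smooth_on_const that]) (rule smooth_on_const)
  have "\<xi> p ?f = 0" if p: "p \<in> cyl Y\<^sub>0" for p
  proof -
    have pG: "p \<in> fst G" using p by auto
    have "T (?E u) (?E v) p = 0" by (rule h_vanishes_T[OF h0 E E p])
    then show ?thesis
      unfolding lie_deriv_2_def on_fields_def LE[OF p]
      using g_tzero[OF G_points[OF pG] chart_vec_in[OF G pG]] by simp
  qed
  then show ?thesis
    by (rule constant_along_\<xi>[OF open_ball order_refl g_smooth[OF E E]]) (use q pr_in in auto)
qed

text \<open>The isometry is the chart G itself. A vector splits as \<tau> \<xi> plus a vector in the
  kernel of \<eta>, and these parts are orthogonal with \<xi> of length 1; the first part gives the
  metric of the line, and the second, moved along t to the slice, gives \<open>k\<close>.\<close>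

lemma locally_isometric_product:
  assumes p0: "p0 \<in> fst G"
  shows "locally_isometric_at A g (product_atlas real_line B)
    (product_metric real_line B real_line_metric k) p0"
proof -
  let ?S = "(UNIV :: real set) \<times> Y\<^sub>0"
  let ?C = "(?S, id :: real \<times> 'f \<Rightarrow> real \<times> 'f)"
  let ?W = "{-a<..<a} \<times> Y\<^sub>0"
  \<comment> \<open>Both factors have a single identity chart, so the product atlas is one identity
    chart as well.\<close>
  have PB: "product_atlas real_line B = {?C}"
    unfolding product_atlas_def real_line_def by (auto simp: map_prod.id)
  have oS: "open ?S" "open ?W" by (auto intro: open_Times)
  interpret PM: manifold "{?C}" by (rule manifold_id[OF oS(1)]) (use r in auto)
  interpret R: manifold real_line unfolding real_line_def by (rule manifold_id) auto
  have C: "compatible_chart {?C} ?C" by (rule PM.atlas_compatible) simp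
  have R: "compatible_chart real_line (UNIV, id)" by (rule R.atlas_compatible) (simp add: real_line_def)
  have hom: "homeomorphism (fst G) ?W (snd G) (chart_inv G)" using is_chart_homeomorphism[OF chG] unfolding G_img .
  have WS: "?W \<subseteq> ?S" by auto
  have dif: "diffeomorphism_on A {?C} (fst G) ?W (snd G)"
    unfolding diffeomorphism_on_def
  proof (intro exI[of _ "chart_inv G"] conjI)
    show "homeomorphism (fst G) ?W (snd G) (chart_inv G)" by (rule hom)
    show "smooth_map_on A {?C} (fst G) (snd G)"
      unfolding smooth_map_on_def
    proof (intro conjI ballI)
      show "open (fst G)" "fst G \<subseteq> points A" using is_chart_open(1)[OF chG] G_points by auto
      show "snd G ` fst G \<subseteq> points {?C}" unfolding G_img by (auto simp: points_def)
      show "continuous_on (fst G) (snd G)" by (rule homeomorphism_cont1[OF hom])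
      fix c d assume c: "c \<in> A" and d: "d \<in> {?C}"
      have "smooth_on (snd c ` (fst G \<inter> fst c)) (snd G \<circ> chart_inv c)"
        using G c unfolding compatible_chart_def by blast
      then show "smooth_on (snd c ` (fst c \<inter> fst G \<inter> snd G -` fst d)) (snd d \<circ> snd G \<circ> chart_inv c)"
        using d by (auto intro: smooth_on_subset simp: o_def)
    qed
    show "smooth_map_on {?C} A ?W (chart_inv G)"
      unfolding smooth_map_on_def
    proof (intro conjI ballI)
      show "open ?W" "?W \<subseteq> points {?C}" using oS by (auto simp: points_def)
      show "chart_inv G ` ?W \<subseteq> points A" using homeomorphism_image2[OF hom] G_points by auto
      show "continuous_on ?W (chart_inv G)" by (rule homeomorphism_cont2[OF hom])
      fix c d assume c: "c \<in> {?C}" and d: "d \<in> A"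
      have o: "open (snd G ` (fst G \<inter> fst d))"
        by (rule chart_image_open[OF chG]) (use is_chart_open(1)[OF chG] is_chart_open(1)[OF atlas_chart[OF d]] in auto)
      have "smooth_on (snd G ` (fst G \<inter> fst d)) (snd d \<circ> chart_inv G)"
        using G d unfolding compatible_chart_def by blast
      then have sm: "smooth_on (snd G ` (fst G \<inter> fst d)) (snd d \<circ> chart_inv G \<circ> chart_inv ?C)"
      proof (rule smooth_on_transform[OF o])
        fix z assume "z \<in> snd G ` (fst G \<inter> fst d)"
        then have "z \<in> snd G ` fst G" by blast
        then have "z \<in> ?S" unfolding G_img by blast
        then show "(snd d \<circ> chart_inv G) z = (snd d \<circ> chart_inv G \<circ> chart_inv ?C) z" by simp
      qed
      have "snd c ` (fst c \<inter> ?W \<inter> chart_inv G -` fst d) \<subseteq> snd G ` (fst G \<inter> fst d)"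
      proof
        fix z assume "z \<in> snd c ` (fst c \<inter> ?W \<inter> chart_inv G -` fst d)"
        then have z: "z \<in> ?W" "chart_inv G z \<in> fst d" using c by auto
        then have "snd G (chart_inv G z) = z" "chart_inv G z \<in> fst G"
          using homeomorphism_apply2[OF hom] homeomorphism_image2[OF hom] by auto
        then show "z \<in> snd G ` (fst G \<inter> fst d)" using z imageI[of "chart_inv G z" "fst G \<inter> fst d" "snd G"] by simp
      qed
      then show "smooth_on (snd c ` (fst c \<inter> ?W \<inter> chart_inv G -` fst d)) (snd d \<circ> chart_inv G \<circ> chart_inv c)"
        using c sm by (auto intro: smooth_on_subset)
    qed
  qed
  \<comment> \<open>In coordinates the chart becomes the identity and the two projections are
    linear, so the pushforwards just select components.\<close>
  have push: "pushforward {?C} (snd G) q (chart_vec A G q w) = chart_vec {?C} ?C (snd G q) w"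
    "pushforward real_line fst (snd G q) (chart_vec {?C} ?C (snd G q) w) id = fst w"
    "pushforward B snd (snd G q) (chart_vec {?C} ?C (snd G q) w) = chart_vec B H (pr q) (snd w)"
    if q: "q \<in> fst G" for q w
  proof -
    have qS: "snd G q \<in> ?S" using pr_in[OF q] by (simp add: mem_Times_iff)
    have id_der: "frechet_derivative (\<lambda>x. x) (at z) = (\<lambda>h. h)" for z :: "'b::real_normed_vector"
      using frechet_derivative_at[OF has_derivative_ident] by metis
    have fs_der: "frechet_derivative fst (at z) = fst" "frechet_derivative snd (at z) = snd" for z :: "real \<times> 'f"
      using frechet_derivative_at[OF bounded_linear_imp_has_derivative[OF bounded_linear_fst]]
        frechet_derivative_at[OF bounded_linear_imp_has_derivative[OF bounded_linear_snd]] by metis+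
    have smooth_fs: "smooth_on S fst" "smooth_on S snd" for S :: "(real \<times> 'f) set"
      by (rule smooth_on_linear[OF linear_fst_snd(1)], rule smooth_on_linear[OF linear_fst_snd(2)])
    have "snd G ` fst G \<subseteq> fst ?C" unfolding G_img by auto
    from pushforward_chart_vec[OF manifold_axioms PM.manifold_axioms G C is_chart_open(1)[OF chG] order_refl q this
        smooth_on_id, of w]
    show "pushforward {?C} (snd G) q (chart_vec A G q w) = chart_vec {?C} ?C (snd G q) w"
      by (simp add: id_der)
    have "pushforward real_line fst (snd G q) (chart_vec {?C} ?C (snd G q) w) =
        chart_vec real_line (UNIV, id) (fst (snd G q)) (fst w)"
      using pushforward_chart_vec[OF PM.manifold_axioms R.manifold_axioms C R, of ?S "snd G q" fst fst w]
        oS qS smooth_fs(1) by (simp add: fs_der)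
    moreover have "chart_vec real_line (UNIV, id) t \<tau> id = \<tau>" for t \<tau>
      using R.chart_vec_apply[OF R open_UNIV _ UNIV_I, of "\<lambda>x. x" id t \<tau>]
        smooth_on_id[of "UNIV :: real set"] by (simp add: id_der)
    ultimately show "pushforward real_line fst (snd G q) (chart_vec {?C} ?C (snd G q) w) id = fst w" by simp
    show "pushforward B snd (snd G q) (chart_vec {?C} ?C (snd G q) w) = chart_vec B H (pr q) (snd w)"
      using pushforward_chart_vec[OF PM.manifold_axioms B.manifold_axioms C H, of ?S "snd G q" snd snd w]
        oS qS smooth_fs(2) by (auto simp: fs_der simp del: mem_ball)
  qed
  have "g q u v = product_metric real_line B real_line_metric k (snd G q)
      (pushforward {?C} (snd G) q u) (pushforward {?C} (snd G) q v)"
    if q: "q \<in> fst G" and u: "u \<in> tangent_space A q" and v: "v \<in> tangent_space A q" for q u v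
  proof -
    note qA = G_points[OF q] and xi = \<xi>_in[OF G_points[OF q]]
    let ?E = "\<lambda>w. chart_vec A G q (0, w)"
    have E: "?E w \<in> tangent_space A q" for w by (rule chart_vec_in[OF G q])
    define \<tau> x where "\<tau> = fst (chart_comp G u)" and "x = snd (chart_comp G u)"
    define \<tau>' x' where "\<tau>' = fst (chart_comp G v)" and "x' = snd (chart_comp G v)"
    have u_eq: "u = chart_vec A G q (\<tau>, x)" and v_eq: "v = chart_vec A G q (\<tau>', x')"
      using chart_vec_comp[OF G q u] chart_vec_comp[OF G q v] by (simp_all add: \<tau>_def x_def \<tau>'_def x'_def)
    have split: "chart_vec A G q (\<tau>, x) = tcomb \<tau> (\<xi> q) 1 (?E x)" for \<tau> x
      unfolding \<xi>_G[OF q] by (simp add: tcomb_chart_vec[OF G q])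
    have g\<xi>E: "g q (\<xi> q) (?E w) = 0" "g q (?E w) (\<xi> q) = 0" for w
      using g_\<xi>[OF qA E] \<eta>_G[OF q] g_sym[OF qA E xi] by auto
    have "g q u v = \<tau> * g q (\<xi> q) v + g q (?E x) v"
      unfolding u_eq split[of \<tau>] using g_tcomb_left[OF qA xi E v] by simp
    also have "g q (\<xi> q) v = \<tau>'" using g_\<xi>[OF qA v] \<eta>_G[OF q] v_eq by simp
    also have "g q (?E x) v = g q (?E x) (?E x')"
      unfolding v_eq split[of \<tau>'] using g_tcomb_right[OF qA xi E E] g\<xi>E by simp
    also have "\<dots> = k (pr q) (chart_vec B H (pr q) x) (chart_vec B H (pr q) x')"
      unfolding k_def g_lift_eq[OF q, of x x'] using pr_in[OF q] by (simp add: B.chart_comp_vec[OF H] del: mem_ball)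
    finally show ?thesis
      unfolding product_metric_def real_line_metric_def u_eq v_eq push[OF q] by simp
  qed
  then show ?thesis
    unfolding locally_isometric_at_def PB using p0 dif by (intro exI[of _ "fst G"] exI[of _ ?W] exI[of _ "snd G"]) auto
qed

end

lemma (in almost_coKaehler_manifold) h_vanishes_locally_product:
  assumes h: "h_vanishes A \<phi> \<xi>" and dim: "DIM('f::euclidean_space) = 2 * n"
  shows "locally_real_line_times_almost_Kaehler TYPE('f) A g"
  unfolding locally_real_line_times_almost_Kaehler_def
proof
  fix p assume p: "p \<in> points A"
  obtain G :: "('a, real \<times> 'f) chart" and a r where G: "compatible_chart A G" "p \<in> fst G" "a > 0" "r > 0"
    "snd G ` fst G = {-a<..<a} \<times> ball 0 r"
    "\<And>q. q \<in> fst G \<Longrightarrow> \<xi> q = chart_vec A G q (1, 0)"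
    "\<And>q \<tau> w. q \<in> fst G \<Longrightarrow> \<eta> q (chart_vec A G q (\<tau>, w)) = \<tau>"
    by (rule reeb_chart_exists[OF p dim]) blast
  note pG = G(2)
  interpret reeb_coordinates n A \<phi> \<xi> \<eta> g G a r
    by unfold_locales (use G h in auto)
  show "\<exists>(B :: ('f, 'f) chart set) J k. almost_Kaehler B J k \<and>
      locally_isometric_at A g (product_atlas real_line B) (product_metric real_line B real_line_metric k) p"
    using almost_Kaehler_slice locally_isometric_product[OF pG] by blast
qed

theorem theorem5:
  fixes n :: nat
    and A :: "('a::{t2_space, second_countable_topology}, 'e::euclidean_space) chart set"
    and \<phi> :: "'a \<Rightarrow> 'a tvec \<Rightarrow> 'a tvec"
    and \<xi> :: "'a vfield"
    and \<eta> :: "'a \<Rightarrow> 'a tvec \<Rightarrow> real"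
    and g :: "'a \<Rightarrow> 'a tvec \<Rightarrow> 'a tvec \<Rightarrow> real"
  assumes "almost_coKaehler n A \<phi> \<xi> \<eta> g"
    and "DIM('f::euclidean_space) = 2 * n"
  shows "(mixed_killing A g \<xi> \<longleftrightarrow> h_vanishes A \<phi> \<xi>) \<and>
         (h_vanishes A \<phi> \<xi> \<longrightarrow> locally_real_line_times_almost_Kaehler TYPE('f) A g)"
proof -
  interpret almost_coKaehler_manifold n A \<phi> \<xi> \<eta> g by unfold_locales fact
  show ?thesis using mixed_killing_iff h_vanishes_locally_product[OF _ assms(2)] by blast
qed

end
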